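(* Let $q$ be an odd prime power, let $i\in I$ be a generator of the cyclic group $(\mathbb{F}_q^\infty,\psi)$ of order $q+1$, and let $\Gamma_i=\mathrm{Cay}(G,X_i)$ be the Cayley digraph over $G=H_3(q)$ defined in the context. Then $\dim_{\mathrm{WL}}(\Gamma_i)\leq 3$. Moreover, $\dim_{\mathrm{WL}}(\Gamma_i)=3$ if $q>9$ and $\dim_{\mathrm{WL}}(\Gamma_i)=2$ if $q=3$.
   Context: Let $q$ be an odd prime power, $\varepsilon\in\mathbb{F}_q$ a fixed nonsquare, and $G=H_3(q)$ the group of matrices $m(x,y,z)=\left(\begin{smallmatrix}1&x&z\\0&1&y\\0&0&1\end{smallmatrix}\right)$, $x,y,z\in\mathbb{F}_q$, with identity $e$. For $i\in\mathbb{F}_q$ put $Y_i=\{m(\alpha,\beta,\tfrac{\alpha\beta}{2}+(\alpha^2-\varepsilon\beta^2)i):(\alpha,\beta)\in\mathbb{F}_q^2\setminus\{(0,0)\}\}$, $X_i=Y_i\cup\{e\}$, and let $\Gamma_i=\mathrm{Cay}(G,X_i)$ be the digraph (with loops) with vertex set $G$ and arc set $\{(g,xg):x\in X_i,\ g\in G\}$. Group $\mathbb{F}_q^\infty$: the set $\mathbb{F}_q^\infty=\mathbb{F}_q\cup\{\infty\}$ with the operation $\psi(i,j)=\frac{ij+\delta}{i+j}$ for $i,j\in\mathbb{F}_q$, $i+j\ne0$; $\psi(i,-i)=\infty$ for $i\in\mathbb{F}_q$; $\psi(i,\infty)=\psi(\infty,i)=i$ for $i\in \mathbb{F}_q$;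 $\psi(\infty,\infty)=\infty$, where $\delta=\frac{1}{16\varepsilon}$, is a cyclic group of order $q+1$ with identity $\infty$. $I\subseteq\mathbb{F}_q$ denotes the set of its generators. WL-dimension: for a digraph $\Gamma=(\Omega,D)$ (loops allowed) and $k\ge 2$ the $k$-dimensional Weisfeiler-Leman algorithm colours $k$-tuples $x=(x_1,\dots,x_k)\in\Omega^k$ as follows: the initial colour $c_0(x)$ records for all $a,b$ whether $x_a=x_b$ and whether $(x_a,x_b)\in D$; and $c_{m+1}(x)$ is the pair consisting of $c_m(x)$ and the multiset $\{\!\{(c_m(x_{1\leftarrow\alpha}),\dots,c_m(x_{k\leftarrow\alpha})):\alpha\in\Omega\}\!\}$, where $x_{a\leftarrow\alpha}$ is $x$ with its $a$-th entry replaced by $\alpha$. For $k=1$, $c_0(\alpha)$ records whether $(\alpha,\alpha)\in D$, and $c_{m+1}(\alpha)$ consists of $c_m(\alpha)$ and the multiset over $\beta\in\Omega$ of the triples formed by $c_m(\beta)$, the truth value of $(\alpha,\beta)\in D$, and the truth value of $(\beta,\alpha)\in D$. The algorithm distinguishes two digraphs if for some $m$ the multisets of colours $c_m$ of all $k$-tuples are different. $\dim_{\mathrm{WL}}(\Gamma)$ is the smallest $k\geq1$ such that the $k$-dimensional algorithm distinguishes $\Gamma$ from every digraph not isomorphic to $\Gamma$. *)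

theory Defs
  imports
    "HOL-Analysis.Analysis"
    "HOL-Algebra.Algebra"
    "HOL-Computational_Algebra.Nth_Powers"
    "HOL-Library.Multiset"
    "Graph_Theory.Graph_Theory"
begin

section \<open>The Weisfeiler--Leman dimension of a finite digraph\<close>

text \<open>
  Digraphs are values of type \<open>'v pair_pre_digraph\<close> satisfying \<open>pair_fin_digraph\<close>:
  finitely many vertices, at most one arc for each ordered pair of vertices, loops allowed.

  Colours live in a free datatype that does not mention the vertex type, so that colours
  arising from different digraphs can be compared.  A \<open>k\<close>-tuple of vertices is a list of
  length \<open>k\<close>, with entries numbered from \<open>0\<close>.
\<close>

datatype wl_colour =
    WL_Init "(bool \<times> bool) list list"
  | WL_Refine wl_colour "wl_colour list multiset"

definition tuple_type :: "'v pair_pre_digraph \<Rightarrow> 'v list \<Rightarrow> (bool \<times> bool) list list" where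
  "tuple_type D xs =
     map (\<lambda>a. map (\<lambda>b. (xs ! a = xs ! b, (xs ! a, xs ! b) \<in> parcs D)) [0..<length xs])
       [0..<length xs]"

primrec wl_tuple_colour :: "'v pair_pre_digraph \<Rightarrow> nat \<Rightarrow> 'v list \<Rightarrow> wl_colour" where
  "wl_tuple_colour D 0 xs = WL_Init (tuple_type D xs)"
| "wl_tuple_colour D (Suc m) xs =
     WL_Refine (wl_tuple_colour D m xs)
       {# map (\<lambda>a. wl_tuple_colour D m (xs[a := v])) [0..<length xs].
          v \<in># mset_set (pverts D) #}"

definition vertex_tuples :: "nat \<Rightarrow> 'v pair_pre_digraph \<Rightarrow> 'v list set" where
  "vertex_tuples k D = {xs. length xs = k \<and> set xs \<subseteq> pverts D}"

text \<open>The one-dimensional algorithm (colour refinement) colours vertices.\<close>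

datatype wl1_colour =
    WL1_Init bool
  | WL1_Refine wl1_colour "(wl1_colour \<times> bool \<times> bool) multiset"

primrec wl1_vertex_colour :: "'v pair_pre_digraph \<Rightarrow> nat \<Rightarrow> 'v \<Rightarrow> wl1_colour" where
  "wl1_vertex_colour D 0 u = WL1_Init ((u, u) \<in> parcs D)"
| "wl1_vertex_colour D (Suc m) u =
     WL1_Refine (wl1_vertex_colour D m u)
       {# (wl1_vertex_colour D m v, (u, v) \<in> parcs D, (v, u) \<in> parcs D).
          v \<in># mset_set (pverts D) #}"

text \<open>Meaningful for \<open>k \<ge> 1\<close> only.\<close>

definition wl_distinguishes :: "nat \<Rightarrow> 'v pair_pre_digraph \<Rightarrow> 'w pair_pre_digraph \<Rightarrow> bool" where
  "wl_distinguishes k D E \<longleftrightarrow>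
     (if k = 1
      then \<exists>m. image_mset (wl1_vertex_colour D m) (mset_set (pverts D)) \<noteq>
               image_mset (wl1_vertex_colour E m) (mset_set (pverts E))
      else \<exists>m. image_mset (wl_tuple_colour D m) (mset_set (vertex_tuples k D)) \<noteq>
               image_mset (wl_tuple_colour E m) (mset_set (vertex_tuples k E)))"

text \<open>
  Every finite digraph is isomorphic to one whose vertices are natural numbers, so letting
  \<open>E\<close> range over the latter covers all finite digraphs.
\<close>

definition wl_identifies :: "nat \<Rightarrow> 'v pair_pre_digraph \<Rightarrow> bool" where
  "wl_identifies k D \<longleftrightarrow>
     (\<forall>E :: nat pair_pre_digraph.
        pair_fin_digraph E \<and> \<not> digraph_iso (with_proj D) (with_proj E) \<longrightarrow>
        wl_distinguishes k D E)"

definition wl_dim :: "'v pair_pre_digraph \<Rightarrow> nat" where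
  "wl_dim D = (LEAST k. 1 \<le> k \<and> wl_identifies k D)"


section \<open>The Heisenberg group and its Cayley digraphs\<close>

definition heis_mat :: "'a \<Rightarrow> 'a \<Rightarrow> 'a \<Rightarrow> 'a::field ^ 3 ^ 3" where
  "heis_mat x y z =
     vector [vector [1, x, z],
             vector [0, 1, y],
             vector [0, 0, 1]]"

definition heisenberg_group :: "('a::field ^ 3 ^ 3) monoid" where
  "heisenberg_group =
     \<lparr>carrier = {heis_mat x y z | x y z. True}, mult = (**), one = mat 1\<rparr>"

definition cayley_digraph :: "('g, 'b) monoid_scheme \<Rightarrow> 'g set \<Rightarrow> 'g pair_pre_digraph" where
  "cayley_digraph G S =
     \<lparr>pverts = carrier G, parcs = {(g, x \<otimes>\<^bsub>G\<^esub> g) | x g. x \<in> S \<and> g \<in> carrier G}\<rparr>"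

definition Y_set :: "'a \<Rightarrow> 'a \<Rightarrow> ('a::field ^ 3 ^ 3) set" where
  "Y_set \<epsilon> i =
     {heis_mat \<alpha> \<beta> (\<alpha> * \<beta> / 2 + (\<alpha>\<^sup>2 - \<epsilon> * \<beta>\<^sup>2) * i) | \<alpha> \<beta>. (\<alpha>, \<beta>) \<noteq> (0, 0)}"

definition X_set :: "'a \<Rightarrow> 'a \<Rightarrow> ('a::field ^ 3 ^ 3) set" where
  "X_set \<epsilon> i = Y_set \<epsilon> i \<union> {\<one>\<^bsub>heisenberg_group\<^esub>}"

definition Gamma_digraph :: "'a \<Rightarrow> 'a \<Rightarrow> ('a::field ^ 3 ^ 3) pair_pre_digraph" where
  "Gamma_digraph \<epsilon> i = cayley_digraph heisenberg_group (X_set \<epsilon> i)"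


section \<open>The cyclic group on the projective line\<close>

text \<open>\<open>Some i\<close> is the field element \<open>i\<close>, and \<open>None\<close> is the point \<open>\<infinity>\<close>.\<close>

fun psi :: "'a::field \<Rightarrow> 'a option \<Rightarrow> 'a option \<Rightarrow> 'a option" where
  "psi \<epsilon> (Some i) (Some j) =
     (if i + j = 0 then None else Some ((i * j + 1 / (16 * \<epsilon>)) / (i + j)))"
| "psi \<epsilon> (Some i) None = Some i"
| "psi \<epsilon> None (Some i) = Some i"
| "psi \<epsilon> None None = None"

definition psi_group :: "'a::field \<Rightarrow> 'a option monoid" where
  "psi_group \<epsilon> = \<lparr>carrier = UNIV, mult = psi \<epsilon>, one = None\<rparr>"

definition psi_generators :: "'a::field \<Rightarrow> 'a set" where
  "psi_generators \<epsilon> = {i. generate (psi_group \<epsilon>) {Some i} = carrier (psi_group \<epsilon>)}"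

end

(* In suitable coordinates the connection sets become cones over the anisotropic norm form
   x^2 - eps y^2: the arcs are given by "height = i * norm".  Walks of length 2 through the cones a
   and b are counted by psi(a, b).  Since i generates the group, the colours of pairs therefore
   determine all cones, and individualising two points in different fibres fixes every vertex, so
   dimension 3 suffices.  The one-dimensional algorithm sees only degrees.

   An automorphism of the group induces a permutation sigma of the field that preserves all
   intersection numbers, so the two-dimensional algorithm does not separate the digraphs of i and
   sigma(i).  An isomorphism between them would make sigma additive; for q > 9 a suitable power map
   sigma is not.  For q = 3 the intersection numbers determine the configuration: the 9 fibres are
   coordinatised as an affine plane of order 3 with its norm and symplectic form. *)
theory Submission
  imports Defs "HOL-Number_Theory.Residues"
begin

section \<open>Isomorphisms and Weisfeiler--Leman colours\<close>

text \<open>The operation \<open>psi\<close> comes from completing a square. The midpoints of walks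
  through the cones a and b solve a N(u) + b N(w - u) + area(w, u) / 2 = height, where N is the
  norm, w the base displacement of the endpoints and u that of the midpoint. The area term moves the
  centre of the quadratic, and its square contributes the constant 1 / (16 \<epsilon>): what remains
  is (a + b) N(u - centre) = height - psi(a, b) N(w). As this constant is a nonsquare, psi(a, b)
  differs from a and b, and for a + b = 0 the equation is a nondegenerate linear one off the fibre.
  An isomorphism makes \<sigma> additive because points of a second fibre read the heights in the
  first: differences of heights go to a fixed multiple of their \<sigma>-values. The exponent of
  \<sigma> has to be coprime to q + 1, hence the cases modulo 4. It is close to (q + 1) / 2, so that
  \<sigma> is a rational function of small degree on each coset of the subgroup of index two, and
  additivity gives a polynomial of bounded degree with about q / 2 roots. For q = 3 two fibres are
  related by a Latin square of order 3. These are all affine, so a multiplier and a shift describe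
  each pair of fibres.\<close>

definition arc_isomorphism :: "('v \<Rightarrow> 'w) \<Rightarrow> 'v pair_pre_digraph \<Rightarrow> 'w pair_pre_digraph \<Rightarrow> bool" where
  "arc_isomorphism f D E \<longleftrightarrow> bij_betw f (pverts D) (pverts E) \<and>
     (\<forall>u\<in>pverts D. \<forall>v\<in>pverts D. (u, v) \<in> parcs D \<longleftrightarrow> (f u, f v) \<in> parcs E)"

text \<open>Tail and head of \<open>with_proj\<close> are the projections of a pair, so the arc part
  of a library isomorphism is forced by its vertex part. Below, plain bijections that respect arcs
  in both directions can be used instead.\<close>

lemma digraph_iso_iff:
  assumes "pair_wf_digraph D" "pair_wf_digraph E"
  shows "digraph_iso (with_proj D) (with_proj E) \<longleftrightarrow> (\<exists>f. arc_isomorphism f D E)"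
proof
  interpret D: pair_wf_digraph D by fact
  assume "digraph_iso (with_proj D) (with_proj E)"
  then obtain h where h: "pre_digraph.digraph_isomorphism (with_proj D) h"
    and E: "with_proj E = app_iso h (with_proj D)"
    unfolding digraph_iso_def by blast
  have verts: "pverts E = iso_verts h ` pverts D" and arcs: "parcs E = iso_arcs h ` parcs D"
    and tl: "iso_tail h = fst" and hd: "iso_head h = snd"
    using arg_cong[OF E, of verts] arg_cong[OF E, of arcs] arg_cong[OF E, of tail]
      arg_cong[OF E, of head] by auto
  have inj: "inj_on (iso_verts h) (pverts D)"
    using D.digraph_isomorphism_inj_on_verts[OF h] by simp
  have a: "iso_arcs h e = (iso_verts h (fst e), iso_verts h (snd e))" if "e \<in> parcs D" for e
    using D.iso_verts_tail[OF h, of e] D.iso_verts_head[OF h, of e] that tl hd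
    by (auto simp: prod_eq_iff)
  have "(u, v) \<in> parcs D \<longleftrightarrow> (iso_verts h u, iso_verts h v) \<in> parcs E"
    if uv: "u \<in> pverts D" "v \<in> pverts D" for u v
  proof
    assume "(u, v) \<in> parcs D"
    then show "(iso_verts h u, iso_verts h v) \<in> parcs E"
      using a[of "(u, v)"] unfolding arcs by force
  next
    assume "(iso_verts h u, iso_verts h v) \<in> parcs E"
    then obtain e where e: "e \<in> parcs D" and eq: "iso_arcs h e = (iso_verts h u, iso_verts h v)"
      unfolding arcs by force
    have "fst e \<in> pverts D" "snd e \<in> pverts D"
      using D.in_arcsD1[of "fst e" "snd e"] D.in_arcsD2[of "fst e" "snd e"] e by auto
    then have "fst e = u" "snd e = v"
      using a[OF e] eq inj uv by (auto dest: inj_onD)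
    then show "(u, v) \<in> parcs D" using e by auto
  qed
  then show "\<exists>f. arc_isomorphism f D E"
    using inj verts unfolding arc_isomorphism_def bij_betw_def by blast
next
  interpret D: pair_wf_digraph D by fact
  interpret E: pair_wf_digraph E by fact
  assume "\<exists>f. arc_isomorphism f D E"
  then obtain f where f: "bij_betw f (pverts D) (pverts E)"
    and arc: "\<And>u v. u \<in> pverts D \<Longrightarrow> v \<in> pverts D \<Longrightarrow> (u, v) \<in> parcs D \<longleftrightarrow> (f u, f v) \<in> parcs E"
    unfolding arc_isomorphism_def by blast
  define h where "h = \<lparr>iso_verts = f, iso_arcs = map_prod f f, iso_head = snd, iso_tail = fst\<rparr>"
  have inj: "inj_on f (pverts D)" and im: "f ` pverts D = pverts E"
    using f by (auto simp: bij_betw_def)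
  have sub: "parcs D \<subseteq> pverts D \<times> pverts D"
    using D.in_arcsD1 D.in_arcsD2 by auto
  have "inj_on (map_prod f f) (parcs D)"
    using map_prod_inj_on[OF inj inj] sub by (rule inj_on_subset)
  then have "pre_digraph.digraph_isomorphism (with_proj D) h"
    unfolding pre_digraph.digraph_isomorphism_def h_def using inj
    by (auto simp: D.wf_digraph_axioms)
  moreover have "map_prod f f ` parcs D = parcs E"
  proof
    show "map_prod f f ` parcs D \<subseteq> parcs E" using arc sub by auto
    show "parcs E \<subseteq> map_prod f f ` parcs D"
    proof
      fix e assume e: "e \<in> parcs E"
      then have "fst e \<in> pverts E" "snd e \<in> pverts E"
        using E.in_arcsD1[of "fst e" "snd e"] E.in_arcsD2[of "fst e" "snd e"] by auto
      then obtain u v where uv: "u \<in> pverts D" "v \<in> pverts D" "e = (f u, f v)"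
        using im by (metis imageE prod.collapse)
      then show "e \<in> map_prod f f ` parcs D"
        using arc[of u v] e by force
    qed
  qed
  ultimately have "pre_digraph.digraph_isomorphism (with_proj D) h \<and> with_proj E = app_iso h (with_proj D)"
    using im by (simp add: app_iso_def h_def with_proj_def)
  then show "digraph_iso (with_proj D) (with_proj E)"
    unfolding digraph_iso_def by blast
qed

lemma arc_isomorphism_comp:
  "arc_isomorphism f D E \<Longrightarrow> arc_isomorphism g E F \<Longrightarrow> arc_isomorphism (g \<circ> f) D F"
  unfolding arc_isomorphism_def by (auto intro: bij_betw_trans dest: bij_betwE)

lemma arc_isomorphism_inv:
  assumes "arc_isomorphism f D E"
  shows "arc_isomorphism (the_inv_into (pverts D) f) E D"
proof -
  have f: "bij_betw f (pverts D) (pverts E)" using assms unfolding arc_isomorphism_def by blast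
  let ?g = "the_inv_into (pverts D) f"
  have g: "bij_betw ?g (pverts E) (pverts D)" by (rule bij_betw_the_inv_into[OF f])
  have inv: "f (?g v) = v" if "v \<in> pverts E" for v
    using f_the_inv_into_f_bij_betw[OF f] that by blast
  have "?g v \<in> pverts D" if "v \<in> pverts E" for v using bij_betwE[OF g] that by blast
  then have "(u, v) \<in> parcs E \<longleftrightarrow> (?g u, ?g v) \<in> parcs D" if "u \<in> pverts E" "v \<in> pverts E" for u v
    using assms inv that unfolding arc_isomorphism_def by metis
  then show ?thesis using g unfolding arc_isomorphism_def by blast
qed

text \<open>\<open>wl_identifies\<close> only tests digraphs on natural numbers; a competitor on
  another vertex type has to be relabelled before it refutes identification.\<close>

lemma arc_isomorphism_relabel:
  assumes "finite (pverts D)"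
  obtains E :: "nat pair_pre_digraph" and f where "arc_isomorphism f D E"
    "pair_wf_digraph D \<Longrightarrow> pair_fin_digraph E"
proof -
  obtain f :: "'a \<Rightarrow> nat" where f: "inj_on f (pverts D)"
    using assms finite_imp_inj_to_nat_seg by blast
  define E where "E = \<lparr>pverts = f ` pverts D,
    parcs = {(f u, f v) | u v. (u, v) \<in> parcs D \<and> u \<in> pverts D \<and> v \<in> pverts D}\<rparr>"
  have "arc_isomorphism f D E"
    unfolding arc_isomorphism_def E_def using f by (auto simp: bij_betw_def inj_on_def)
  moreover have "pair_fin_digraph E"
  proof
    show "finite (pverts E)" using assms by (simp add: E_def)
    have "parcs E \<subseteq> pverts E \<times> pverts E" by (auto simp: E_def)
    then show "finite (parcs E)" using \<open>finite (pverts E)\<close> by (meson finite_SigmaI finite_subset)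
  qed (auto simp: E_def)
  ultimately show ?thesis using that by blast
qed

lemma wl_tuple_colour_iso:
  assumes iso: "arc_isomorphism f D E"
  shows "set xs \<subseteq> pverts D \<Longrightarrow> wl_tuple_colour E m (map f xs) = wl_tuple_colour D m xs"
proof (induction m arbitrary: xs)
  have f: "bij_betw f (pverts D) (pverts E)" using iso unfolding arc_isomorphism_def by blast
  case 0
  have "(f (xs ! a), f (xs ! b)) \<in> parcs E \<longleftrightarrow> (xs ! a, xs ! b) \<in> parcs D"
    "f (xs ! a) = f (xs ! b) \<longleftrightarrow> xs ! a = xs ! b"
    if "a < length xs" "b < length xs" for a b
    using 0 that iso f by (auto simp: arc_isomorphism_def bij_betw_def inj_on_def subset_iff)
  then show ?case by (auto simp: tuple_type_def)
next
  have f: "bij_betw f (pverts D) (pverts E)" using iso unfolding arc_isomorphism_def by blast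
  case (Suc m)
  have *: "wl_tuple_colour E m ((map f xs)[a := f v]) = wl_tuple_colour D m (xs[a := v])"
    if "v \<in> pverts D" for a v
    using Suc.IH[of "xs[a := v]"] Suc.prems that set_update_subset_insert[of xs a v]
    by (metis insert_subset map_update order_trans)
  have E: "mset_set (pverts E) = image_mset f (mset_set (pverts D))"
    using f by (metis bij_betw_def image_mset_mset_set)
  have "{#map (\<lambda>a. wl_tuple_colour E m ((map f xs)[a := v])) [0..<length xs]. v \<in># mset_set (pverts E)#}
      = {#map (\<lambda>a. wl_tuple_colour D m (xs[a := v])) [0..<length xs]. v \<in># mset_set (pverts D)#}"
    unfolding E image_mset.compositionality o_def
    by (intro image_mset_cong) (metis (no_types, lifting) * elem_mset_set empty_iff mset_set.infinite
        set_mset_empty)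
  then show ?case using Suc by simp
qed

lemma wl1_vertex_colour_iso:
  assumes iso: "arc_isomorphism f D E"
  shows "u \<in> pverts D \<Longrightarrow> wl1_vertex_colour E m (f u) = wl1_vertex_colour D m u"
proof (induction m arbitrary: u)
  case 0
  then show ?case using iso by (auto simp: arc_isomorphism_def)
next
  have f: "bij_betw f (pverts D) (pverts E)" using iso unfolding arc_isomorphism_def by blast
  have E: "mset_set (pverts E) = image_mset f (mset_set (pverts D))"
    using f by (metis bij_betw_def image_mset_mset_set)
  have mem: "v \<in> pverts D" if "v \<in># mset_set (pverts D)" for v
    using that by (metis elem_mset_set empty_iff mset_set.infinite set_mset_empty)
  case (Suc m)
  then show ?case
    using iso unfolding arc_isomorphism_def
    by (auto simp: E image_mset.compositionality o_def intro!: image_mset_cong dest!: mem)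
qed

lemma wl_distinguishes_iso:
  assumes iso: "arc_isomorphism f D E"
  shows "wl_distinguishes k D F \<longleftrightarrow> wl_distinguishes k E F"
proof -
  have f: "bij_betw f (pverts D) (pverts E)" using iso unfolding arc_isomorphism_def by blast
  have E: "mset_set (pverts E) = image_mset f (mset_set (pverts D))"
    using f by (metis bij_betw_def image_mset_mset_set)
  have mem: "v \<in> A" if "v \<in># mset_set A" for v and A :: "'x set"
    using that by (metis elem_mset_set empty_iff mset_set.infinite set_mset_empty)
  have inj: "inj_on (map f) (vertex_tuples k D)"
  proof (rule inj_onI)
    fix xs ys assume "xs \<in> vertex_tuples k D" "ys \<in> vertex_tuples k D" and eq: "map f xs = map f ys"
    then have "set xs \<union> set ys \<subseteq> pverts D" by (auto simp: vertex_tuples_def)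
    then have "inj_on f (set xs \<union> set ys)" using f by (meson bij_betw_def inj_on_subset)
    then show "xs = ys" using eq by (simp add: inj_on_map_eq_map)
  qed
  have im: "map f ` vertex_tuples k D = vertex_tuples k E"
  proof
    show "map f ` vertex_tuples k D \<subseteq> vertex_tuples k E"
      using bij_betwE[OF f] unfolding vertex_tuples_def by (auto simp: subset_iff)
    show "vertex_tuples k E \<subseteq> map f ` vertex_tuples k D"
    proof
      fix ys assume ys: "ys \<in> vertex_tuples k E"
      then have "ys \<in> lists (f ` pverts D)"
        using f unfolding vertex_tuples_def bij_betw_def by auto
      then obtain xs where "xs \<in> lists (pverts D)" "ys = map f xs"
        unfolding lists_image by auto
      then show "ys \<in> map f ` vertex_tuples k D" using ys unfolding vertex_tuples_def by auto
    qed
  qed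
  have 2: "image_mset (wl_tuple_colour E m) (mset_set (vertex_tuples k E)) =
      image_mset (wl_tuple_colour D m) (mset_set (vertex_tuples k D))" for m
    unfolding im[symmetric] image_mset_mset_set[OF inj, symmetric]
    using wl_tuple_colour_iso[OF iso]
    by (auto simp: image_mset.compositionality o_def vertex_tuples_def intro!: image_mset_cong dest!: mem)
  have 1: "image_mset (wl1_vertex_colour E m) (mset_set (pverts E)) =
      image_mset (wl1_vertex_colour D m) (mset_set (pverts D))" for m
    unfolding E using wl1_vertex_colour_iso[OF iso]
    by (auto simp: image_mset.compositionality o_def intro!: image_mset_cong dest!: mem)
  show ?thesis unfolding wl_distinguishes_def 1 2 ..
qed

lemma wl_identifies_iso:
  assumes iso: "arc_isomorphism f D E" and wf: "pair_wf_digraph D" "pair_wf_digraph E"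
  shows "wl_identifies k D \<longleftrightarrow> wl_identifies k E"
proof -
  have "digraph_iso (with_proj D) (with_proj F) \<longleftrightarrow> digraph_iso (with_proj E) (with_proj F)"
    if "pair_fin_digraph F" for F :: "nat pair_pre_digraph"
  proof -
    have F: "pair_wf_digraph F" using that by (simp add: pair_fin_digraph_def)
    show ?thesis unfolding digraph_iso_iff[OF wf(1) F] digraph_iso_iff[OF wf(2) F]
      using iso arc_isomorphism_comp arc_isomorphism_inv by metis
  qed
  then show ?thesis unfolding wl_identifies_def wl_distinguishes_iso[OF iso] by blast
qed

lemma wl_dim_iso:
  assumes "arc_isomorphism f D E" "pair_wf_digraph D" "pair_wf_digraph E"
  shows "wl_dim D = wl_dim E"
  unfolding wl_dim_def wl_identifies_iso[OF assms] ..

lemma not_wl_identifiesI: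
  assumes D: "pair_wf_digraph D" and E: "pair_wf_digraph E" "finite (pverts E)"
    and noniso: "\<And>f. \<not> arc_isomorphism f D E" and nd: "\<not> wl_distinguishes k D E"
  shows "\<not> wl_identifies k D"
proof -
  obtain F :: "nat pair_pre_digraph" and f where f: "arc_isomorphism f E F"
    and F: "pair_fin_digraph F"
    using arc_isomorphism_relabel[OF E(2)] E(1) by blast
  have "\<not> digraph_iso (with_proj D) (with_proj F)"
    using digraph_iso_iff[OF D, of F] F noniso arc_isomorphism_comp arc_isomorphism_inv[OF f]
    by (metis pair_fin_digraph_def)
  \<comment> \<open>\<open>wl_distinguishes_iso\<close> changes only the first argument; symmetry
    carries it over to the second.\<close>
  moreover have "wl_distinguishes k A B \<longleftrightarrow> wl_distinguishes k B A"
    for A :: "'x pair_pre_digraph" and B :: "'y pair_pre_digraph"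
    unfolding wl_distinguishes_def by metis
  then have "\<not> wl_distinguishes k D F" using nd wl_distinguishes_iso[OF f] by metis
  ultimately show ?thesis using F unfolding wl_identifies_def by blast
qed

text \<open>Equal colour multisets are used through a colour-preserving bijection. This turns
  counting into the bijective pebble game that all later arguments play.\<close>

lemma image_mset_set_eq_bij:
  assumes "finite A" "finite B" and eq: "image_mset f (mset_set A) = image_mset g (mset_set B)"
  obtains h where "bij_betw h A B" "\<And>x. x \<in> A \<Longrightarrow> f x = g (h x)"
proof -
  have "\<exists>h. bij_betw h A B \<and> (\<forall>x\<in>A. f x = g (h x))"
    using assms
  proof (induction A arbitrary: B rule: finite_induct)
    case empty
    then have "B = {}" by (metis finite_set_mset_mset_set image_mset_is_empty_iff mset_set.empty
          set_mset_empty)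
    then show ?case by (auto simp: bij_betw_def)
  next
    case (insert a A)
    have "f a \<in># image_mset f (mset_set (insert a A))"
      using insert.hyps by simp
    then obtain b where b: "b \<in> B" "f a = g b"
      using insert.prems by auto
    have "mset_set B = add_mset b (mset_set (B - {b}))"
      using b insert.prems(1) by (metis mset_set.remove)
    then have "image_mset f (mset_set A) = image_mset g (mset_set (B - {b}))"
      using insert.prems insert.hyps b by simp
    then obtain h where h: "bij_betw h A (B - {b})" "\<forall>x\<in>A. f x = g (h x)"
      using insert.IH[of "B - {b}"] insert.prems(1) by auto
    let ?h = "h(a := b)"
    have "?h ` A = h ` A" using insert.hyps(2) by (intro image_cong) auto
    then have im: "?h ` insert a A = B" using h(1) b by (auto simp: bij_betw_def)
    moreover have "card B = card (insert a A)"
      using bij_betw_same_card[OF h(1)] insert.hyps insert.prems(1) b(1)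
      by (simp add: card_Diff_singleton card_gt_0_iff) (metis Suc_pred card_gt_0_iff empty_iff)
    ultimately have "bij_betw ?h (insert a A) B"
      unfolding bij_betw_def using insert.hyps(1) eq_card_imp_inj_on[of "insert a A" ?h] by simp
    moreover have "\<forall>x\<in>insert a A. f x = g (?h x)" using h(2) b(2) insert.hyps(2) by auto
    ultimately show ?case by blast
  qed
  then show ?thesis using that by blast
qed

lemma tuple_type_eqD:
  assumes "tuple_type D xs = tuple_type E ys"
  shows "length xs = length ys"
    and "a < length xs \<Longrightarrow> b < length xs \<Longrightarrow> xs ! a = xs ! b \<longleftrightarrow> ys ! a = ys ! b"
    and "a < length xs \<Longrightarrow> b < length xs \<Longrightarrow> (xs ! a, xs ! b) \<in> parcs D \<longleftrightarrow> (ys ! a, ys ! b) \<in> parcs E"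
proof -
  show len: "length xs = length ys"
    using arg_cong[OF assms, of length] by (simp add: tuple_type_def)
  assume "a < length xs" "b < length xs"
  then show "xs ! a = xs ! b \<longleftrightarrow> ys ! a = ys ! b"
    "(xs ! a, xs ! b) \<in> parcs D \<longleftrightarrow> (ys ! a, ys ! b) \<in> parcs E"
    using arg_cong[OF assms, of "\<lambda>t. t ! a ! b"] len by (simp_all add: tuple_type_def)
qed

text \<open>Each refined colour stores its predecessor, so agreement at a late round includes
  agreement at all earlier ones.\<close>

lemma wl_tuple_colour_mono:
  "wl_tuple_colour D m xs = wl_tuple_colour E m ys \<Longrightarrow> n \<le> m \<Longrightarrow>
    wl_tuple_colour D n xs = wl_tuple_colour E n ys"
  by (induction m) (auto simp: le_Suc_eq)

lemma wl_tuple_colour_type: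
  assumes "wl_tuple_colour D m xs = wl_tuple_colour E m ys"
  shows "tuple_type D xs = tuple_type E ys"
  using wl_tuple_colour_mono[OF assms, of 0] by simp

text \<open>One round of the bijective pebble game. A single \<open>h\<close> serves all positions
  \<open>a\<close> at once, because the refinement records the whole list of colours for each
  inserted vertex; this is what lets both halves of a walk be followed together.\<close>

lemma wl_tuple_colour_step:
  assumes "finite (pverts D)" "finite (pverts E)"
    and eq: "wl_tuple_colour D (Suc m) xs = wl_tuple_colour E (Suc m) ys"
  obtains h where "bij_betw h (pverts D) (pverts E)"
    "\<And>v a. v \<in> pverts D \<Longrightarrow> a < length xs \<Longrightarrow>
      wl_tuple_colour D m (xs[a := v]) = wl_tuple_colour E m (ys[a := h v])"
proof -
  have len: "length xs = length ys" using tuple_type_eqD(1)[OF wl_tuple_colour_type[OF eq]] .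
  obtain h where "bij_betw h (pverts D) (pverts E)"
    and h: "\<And>v. v \<in> pverts D \<Longrightarrow> map (\<lambda>a. wl_tuple_colour D m (xs[a := v])) [0..<length xs] =
      map (\<lambda>a. wl_tuple_colour E m (ys[a := h v])) [0..<length ys]"
    using image_mset_set_eq_bij[OF assms(1,2)] eq by auto
  moreover have "wl_tuple_colour D m (xs[a := v]) = wl_tuple_colour E m (ys[a := h v])"
    if "v \<in> pverts D" "a < length xs" for v a
    using arg_cong[OF h[OF that(1)], of "\<lambda>l. l ! a"] that len by simp
  ultimately show ?thesis using that by blast
qed

text \<open>If every vertex sees the same multiset \<open>M\<close> of arc patterns, colour
  refinement never leaves a constant colouring.\<close>

lemma regular_not_wl1_distinguishes:
  assumes fin: "finite (pverts D)" "finite (pverts E)" and card: "card (pverts D) = card (pverts E)"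
    and D: "\<And>u. u \<in> pverts D \<Longrightarrow> (u, u) \<in> parcs D"
      "\<And>u. u \<in> pverts D \<Longrightarrow>
        image_mset (\<lambda>v. ((u, v) \<in> parcs D, (v, u) \<in> parcs D)) (mset_set (pverts D)) = M"
    and E: "\<And>u. u \<in> pverts E \<Longrightarrow> (u, u) \<in> parcs E"
      "\<And>u. u \<in> pverts E \<Longrightarrow>
        image_mset (\<lambda>v. ((u, v) \<in> parcs E, (v, u) \<in> parcs E)) (mset_set (pverts E)) = M"
  shows "\<not> wl_distinguishes 1 D E"
proof -
  have const: "\<exists>c. (\<forall>u\<in>pverts D. wl1_vertex_colour D m u = c) \<and> (\<forall>u\<in>pverts E. wl1_vertex_colour E m u = c)" for m
  proof (induction m)
    case 0
    then show ?case using D(1) E(1) by auto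
  next
    case (Suc m)
    then obtain c where c: "\<And>u. u \<in> pverts D \<Longrightarrow> wl1_vertex_colour D m u = c"
      "\<And>u. u \<in> pverts E \<Longrightarrow> wl1_vertex_colour E m u = c" by blast
    have "wl1_vertex_colour D (Suc m) u = WL1_Refine c (image_mset (Pair c) M)" if "u \<in> pverts D" for u
      using c(1) that fin by (auto simp flip: D(2)[OF that] simp: image_mset.compositionality o_def intro!: image_mset_cong)
    moreover have "wl1_vertex_colour E (Suc m) u = WL1_Refine c (image_mset (Pair c) M)" if "u \<in> pverts E" for u
      using c(2) that fin by (auto simp flip: E(2)[OF that] simp: image_mset.compositionality o_def intro!: image_mset_cong)
    ultimately show ?case by blast
  qed
  then have "image_mset (wl1_vertex_colour D m) (mset_set (pverts D)) =
      image_mset (wl1_vertex_colour E m) (mset_set (pverts E))" for m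
  proof -
    obtain c where c: "\<And>u. u \<in> pverts D \<Longrightarrow> wl1_vertex_colour D m u = c"
      "\<And>u. u \<in> pverts E \<Longrightarrow> wl1_vertex_colour E m u = c"
      using const[of m] by blast
    have "image_mset (wl1_vertex_colour D m) (mset_set (pverts D)) = image_mset (\<lambda>_. c) (mset_set (pverts D))"
      "image_mset (wl1_vertex_colour E m) (mset_set (pverts E)) = image_mset (\<lambda>_. c) (mset_set (pverts E))"
      using c fin by (auto intro!: image_mset_cong)
    then show ?thesis using card by (simp add: image_mset_const_eq)
  qed
  then show ?thesis unfolding wl_distinguishes_def by simp
qed

lemma vertex_tuples_2: "vertex_tuples 2 D = (\<lambda>(x, y). [x, y]) ` (pverts D \<times> pverts D)"
  by (auto simp: vertex_tuples_def numeral_2_eq_2 length_Suc_conv image_iff)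

lemma finite_vertex_tuples: "finite (pverts D) \<Longrightarrow> finite (vertex_tuples k D)"
  unfolding vertex_tuples_def using finite_lists_length_eq[of "pverts D" k] by (simp add: conj_commute)

text \<open>\<open>\<rho>\<close> and \<open>\<rho>'\<close> act as coherent colourings with
  matching intersection numbers. By induction on the round, pairs in the same relation get the same
  colour, since replacing either entry of a pair by \<open>z\<close> exposes just the two relations
  counted in \<open>step\<close>.\<close>

lemma coherent_not_wl2_distinguishes:
  fixes \<rho> :: "'v \<Rightarrow> 'v \<Rightarrow> 't" and \<rho>' :: "'w \<Rightarrow> 'w \<Rightarrow> 't"
  assumes fin: "finite (pverts D)" "finite (pverts E)"
    and type: "\<And>x y x' y'. \<lbrakk>x \<in> pverts D; y \<in> pverts D; x' \<in> pverts E; y' \<in> pverts E; \<rho> x y = \<rho>' x' y'\<rbrakk>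
      \<Longrightarrow> tuple_type D [x, y] = tuple_type E [x', y']"
    and step: "\<And>x y x' y'. \<lbrakk>x \<in> pverts D; y \<in> pverts D; x' \<in> pverts E; y' \<in> pverts E; \<rho> x y = \<rho>' x' y'\<rbrakk>
      \<Longrightarrow> image_mset (\<lambda>z. (\<rho> x z, \<rho> z y)) (mset_set (pverts D)) =
          image_mset (\<lambda>z. (\<rho>' x' z, \<rho>' z y')) (mset_set (pverts E))"
    and total: "image_mset (\<lambda>(x, y). \<rho> x y) (mset_set (pverts D \<times> pverts D)) =
      image_mset (\<lambda>(x, y). \<rho>' x y) (mset_set (pverts E \<times> pverts E))"
  shows "\<not> wl_distinguishes 2 D E"
proof -
  have colour: "wl_tuple_colour D m [x, y] = wl_tuple_colour E m [x', y']"
    if "x \<in> pverts D" "y \<in> pverts D" "x' \<in> pverts E" "y' \<in> pverts E" "\<rho> x y = \<rho>' x' y'" for m x y x' y'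
    using that
  proof (induction m arbitrary: x y x' y')
    case 0
    then show ?case using type by simp
  next
    case (Suc m)
    obtain h where h: "bij_betw h (pverts D) (pverts E)"
      and eq: "\<And>z. z \<in> pverts D \<Longrightarrow> (\<rho> x z, \<rho> z y) = (\<rho>' x' (h z), \<rho>' (h z) y')"
      using image_mset_set_eq_bij[OF fin step[OF Suc.prems]] by blast
    have E: "mset_set (pverts E) = image_mset h (mset_set (pverts D))"
      using h by (metis bij_betw_def image_mset_mset_set)
    have "wl_tuple_colour D m [x, z] = wl_tuple_colour E m [x', h z] \<and>
        wl_tuple_colour D m [z, y] = wl_tuple_colour E m [h z, y']" if "z \<in> pverts D" for z
      using Suc.IH Suc.prems eq[OF that] that bij_betwE[OF h] by auto
    then show ?case
      using Suc.IH[OF Suc.prems] fin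
      by (auto simp: E image_mset.compositionality o_def upt_rec intro!: image_mset_cong)
  qed
  obtain h where h: "bij_betw h (pverts D \<times> pverts D) (pverts E \<times> pverts E)"
    and eq: "\<And>p. p \<in> pverts D \<times> pverts D \<Longrightarrow> (\<lambda>(x, y). \<rho> x y) p = (\<lambda>(x, y). \<rho>' x y) (h p)"
    using image_mset_set_eq_bij[OF _ _ total] fin by auto
  have E: "mset_set (pverts E \<times> pverts E) = image_mset h (mset_set (pverts D \<times> pverts D))"
    using h by (metis bij_betw_def image_mset_mset_set)
  have inj: "inj_on (\<lambda>(x, y). [x, y]) A" for A :: "('x \<times> 'x) set" by (auto simp: inj_on_def)
  have "image_mset (wl_tuple_colour D m) (mset_set (vertex_tuples 2 D)) =
      image_mset (wl_tuple_colour E m) (mset_set (vertex_tuples 2 E))" for m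
  proof -
    have "wl_tuple_colour D m (case p of (x, y) \<Rightarrow> [x, y]) =
        wl_tuple_colour E m (case h p of (x, y) \<Rightarrow> [x, y])" if "p \<in> pverts D \<times> pverts D" for p
    proof -
      obtain x y x' y' where p: "p = (x, y)" "h p = (x', y')" by (metis prod.exhaust)
      have "h p \<in> pverts E \<times> pverts E" using bij_betwE[OF h] that by blast
      then show ?thesis using p colour[of x y x' y' m] eq[OF that] that by simp
    qed
    then show ?thesis
      unfolding vertex_tuples_2 image_mset_mset_set[OF inj, symmetric] E
      using fin by (auto simp: image_mset.compositionality o_def intro!: image_mset_cong)
  qed
  then show ?thesis unfolding wl_distinguishes_def by simp
qed

text \<open>With \<open>e\<close> and \<open>y\<close> fixed, the third entry names every vertex.
  Two extra rounds suffice: one produces a bijection \<open>g\<close> of the vertex sets, the other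
  shows that a later choice agrees with \<open>g\<close> and lets arcs be compared.\<close>

lemma wl3_identifiesI:
  assumes D: "pair_fin_digraph D" and ey: "e \<in> pverts D" "y \<in> pverts D"
    and inj: "inj_on (\<lambda>z. wl_tuple_colour D m [e, y, z]) (pverts D)"
  shows "wl_identifies 3 D"
  unfolding wl_identifies_def
proof (intro allI impI, elim conjE, rule ccontr)
  fix E :: "nat pair_pre_digraph"
  assume E: "pair_fin_digraph E" and noniso: "\<not> digraph_iso (with_proj D) (with_proj E)"
    and nd: "\<not> wl_distinguishes 3 D E"
  have fin: "finite (pverts D)" "finite (pverts E)"
    using D E by (auto simp: pair_fin_digraph_def pair_fin_digraph_axioms_def)
  have wf: "pair_wf_digraph D" "pair_wf_digraph E" using D E by (auto simp: pair_fin_digraph_def)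
  let ?c = "wl_tuple_colour D" and ?d = "wl_tuple_colour E"
  obtain h where h: "bij_betw h (vertex_tuples 3 D) (vertex_tuples 3 E)"
    and eq: "\<And>xs. xs \<in> vertex_tuples 3 D \<Longrightarrow> ?c (Suc (Suc m)) xs = ?d (Suc (Suc m)) (h xs)"
  proof (rule image_mset_set_eq_bij[OF finite_vertex_tuples[OF fin(1)] finite_vertex_tuples[OF fin(2)]])
    show "image_mset (?c (Suc (Suc m))) (mset_set (vertex_tuples 3 D)) =
        image_mset (?d (Suc (Suc m))) (mset_set (vertex_tuples 3 E))"
      using nd unfolding wl_distinguishes_def by (simp del: wl_tuple_colour.simps)
  qed blast
  have in3: "[e, y, y] \<in> vertex_tuples 3 D" using ey by (auto simp: vertex_tuples_def)
  then have "h [e, y, y] \<in> vertex_tuples 3 E" using bij_betwE[OF h] by blast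
  then obtain e' y' w' where h3: "h [e, y, y] = [e', y', w']"
    by (auto simp: vertex_tuples_def numeral_3_eq_3 length_Suc_conv)
  obtain g where g: "bij_betw g (pverts D) (pverts E)"
    and geq: "\<And>v a. v \<in> pverts D \<Longrightarrow> a < 3 \<Longrightarrow> ?c (Suc m) ([e, y, y][a := v]) = ?d (Suc m) ([e', y', w'][a := g v])"
    using wl_tuple_colour_step[OF fin eq[OF in3, unfolded h3]] by (simp add: eval_nat_numeral) blast
  have geq: "?c (Suc m) [e, y, v] = ?d (Suc m) [e', y', g v]" if "v \<in> pverts D" for v
    using geq[OF that, of 2] by (simp add: numeral_2_eq_2)
  have "(u, z) \<in> parcs D \<longleftrightarrow> (g u, g z) \<in> parcs E" if uz: "u \<in> pverts D" "z \<in> pverts D" for u z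
  proof -
    obtain k where k: "bij_betw k (pverts D) (pverts E)"
      and keq: "\<And>v a. v \<in> pverts D \<Longrightarrow> a < 3 \<Longrightarrow> ?c m ([e, y, z][a := v]) = ?d m ([e', y', g z][a := k v])"
      using wl_tuple_colour_step[OF fin geq[OF uz(2)]] by (simp add: eval_nat_numeral) blast
    \<comment> \<open>The second bijection \<open>k\<close> could differ from \<open>g\<close>;
      injectivity of the colours at round \<open>m\<close> forces agreement at
      \<open>u\<close>.\<close>
    obtain u' where u': "u' \<in> pverts D" "k u = g u'"
      using bij_betwE[OF k] g uz by (metis bij_betw_def imageE)
    have "?c m [e, y, u] = ?d m [e', y', g u']"
      using keq[OF uz(1), of 2] u' by (simp add: numeral_2_eq_2)
    also have "\<dots> = ?c m [e, y, u']" using wl_tuple_colour_mono[OF geq[OF u'(1)], of m] by simp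
    finally have "u = u'" using inj uz u' by (auto dest: inj_onD)
    \<comment> \<open>Replacing position 1 instead of 2 puts \<open>u\<close> and \<open>z\<close>
      into one tuple, where the arc is visible in the type.\<close>
    then have "?c m [e, u, z] = ?d m [e', g u, g z]" using keq[OF uz(1), of 1] u' by simp
    from tuple_type_eqD(3)[OF wl_tuple_colour_type[OF this], of 1 2] show ?thesis
      by (simp add: numeral_2_eq_2)
  qed
  then have "arc_isomorphism g D E" using g unfolding arc_isomorphism_def by blast
  then show False using noniso digraph_iso_iff[OF wf] by blast
qed

section \<open>Norm form and cones\<close>

definition norm_form :: "'a::field \<Rightarrow> 'a \<Rightarrow> 'a \<Rightarrow> 'a" where
  "norm_form \<epsilon> x y = x\<^sup>2 - \<epsilon> * y\<^sup>2"

lemma norm_form_eq_0_iff: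
  fixes \<epsilon> :: "'a::field"
  assumes "\<not> is_square \<epsilon>"
  shows "norm_form \<epsilon> x y = 0 \<longleftrightarrow> x = 0 \<and> y = 0"
proof
  assume "norm_form \<epsilon> x y = 0"
  then have eq: "x\<^sup>2 = \<epsilon> * y\<^sup>2" by (simp add: norm_form_def)
  have "y = 0"
  proof (rule ccontr)
    assume "y \<noteq> 0"
    then have "\<epsilon> = (x / y)\<^sup>2" using eq by (simp add: field_simps power2_eq_square)
    then show False using assms by (auto intro: is_nth_powerI)
  qed
  then show "x = 0 \<and> y = 0" using eq by simp
qed (simp add: norm_form_def)

lemma sum_card_fibres:
  assumes "finite A" "finite B" "f ` A \<subseteq> B"
  shows "(\<Sum>b\<in>B. card {a \<in> A. f a = b}) = card A"
  using sum.group[OF assms, of "\<lambda>_. 1::nat"] assms(1) by simp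

lemma card_square_roots_le: "card {x::'a::idom. x\<^sup>2 = a} \<le> 2"
proof (cases "\<exists>x::'a. x\<^sup>2 = a")
  case True
  then obtain x :: 'a where "x\<^sup>2 = a" by blast
  then have "{x. x\<^sup>2 = a} \<subseteq> {x, -x}" by (auto simp: power2_eq_iff)
  then have "card {x. x\<^sup>2 = a} \<le> card {x, -x}" by (intro card_mono) auto
  also have "\<dots> \<le> 2" by (simp add: card_insert_if)
  finally show ?thesis .
qed simp

text \<open>The squares and their images under \<open>y \<mapsto> c + \<epsilon> y\<^sup>2\<close> each fill more than half of the
  field, so they meet.\<close>

lemma norm_form_surj:
  fixes \<epsilon> c :: "'a::{field,finite}"
  assumes "\<epsilon> \<noteq> 0"
  shows "\<exists>x y. norm_form \<epsilon> x y = c"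
proof -
  have half: "CARD('a) + 1 \<le> 2 * card (range (\<lambda>x::'a. x\<^sup>2))"
  proof -
    have zero: "0 \<in> range (\<lambda>x::'a. x\<^sup>2)" by (metis rangeI zero_power2)
    have "CARD('a) = (\<Sum>a\<in>range (\<lambda>x::'a. x\<^sup>2). card {x. x\<^sup>2 = a})"
      using sum_card_fibres[of UNIV _ "\<lambda>x::'a. x\<^sup>2"] by simp
    also have "\<dots> = card {x::'a. x\<^sup>2 = 0} + (\<Sum>a\<in>range (\<lambda>x::'a. x\<^sup>2) - {0}. card {x. x\<^sup>2 = a})"
      by (rule sum.remove) (simp, rule zero)
    also have "\<dots> \<le> 1 + (\<Sum>a\<in>range (\<lambda>x::'a. x\<^sup>2) - {0}. 2)"
      by (intro add_mono sum_mono card_square_roots_le) simp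
    also have "\<dots> = 1 + 2 * (card (range (\<lambda>x::'a. x\<^sup>2)) - 1)"
      using zero by (simp add: card_Diff_singleton)
    finally show ?thesis
      using card_gt_0_iff[of "range (\<lambda>x::'a. x\<^sup>2)"] by simp
  qed
  let ?S = "range (\<lambda>x::'a. x\<^sup>2)"
  have "card ((\<lambda>s. c + \<epsilon> * s) ` ?S) = card ?S"
    by (rule card_image) (use assms in \<open>auto simp: inj_on_def\<close>)
  moreover have "card (?S \<union> (\<lambda>s. c + \<epsilon> * s) ` ?S) \<le> CARD('a)"
    by (intro card_mono) auto
  ultimately have "?S \<inter> (\<lambda>s. c + \<epsilon> * s) ` ?S \<noteq> {}"
    using half card_Un_disjoint[of ?S "(\<lambda>s. c + \<epsilon> * s) ` ?S"] by auto
  then obtain x y :: 'a where "x\<^sup>2 = c + \<epsilon> * y\<^sup>2" by auto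
  then have "norm_form \<epsilon> x y = c" by (simp add: norm_form_def)
  then show ?thesis by blast
qed

text \<open>The form is the norm of the quadratic extension by a square root of \<epsilon>.
  Multiplication by an element of norm d carries the fibre over 1 to the fibre over d, so all q - 1
  nonzero fibres have one size; together with the single zero they fill the q^2 pairs.\<close>

lemma card_norm_form_eq:
  fixes \<epsilon> c :: "'a::{field,finite}"
  assumes eps: "\<not> is_square \<epsilon>" and c: "c \<noteq> 0"
  shows "card {(x, y). norm_form \<epsilon> x y = c} = CARD('a) + 1"
proof -
  have eps0: "\<epsilon> \<noteq> 0" using eps by auto
  have nz: "norm_form \<epsilon> x y = 0 \<longleftrightarrow> x = 0 \<and> y = 0" for x y
    using norm_form_eq_0_iff[OF eps] .
  let ?k = "card {(x, y). norm_form \<epsilon> x y = 1}"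
  have same: "card {(x, y). norm_form \<epsilon> x y = d} = ?k" if d: "d \<noteq> 0" for d
  proof -
    obtain p r where pr: "norm_form \<epsilon> p r = d" using norm_form_surj[OF eps0] by blast
    have "bij_betw (\<lambda>(x, y). (p * x + \<epsilon> * r * y, p * y + r * x))
        {(x, y). norm_form \<epsilon> x y = 1} {(x, y). norm_form \<epsilon> x y = d}"
    \<comment> \<open>The inverse map multiplies by the conjugate and divides by the norm.\<close>
    proof (rule bij_betw_byWitness[where f' = "\<lambda>(x, y). ((p * x - \<epsilon> * r * y) / d, (p * y - r * x) / d)"])
      have mult: "norm_form \<epsilon> (p * x + \<epsilon> * r * y) (p * y + r * x) = d * norm_form \<epsilon> x y" for x y
        by (simp add: pr[symmetric] norm_form_def algebra_simps power2_eq_square)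
      have "norm_form \<epsilon> (p * x - \<epsilon> * r * y) (p * y - r * x) = d * norm_form \<epsilon> x y" for x y
        by (simp add: pr[symmetric] norm_form_def algebra_simps power2_eq_square)
      moreover have "norm_form \<epsilon> (x / d) (y / d) = norm_form \<epsilon> x y / d\<^sup>2" for x y
        by (simp add: norm_form_def power_divide diff_divide_distrib)
      ultimately have mult': "norm_form \<epsilon> ((p * x - \<epsilon> * r * y) / d) ((p * y - r * x) / d) =
          norm_form \<epsilon> x y / d" for x y
        using d by (simp add: power2_eq_square)
      show "(\<lambda>(x, y). (p * x + \<epsilon> * r * y, p * y + r * x)) ` {(x, y). norm_form \<epsilon> x y = 1}
          \<subseteq> {(x, y). norm_form \<epsilon> x y = d}" using mult by auto
      show "(\<lambda>(x, y). ((p * x - \<epsilon> * r * y) / d, (p * y - r * x) / d)) ` {(x, y). norm_form \<epsilon> x y = d}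
          \<subseteq> {(x, y). norm_form \<epsilon> x y = 1}" using mult' d by auto
      have "p * (p * x + \<epsilon> * r * y) - \<epsilon> * r * (p * y + r * x) = x * d"
        "p * (p * y + r * x) - r * (p * x + \<epsilon> * r * y) = y * d"
        "p * (p * x - \<epsilon> * r * y) + \<epsilon> * r * (p * y - r * x) = x * d"
        "p * (p * y - r * x) + r * (p * x - \<epsilon> * r * y) = y * d" for x y
        by (auto simp: pr[symmetric] norm_form_def power2_eq_square algebra_simps)
      then show "\<forall>a\<in>{(x, y). norm_form \<epsilon> x y = 1}. (\<lambda>(x, y). ((p * x - \<epsilon> * r * y) / d, (p * y - r * x) / d))
            ((\<lambda>(x, y). (p * x + \<epsilon> * r * y, p * y + r * x)) a) = a"
        "\<forall>a\<in>{(x, y). norm_form \<epsilon> x y = d}. (\<lambda>(x, y). (p * x + \<epsilon> * r * y, p * y + r * x))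
            ((\<lambda>(x, y). ((p * x - \<epsilon> * r * y) / d, (p * y - r * x) / d)) a) = a"
        using d by (auto simp: add_divide_distrib[symmetric] diff_divide_distrib[symmetric])
    qed
    then show ?thesis by (rule bij_betw_same_card[symmetric])
  qed
  have "CARD('a \<times> 'a) = (\<Sum>d\<in>UNIV. card {(x, y). norm_form \<epsilon> x y = d})"
    using sum_card_fibres[of "UNIV :: ('a \<times> 'a) set" UNIV "\<lambda>(x, y). norm_form \<epsilon> x y"]
    by (simp add: case_prod_unfold)
  also have "\<dots> = card {(x, y). norm_form \<epsilon> x y = 0} + (\<Sum>d\<in>UNIV - {0}. card {(x, y). norm_form \<epsilon> x y = d})"
    by (rule sum.remove) auto
  also have "card {(x, y). norm_form \<epsilon> x y = 0} = 1"
    unfolding nz by simp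
  also have "(\<Sum>d\<in>UNIV - {0}. card {(x, y). norm_form \<epsilon> x y = d}) = (CARD('a) - 1) * ?k"
    by (subst sum.cong[OF refl same]) (auto simp: card_Diff_singleton)
  finally have eq: "CARD('a) * CARD('a) = 1 + (CARD('a) - 1) * ?k" by simp
  have q: "CARD('a) \<ge> 2"
    using card_mono[of UNIV "{0, 1::'a}"] by simp
  then obtain r where "CARD('a) = Suc r" "r > 0" by (cases "CARD('a)") auto
  with eq have "r * ?k = r * (r + 2)" by (simp add: algebra_simps)
  then have "?k = r + 2" using \<open>r > 0\<close> by (metis mult_cancel1 not_gr_zero)
  then show ?thesis using \<open>CARD('a) = Suc r\<close> unfolding same[OF c] by simp
qed

text \<open>The matrix \<open>m(x, y, z)\<close> is given the coordinates \<open>(x, y, z - xy/2)\<close>.  For \<open>g\<close> and \<open>h\<close> in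
  these coordinates, \<open>height g h\<close> is the last coordinate of \<open>h g\<^sup>-\<^sup>1\<close>, and \<open>base_norm g h\<close> is the
  norm of the first two.\<close>

definition base_norm :: "'a::field \<Rightarrow> 'a \<times> 'a \<times> 'a \<Rightarrow> 'a \<times> 'a \<times> 'a \<Rightarrow> 'a" where
  "base_norm \<epsilon> = (\<lambda>(x, y, t) (x', y', t'). norm_form \<epsilon> (x' - x) (y' - y))"

definition height :: "'a::field \<times> 'a \<times> 'a \<Rightarrow> 'a \<times> 'a \<times> 'a \<Rightarrow> 'a" where
  "height = (\<lambda>(x, y, t) (x', y', t'). t' - t - (x' * y - x * y') / 2)"

definition cone_rel :: "'a::field \<Rightarrow> 'a \<Rightarrow> 'a \<times> 'a \<times> 'a \<Rightarrow> 'a \<times> 'a \<times> 'a \<Rightarrow> bool" where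
  "cone_rel \<epsilon> j g h \<longleftrightarrow> height g h = j * base_norm \<epsilon> g h"

definition cone_digraph :: "'a::field \<Rightarrow> 'a \<Rightarrow> ('a \<times> 'a \<times> 'a) pair_pre_digraph" where
  "cone_digraph \<epsilon> j = \<lparr>pverts = UNIV, parcs = {(g, h). cone_rel \<epsilon> j g h}\<rparr>"

lemma base_norm_simps [simp]:
  "base_norm \<epsilon> (x, y, t) (x', y', t') = norm_form \<epsilon> (x' - x) (y' - y)"
  by (simp add: base_norm_def)

lemma height_simps [simp]:
  "height (x, y, t) (x', y', t') = t' - t - (x' * y - x * y') / 2"
  by (simp add: height_def)

lemma cone_digraph_simps [simp]:
  "pverts (cone_digraph \<epsilon> j) = UNIV" "(g, h) \<in> parcs (cone_digraph \<epsilon> j) \<longleftrightarrow> cone_rel \<epsilon> j g h"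
  by (auto simp: cone_digraph_def)

lemma pair_fin_digraph_cone_digraph:
  "pair_fin_digraph (cone_digraph \<epsilon> (j :: 'a::{field,finite}))"
  by unfold_locales auto

lemma heis_mat_nth:
  "heis_mat x y z $ 1 $ 1 = 1" "heis_mat x y z $ 1 $ 2 = x" "heis_mat x y z $ 1 $ 3 = z"
  "heis_mat x y z $ 2 $ 1 = 0" "heis_mat x y z $ 2 $ 2 = 1" "heis_mat x y z $ 2 $ 3 = y"
  "heis_mat x y z $ 3 $ 1 = 0" "heis_mat x y z $ 3 $ 2 = 0" "heis_mat x y z $ 3 $ 3 = 1"
  by (simp_all add: heis_mat_def)

lemma heis_mat_eq_iff: "heis_mat x y z = heis_mat x' y' z' \<longleftrightarrow> x = x' \<and> y = y' \<and> z = z'"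
  by (metis heis_mat_nth(2,3,6))

lemma heis_mat_mult:
  "heis_mat x y z ** heis_mat x' y' z' = heis_mat (x + x') (y + y') (z + z' + x * y')"
  by (simp add: vec_eq_iff forall_3 matrix_matrix_mult_def sum_3 heis_mat_nth algebra_simps)

lemma heis_mat_0: "heis_mat 0 0 0 = mat 1"
  by (simp add: vec_eq_iff forall_3 heis_mat_nth mat_def)

section \<open>Cone coordinates on the Heisenberg group\<close>

locale odd_nonsquare =
  fixes \<epsilon> :: "'a::{field,finite}"
  assumes odd_card: "odd CARD('a)" and nonsquare: "\<not> is_square \<epsilon>"
begin

abbreviation "\<delta> \<equiv> 1 / (16 * \<epsilon>)"

lemma two_neq_0 [simp]: "(2::'a) \<noteq> 0"
proof
  assume "(2::'a) = 0"
  then have "CHAR('a) dvd 2" using of_nat_eq_0_iff_char_dvd[of 2, where ?'a = 'a] by simp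
  moreover from this have "CHAR('a) \<le> 2" by (rule dvd_imp_le) simp
  moreover have "CHAR('a) \<noteq> 1" by simp
  ultimately have "CHAR('a) = 2" by (cases "CHAR('a)"; cases "CHAR('a) - 1") auto
  then show False using CHAR_dvd_CARD[where ?'a = 'a] odd_card by simp
qed

lemma four_neq_0 [simp]: "(4::'a) \<noteq> 0"
proof -
  have "(4::'a) = 2 * 2" by simp
  then show ?thesis using two_neq_0 by (metis mult_eq_0_iff)
qed

lemma sixteen_neq_0 [simp]: "(16::'a) \<noteq> 0"
proof -
  have "(16::'a) = 4 * 4" by simp
  then show ?thesis using four_neq_0 by (metis mult_eq_0_iff)
qed

lemma eps_neq_0 [simp]: "\<epsilon> \<noteq> 0" using nonsquare by auto

lemma norm_form_0_iff [simp]: "norm_form \<epsilon> x y = 0 \<longleftrightarrow> x = 0 \<and> y = 0"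
  using norm_form_eq_0_iff[OF nonsquare] .

text \<open>A square root of \<delta> would give one of \<epsilon>, as 16 is a square. Used for the
  associativity of \<open>psi\<close> and to keep the cone (a b + \<delta>) / (a + b) apart from a
  and b.\<close>

lemma square_neq_delta [simp]: "a\<^sup>2 \<noteq> \<delta>"
proof
  assume "a\<^sup>2 = \<delta>"
  then have "\<epsilon> * (4 * a)\<^sup>2 = 1" by (simp add: field_simps power2_eq_square)
  then have "(4 * a)\<^sup>2 * \<epsilon> = 1" by (simp only: mult.commute)
  then have "\<epsilon> = (inverse (4 * a))\<^sup>2" unfolding power_inverse by (rule inverse_unique[symmetric])
  then show False using nonsquare by (auto intro: is_nth_powerI)
qed

text \<open>Replacing the corner entry z by t = z - x y / 2 leaves only the skew part of the
  product, so the last coordinate of h g^-1 becomes \<open>height\<close>. The identity adjoined in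
  \<open>X_set\<close> is the value at (0, 0) that \<open>Y_set\<close> omits, so the connection set
  is a full cone.\<close>

lemma Gamma_digraph_iso_cone_digraph:
  "arc_isomorphism (\<lambda>(x, y, t). heis_mat x y (t + x * y / 2)) (cone_digraph \<epsilon> i) (Gamma_digraph \<epsilon> i)"
    (is "arc_isomorphism ?f _ _")
proof -
  have zero: "mat 1 = heis_mat 0 0 (0 * 0 / 2 + (0\<^sup>2 - \<epsilon> * 0\<^sup>2) * i)"
    by (simp add: heis_mat_0)
  have X: "X_set \<epsilon> i = {heis_mat a b (a * b / 2 + norm_form \<epsilon> a b * i) | a b. True}"
    (is "_ = ?X")
  proof
    show "X_set \<epsilon> i \<subseteq> ?X"
    proof
      fix m assume "m \<in> X_set \<epsilon> i"
      then consider "m \<in> Y_set \<epsilon> i" | "m = mat 1"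
        by (auto simp: X_set_def heisenberg_group_def)
      then show "m \<in> ?X"
      proof cases
        case 1
        then show ?thesis unfolding Y_set_def norm_form_def by blast
      next
        case 2
        show ?thesis unfolding norm_form_def 2 using zero by blast
      qed
    qed
    show "?X \<subseteq> X_set \<epsilon> i"
    proof
      fix m assume "m \<in> ?X"
      then obtain a b where m: "m = heis_mat a b (a * b / 2 + norm_form \<epsilon> a b * i)" by blast
      then show "m \<in> X_set \<epsilon> i"
        by (cases "(a, b) = (0, 0)")
          (auto simp: X_set_def Y_set_def norm_form_def heisenberg_group_def heis_mat_0)
    qed
  qed
  have "bij_betw ?f UNIV (carrier heisenberg_group)"
    unfolding bij_betw_def
  proof
    show "inj ?f" by (auto simp: inj_def heis_mat_eq_iff)
    have "heis_mat x y z \<in> range ?f" for x y z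
      by (rule image_eqI[of _ _ "(x, y, z - x * y / 2)"]) simp_all
    then show "range ?f = carrier heisenberg_group"
      unfolding heisenberg_group_def by auto
  qed
  moreover have "cone_rel \<epsilon> i (x, y, t) (x', y', t') \<longleftrightarrow>
      (?f (x, y, t), ?f (x', y', t')) \<in> parcs (Gamma_digraph \<epsilon> i)" for x y t x' y' t'
  proof -
    have "(?f (x, y, t), ?f (x', y', t')) \<in> parcs (Gamma_digraph \<epsilon> i) \<longleftrightarrow>
      (\<exists>m\<in>X_set \<epsilon> i. ?f (x', y', t') = m ** ?f (x, y, t))"
    proof -
      have "?f p \<in> carrier heisenberg_group" for p
        by (cases p) (auto simp: heisenberg_group_def)
      then show ?thesis
        unfolding Gamma_digraph_def cayley_digraph_def
        by (simp add: heisenberg_group_def) blast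
    qed
    also have "\<dots> \<longleftrightarrow> (\<exists>a b. x' = a + x \<and> y' = b + y \<and>
        t' + x' * y' / 2 = a * b / 2 + norm_form \<epsilon> a b * i + (t + x * y / 2) + a * y)"
    proof -
      have "(\<exists>m\<in>X_set \<epsilon> i. P m) \<longleftrightarrow> (\<exists>a b. P (heis_mat a b (a * b / 2 + norm_form \<epsilon> a b * i)))" for P
        unfolding X by blast
      then show ?thesis by (simp add: heis_mat_mult heis_mat_eq_iff)
    qed
    also have "\<dots> \<longleftrightarrow> t' + x' * y' / 2 = (x' - x) * (y' - y) / 2 + norm_form \<epsilon> (x' - x) (y' - y) * i
        + (t + x * y / 2) + (x' - x) * y"
    proof -
      have *: "x' = a + x \<longleftrightarrow> a = x' - x" "y' = b + y \<longleftrightarrow> b = y' - y" for a b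
        by (auto simp: algebra_simps)
      show ?thesis unfolding * by simp
    qed
    also have "\<dots> \<longleftrightarrow> cone_rel \<epsilon> i (x, y, t) (x', y', t')"
    proof -
      have "t' + x' * y' / 2 - ((x' - x) * (y' - y) / 2 + norm_form \<epsilon> (x' - x) (y' - y) * i
        + (t + x * y / 2) + (x' - x) * y) = height (x, y, t) (x', y', t') - i * norm_form \<epsilon> (x' - x) (y' - y)"
        (is "?L = ?R")
      proof -
        \<comment> \<open>One half enters only through 2 c = 1: the two sides differ by a polynomial
          multiple of 2 c - 1.\<close>
        define c :: 'a where "c = inverse 2"
        have c: "2 * c = 1" by (simp add: c_def)
        have half: "u / 2 = u * c" for u by (simp only: c_def divide_inverse)
        have "?L - ?R = (2 * c - 1) * (x' * y - x * y)"
          unfolding height_simps half by (simp add: algebra_simps)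
        then show ?thesis unfolding c by (simp only: diff_self mult_zero_left right_minus_eq)
      qed
      moreover have "a = b \<longleftrightarrow> c = d" if "a - b = c - d" for a b c d :: 'a
        using that by (metis eq_iff_diff_eq_0)
      ultimately show ?thesis unfolding cone_rel_def base_norm_simps by blast
    qed
    finally show ?thesis ..
  qed
  then have "(u, v) \<in> parcs (cone_digraph \<epsilon> i) \<longleftrightarrow> (?f u, ?f v) \<in> parcs (Gamma_digraph \<epsilon> i)" for u v
    by (cases u; cases v) (simp only: cone_digraph_simps)
  ultimately show ?thesis
    unfolding arc_isomorphism_def by (simp add: Gamma_digraph_def cayley_digraph_def)
qed

end

section \<open>Walks of length two\<close>

lemma card_linear_eq:
  fixes A B C :: "'a::{field,finite}"
  assumes "(A, B) \<noteq> (0, 0)"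
  shows "card {(x, y). A * x + B * y = C} = CARD('a)"
proof (cases "A = 0")
  case False
  then have "{(x, y). A * x + B * y = C} = range (\<lambda>y. ((C - B * y) / A, y))"
    by (auto simp: field_simps)
  then show ?thesis by (simp add: card_image inj_def)
next
  case True
  then have "B \<noteq> 0" using assms by simp
  then have "{(x, y). A * x + B * y = C} = range (\<lambda>x. (x, (C - A * x) / B))"
    by (auto simp: field_simps)
  then show ?thesis by (simp add: card_image inj_def)
qed

context odd_nonsquare
begin

lemma base_norm_sym: "base_norm \<epsilon> h g = base_norm \<epsilon> g h"
  by (cases g; cases h) (simp add: norm_form_def power2_commute)

lemma height_sym: "height h g = - height g h"
  by (cases g; cases h) (simp add: algebra_simps diff_divide_distrib)

lemma cone_rel_sym: "cone_rel \<epsilon> j h g \<longleftrightarrow> cone_rel \<epsilon> (- j) g h"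
  unfolding cone_rel_def base_norm_sym[of h g] height_sym[of h g] by (metis minus_minus mult_minus_left)

lemma cone_rel_refl [simp]: "cone_rel \<epsilon> j g g"
  by (cases g) (simp add: cone_rel_def)

lemma base_norm_eq_0: "base_norm \<epsilon> g h = 0 \<Longrightarrow> height g h = 0 \<Longrightarrow> g = h"
  by (cases g; cases h) simp

text \<open>Up to the factor a + b, the area term adds (r / 4, p / (4 \<epsilon>)) to the centre.
  The norm of this vector is - \<delta> times \<open>norm_form \<epsilon> p r\<close>, which is the
  origin of \<delta>.\<close>

lemma complete_square:
  assumes s: "a + b \<noteq> 0"
  shows "a * norm_form \<epsilon> x y + b * norm_form \<epsilon> (p - x) (r - y) + (p * y - x * r) / 2 - T =
    (a + b) * norm_form \<epsilon> (x - (4 * b * p + r) / (4 * (a + b))) (y - (4 * b * \<epsilon> * r + p) / (4 * \<epsilon> * (a + b)))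
      - (T - (a * b + \<delta>) / (a + b) * norm_form \<epsilon> p r)"
proof -
  define c where "c = (4 * b * p + r) / (4 * (a + b))"
  define d where "d = (4 * b * \<epsilon> * r + p) / (4 * \<epsilon> * (a + b))"
  define k where "k = (a * b + \<delta>) / (a + b)"
  \<comment> \<open>Inverses become letters with \<epsilon> e = 1 and 4 h = 1, which reduces the
    claim to a polynomial identity modulo \<epsilon> e - 1.\<close>
  define e where "e = inverse \<epsilon>"
  define h :: 'a where "h = inverse 4"
  have half: "u / 2 = 2 * u * h" for u :: 'a
  proof -
    have "2 * (2 * h) = 1" by (simp add: h_def)
    then have "inverse 2 = 2 * h" by (rule inverse_unique)
    then show ?thesis by (simp only: divide_inverse mult.assoc mult.left_commute)
  qed
  have h: "4 * h = 1" by (simp add: h_def)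
  have e: "\<epsilon> * e = 1" by (simp add: e_def)
  have c1: "(a + b) * c = b * p + r * h"
  proof -
    have "(a + b) * c = (4 * b * p + r) / 4"
      using s unfolding c_def by (simp del: distrib_left_numeral)
    also have "\<dots> = (4 * h) * (b * p) + r * h"
      by (simp only: h_def divide_inverse distrib_right) (simp only: mult_ac)
    also have "\<dots> = b * p + r * h" unfolding h by simp
    finally show ?thesis .
  qed
  have d1: "(a + b) * d = b * r + p * h * e"
  proof -
    have "(a + b) * d = (4 * b * \<epsilon> * r + p) / (4 * \<epsilon>)" using s unfolding d_def by simp
    also have "\<dots> = b * r + p * h * e"
      by (simp add: add_divide_distrib)
        (simp only: h_def e_def divide_inverse inverse_mult_distrib mult.assoc)
    finally show ?thesis .
  qed
  have k1: "(a + b) * k = a * b + h * h * e"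
  proof -
    have "(16::'a) = 4 * 4" by simp
    then have "\<delta> = h * h * e"
      by (simp only: h_def e_def divide_inverse inverse_mult_distrib mult_1_left)
    then show ?thesis using s unfolding k_def by simp
  qed
  have "(a + b) * (a * norm_form \<epsilon> x y + b * norm_form \<epsilon> (p - x) (r - y) + 2 * (p * y - x * r) * h - T) =
    (a + b) * ((a + b) * norm_form \<epsilon> (x - c) (y - d) - (T - k * norm_form \<epsilon> p r))"
  proof -
    have "(a + b) * ((a + b) * norm_form \<epsilon> (x - c) (y - d) - (T - k * norm_form \<epsilon> p r)) =
      ((a + b) * x - (a + b) * c)\<^sup>2 - \<epsilon> * ((a + b) * y - (a + b) * d)\<^sup>2 - (a + b) * T +
      ((a + b) * k) * norm_form \<epsilon> p r"
      by (simp add: norm_form_def algebra_simps power2_eq_square)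
    also have "\<dots> = ((a + b) * x - (b * p + r * h))\<^sup>2 - \<epsilon> * ((a + b) * y - (b * r + p * h * e))\<^sup>2
      - (a + b) * T + (a * b + h * h * e) * norm_form \<epsilon> p r"
      unfolding c1 d1 k1 ..
    also have "\<dots> = (a + b) * (a * norm_form \<epsilon> x y + b * norm_form \<epsilon> (p - x) (r - y) + 2 * (p * y - x * r) * h - T)"
      (is "?L = ?R")
    proof -
      have "?L - ?R = (\<epsilon> * e - 1) * (2 * (a + b) * p * y * h - 2 * b * r * p * h - p\<^sup>2 * h\<^sup>2 * e - h\<^sup>2 * r\<^sup>2)"
        unfolding norm_form_def by (simp add: algebra_simps power2_eq_square)
      then show ?thesis unfolding e by (simp only: diff_self mult_zero_left right_minus_eq)
    qed
    finally show ?thesis by (rule sym)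
  qed
  then have "a * norm_form \<epsilon> x y + b * norm_form \<epsilon> (p - x) (r - y) + 2 * (p * y - x * r) * h - T =
    (a + b) * norm_form \<epsilon> (x - c) (y - d) - (T - k * norm_form \<epsilon> p r)"
    using s by (metis mult_left_cancel)
  then show ?thesis unfolding half c_def d_def k_def by simp
qed

text \<open>The first cone determines the last coordinate of a midpoint from its displacement (x, y)
  from \<open>g\<close>, so midpoints are counted by one equation in the plane.\<close>

lemma card_paths_aux:
  "card {v. cone_rel \<epsilon> a g v \<and> cone_rel \<epsilon> b v h} = card {(x, y). a * norm_form \<epsilon> x y +
    b * norm_form \<epsilon> (fst h - fst g - x) (fst (snd h) - fst (snd g) - y) +
    ((fst h - fst g) * y - x * (fst (snd h) - fst (snd g))) / 2 = height g h}"
proof -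
  obtain x0 y0 t0 x1 y1 t1 where gh: "g = (x0, y0, t0)" "h = (x1, y1, t1)"
    by (metis prod.exhaust)
  let ?f = "\<lambda>(x, y). (x0 + x, y0 + y, t0 + a * norm_form \<epsilon> x y + (x * y0 - x0 * y) / 2)"
  define c :: 'a where "c = inverse 2"
  have half: "u / 2 = u * c" for u by (simp only: c_def divide_inverse)
  have g: "cone_rel \<epsilon> a g v \<longleftrightarrow> v = ?f (fst v - x0, fst (snd v) - y0)" for v
  proof -
    obtain x y t where v: "v = (x, y, t)" by (metis prod.exhaust)
    show ?thesis unfolding v gh cone_rel_def half by (auto simp: half algebra_simps)
  qed
  have h: "cone_rel \<epsilon> b (?f (x, y)) h \<longleftrightarrow> a * norm_form \<epsilon> x y +
    b * norm_form \<epsilon> (fst h - fst g - x) (fst (snd h) - fst (snd g) - y) +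
    ((fst h - fst g) * y - x * (fst (snd h) - fst (snd g))) / 2 = height g h" for x y
    unfolding gh cone_rel_def half
    by (auto simp: half algebra_simps)
  show ?thesis
  proof (rule bij_betw_same_card[symmetric], rule bij_betw_imageI)
    show "inj_on ?f A" for A by (auto simp: inj_on_def)
    show "?f ` {(x, y). a * norm_form \<epsilon> x y +
      b * norm_form \<epsilon> (fst h - fst g - x) (fst (snd h) - fst (snd g) - y) +
      ((fst h - fst g) * y - x * (fst (snd h) - fst (snd g))) / 2 = height g h} =
      {v. cone_rel \<epsilon> a g v \<and> cone_rel \<epsilon> b v h}" (is "?f ` ?A = ?B")
    proof
      show "?f ` ?A \<subseteq> ?B" using g h by auto
      show "?B \<subseteq> ?f ` ?A"
      proof
        fix v assume v: "v \<in> ?B"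
        then have v1: "v = ?f (fst v - x0, fst (snd v) - y0)" using g by blast
        then have "(fst v - x0, fst (snd v) - y0) \<in> ?A"
          using v h[of "fst v - x0" "fst (snd v) - y0"] by simp
        then show "v \<in> ?f ` ?A" using v1 by (rule rev_image_eqI)
      qed
    qed
  qed
qed

text \<open>After \<open>complete_square\<close> the midpoints are the points of norm m around a
  centre, where m measures how far the pair is off the cone psi(a, b): one point for m = 0 and q + 1
  otherwise.\<close>

lemma card_paths:
  assumes s: "a + b \<noteq> 0"
  shows "card {v. cone_rel \<epsilon> a g v \<and> cone_rel \<epsilon> b v h} =
    (if cone_rel \<epsilon> ((a * b + \<delta>) / (a + b)) g h then 1 else CARD('a) + 1)"
proof -
  let ?p = "fst h - fst g" and ?r = "fst (snd h) - fst (snd g)"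
  define k where "k = (a * b + \<delta>) / (a + b)"
  define c where "c = (4 * b * ?p + ?r) / (4 * (a + b))"
  define d where "d = (4 * b * \<epsilon> * ?r + ?p) / (4 * \<epsilon> * (a + b))"
  define m where "m = (height g h - k * norm_form \<epsilon> ?p ?r) / (a + b)"
  have bn: "norm_form \<epsilon> ?p ?r = base_norm \<epsilon> g h" by (cases g; cases h) simp
  have m0: "m = 0 \<longleftrightarrow> cone_rel \<epsilon> k g h"
    using s unfolding m_def bn cone_rel_def by simp
  have "a * norm_form \<epsilon> x y + b * norm_form \<epsilon> (?p - x) (?r - y) + (?p * y - x * ?r) / 2 = height g h \<longleftrightarrow>
      norm_form \<epsilon> (x - c) (y - d) = m" for x y
  proof -
    have "a * norm_form \<epsilon> x y + b * norm_form \<epsilon> (?p - x) (?r - y) + (?p * y - x * ?r) / 2 = height g h \<longleftrightarrow>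
      (a + b) * norm_form \<epsilon> (x - c) (y - d) = height g h - k * norm_form \<epsilon> ?p ?r"
      using complete_square[OF s, of x y ?p ?r "height g h"] unfolding c_def d_def k_def
      by (metis (no_types, lifting) right_minus_eq)
    then show ?thesis using s unfolding m_def by (auto simp: field_simps)
  qed
  then have "card {v. cone_rel \<epsilon> a g v \<and> cone_rel \<epsilon> b v h} = card {(x, y). norm_form \<epsilon> (x - c) (y - d) = m}"
    unfolding card_paths_aux by simp
  also have "\<dots> = card {(x, y). norm_form \<epsilon> x y = m}"
  proof (rule bij_betw_same_card, rule bij_betw_imageI)
    show "inj_on (\<lambda>(x, y). (x - c, y - d)) A" for A by (auto simp: inj_on_def)
    show "(\<lambda>(x, y). (x - c, y - d)) ` {(x, y). norm_form \<epsilon> (x - c) (y - d) = m} = {(x, y). norm_form \<epsilon> x y = m}"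
    proof
      show "{(x, y). norm_form \<epsilon> x y = m} \<subseteq> (\<lambda>(x, y). (x - c, y - d)) ` {(x, y). norm_form \<epsilon> (x - c) (y - d) = m}"
      proof
        fix z assume "z \<in> {(x, y). norm_form \<epsilon> x y = m}"
        then show "z \<in> (\<lambda>(x, y). (x - c, y - d)) ` {(x, y). norm_form \<epsilon> (x - c) (y - d) = m}"
          by (intro image_eqI[of _ _ "(fst z + c, snd z + d)"]) auto
      qed
    qed auto
  qed
  also have "\<dots> = (if m = 0 then 1 else CARD('a) + 1)"
    using card_norm_form_eq[OF nonsquare, of m] by (cases "m = 0") auto
  finally show ?thesis unfolding m0 k_def .
qed

text \<open>For opposite cones the quadratic parts cancel and a linear equation remains. Its
  coefficients vanish together only when both endpoints have the same base point, for otherwise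
  \<epsilon> would be a square.\<close>

lemma card_paths_inverse:
  "card {v. cone_rel \<epsilon> a g v \<and> cone_rel \<epsilon> (- a) v h} =
    (if base_norm \<epsilon> g h \<noteq> 0 then CARD('a) else if g = h then CARD('a)\<^sup>2 else 0)"
proof -
  let ?p = "fst h - fst g" and ?r = "fst (snd h) - fst (snd g)"
  have bn: "base_norm \<epsilon> g h = norm_form \<epsilon> ?p ?r" by (cases g; cases h) simp
  define c :: 'a where "c = inverse 2"
  have c: "2 * c = 1" by (simp add: c_def)
  have half: "u / 2 = u * c" for u by (simp only: c_def divide_inverse)
  define A where "A = 2 * a * ?p - c * ?r"
  define B where "B = c * ?p - 2 * a * \<epsilon> * ?r"
  have "a * norm_form \<epsilon> x y + (- a) * norm_form \<epsilon> (?p - x) (?r - y) + (?p * y - x * ?r) / 2 = height g h \<longleftrightarrow>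
      A * x + B * y = height g h + a * norm_form \<epsilon> ?p ?r" for x y
    unfolding A_def B_def half norm_form_def by (auto simp: algebra_simps power2_eq_square)
  then have eq: "card {v. cone_rel \<epsilon> a g v \<and> cone_rel \<epsilon> (- a) v h} =
      card {(x, y). A * x + B * y = height g h + a * norm_form \<epsilon> ?p ?r}"
    unfolding card_paths_aux by simp
  show ?thesis
  proof (cases "base_norm \<epsilon> g h = 0")
    case True
    then have pr: "?p = 0" "?r = 0" unfolding bn by auto
    then have "card {v. cone_rel \<epsilon> a g v \<and> cone_rel \<epsilon> (- a) v h} = card {(x::'a, y::'a). height g h = 0}"
      unfolding eq A_def B_def by (simp add: eq_commute[of 0 "height g h"] norm_form_def)
    also have "\<dots> = (if g = h then CARD('a)\<^sup>2 else 0)"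
      using base_norm_eq_0[OF True] by (auto simp: power2_eq_square case_prod_unfold) (cases h; simp)
    finally show ?thesis using True by simp
  next
    case False
    have "(A, B) \<noteq> (0, 0)"
    proof
      assume "(A, B) = (0, 0)"
      then have A: "2 * a * ?p = c * ?r" and B: "c * ?p = 2 * a * \<epsilon> * ?r"
        by (auto simp: A_def B_def)
      have r: "?r = 4 * a * ?p" using arg_cong[OF A, of "\<lambda>u. 2 * u"] c
        by (simp only: mult.assoc[symmetric]) (simp add: mult.assoc)
      have "?p = 4 * a * \<epsilon> * ?r" using arg_cong[OF B, of "\<lambda>u. 2 * u"] c
        by (simp only: mult.assoc[symmetric]) (simp add: mult.assoc)
      then have "?p * (1 - (4 * a)\<^sup>2 * \<epsilon>) = 0" unfolding r by (simp add: algebra_simps power2_eq_square)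
      moreover have "?p \<noteq> 0" using False r unfolding bn by auto
      ultimately have "(4 * a)\<^sup>2 * \<epsilon> = 1" by simp
      then have "\<epsilon> = (inverse (4 * a))\<^sup>2" unfolding power_inverse by (rule inverse_unique[symmetric])
      then show False using nonsquare by (auto intro: is_nth_powerI)
    qed
    then show ?thesis unfolding eq using False by (simp add: card_linear_eq)
  qed
qed

end

section \<open>Colour refinement recognises the cones\<close>

context odd_nonsquare
begin

lemma psi_Some_eq_None_iff: "psi \<epsilon> (Some a) y = None \<longleftrightarrow> y = Some (- a)"
  by (cases y) (auto simp: eq_neg_iff_add_eq_0 add.commute)

lemma psi_commute: "psi \<epsilon> x y = psi \<epsilon> y x"
  by (cases x; cases y) (auto simp: add.commute mult.commute)

lemma inv_psi_group_Some: "inv\<^bsub>psi_group \<epsilon>\<^esub> (Some a) = Some (- a)"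
  unfolding m_inv_def
  by (rule the_equality)
    (auto simp: psi_group_def psi_Some_eq_None_iff)

text \<open>The walk counts \<open>card_paths\<close> propagate recognition of the relations \<open>cone_rel \<epsilon> a\<close>
  and \<open>cone_rel \<epsilon> b\<close> to \<open>cone_rel \<epsilon> (\<psi> a b)\<close>, hence from a generator to all of them.\<close>

lemma cones_recognised:
  fixes Q :: "nat \<Rightarrow> 'a \<times> 'a \<times> 'a \<Rightarrow> 'a \<times> 'a \<times> 'a \<Rightarrow> 'a \<times> 'a \<times> 'a \<Rightarrow> 'a \<times> 'a \<times> 'a \<Rightarrow> bool"
    and \<sigma> :: "'a \<Rightarrow> 'a"
  assumes gen: "i \<in> psi_generators \<epsilon>"
    and hom: "\<And>a b. psi \<epsilon> (Some (\<sigma> a)) (Some (\<sigma> b)) = map_option \<sigma> (psi \<epsilon> (Some a) (Some b))"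
    and mono: "\<And>m g h g' h'. Q (Suc m) g h g' h' \<Longrightarrow> Q m g h g' h'"
    and sym: "\<And>m g h g' h'. Q m g h g' h' \<Longrightarrow> Q m h g h' g'"
    and arc: "\<And>m g h g' h'. Q m g h g' h' \<Longrightarrow> cone_rel \<epsilon> i g h \<longleftrightarrow> cone_rel \<epsilon> (\<sigma> i) g' h'"
    and step: "\<And>m g h g' h'. Q (Suc m) g h g' h' \<Longrightarrow>
      \<exists>f. bij f \<and> (\<forall>v. Q m g v g' (f v) \<and> Q m v h (f v) h')"
  obtains m where "\<And>k g h g' h'. Q m g h g' h' \<Longrightarrow> cone_rel \<epsilon> k g h \<longleftrightarrow> cone_rel \<epsilon> (\<sigma> k) g' h'"
proof -
  have mono': "Q n g h g' h'" if "Q m g h g' h'" "n \<le> m" for n m g h g' h'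
    using that(2,1) by (induction rule: inc_induct) (auto intro: mono)
  \<comment> \<open>\<open>Q\<close> and \<sigma> stay abstract because two instances follow:
    equality of colours with \<sigma> the identity, and the graph of an isomorphism with \<sigma> a
    power map. \<open>R\<close> records from which round on a cone is recognised.\<close>
  define R where "R j m \<longleftrightarrow> (\<forall>g h g' h'. Q m g h g' h' \<longrightarrow> cone_rel \<epsilon> j g h = cone_rel \<epsilon> (\<sigma> j) g' h')" for j m
  have sig_neg: "\<sigma> (- a) = - \<sigma> a" for a
  proof -
    have "psi \<epsilon> (Some (\<sigma> a)) (Some (\<sigma> (- a))) = None" using hom[of a "- a"] by simp
    then show ?thesis unfolding psi_Some_eq_None_iff by simp
  qed
  have R_i: "R i 0" unfolding R_def using arc by blast
  have R_neg: "R (- j) m" if "R j m" for j m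
    using that sym cone_rel_sym[of "- j"] cone_rel_sym[of "\<sigma> (- j)"] unfolding R_def sig_neg
    by (metis cone_rel_sym)
  have R_psi: "\<exists>m. R k m" if ab: "R a m" "R b n" "psi \<epsilon> (Some a) (Some b) = Some k" for a b k m n
  proof -
    have s: "a + b \<noteq> 0" and k: "k = (a * b + \<delta>) / (a + b)"
      using ab(3) by (auto split: if_splits)
    have s': "\<sigma> a + \<sigma> b \<noteq> 0" and k': "\<sigma> k = (\<sigma> a * \<sigma> b + \<delta>) / (\<sigma> a + \<sigma> b)"
      using hom[of a b] unfolding ab(3) by (auto split: if_splits)
    have "cone_rel \<epsilon> k g h = cone_rel \<epsilon> (\<sigma> k) g' h'" if Q: "Q (Suc (max m n)) g h g' h'" for g h g' h'
    proof -
      obtain f where f: "bij f" "\<And>v. Q (max m n) g v g' (f v) \<and> Q (max m n) v h (f v) h'"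
        using step[OF Q] by blast
      then have eq: "cone_rel \<epsilon> a g v \<and> cone_rel \<epsilon> b v h \<longleftrightarrow> cone_rel \<epsilon> (\<sigma> a) g' (f v) \<and> cone_rel \<epsilon> (\<sigma> b) (f v) h'" for v
        using ab(1,2) mono'[of "max m n" _ _ _ _ m] mono'[of "max m n" _ _ _ _ n]
        unfolding R_def by (metis max.cobounded1 max.cobounded2)
      have "card {v. cone_rel \<epsilon> (\<sigma> a) g' v \<and> cone_rel \<epsilon> (\<sigma> b) v h'} =
          card {v. cone_rel \<epsilon> a g v \<and> cone_rel \<epsilon> b v h}"
      proof (rule bij_betw_same_card[symmetric, of f], rule bij_betw_imageI)
        show "inj_on f {v. cone_rel \<epsilon> a g v \<and> cone_rel \<epsilon> b v h}"
          using f(1) by (meson bij_is_inj inj_on_subset subset_UNIV)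
        show "f ` {v. cone_rel \<epsilon> a g v \<and> cone_rel \<epsilon> b v h} = {v. cone_rel \<epsilon> (\<sigma> a) g' v \<and> cone_rel \<epsilon> (\<sigma> b) v h'}"
        proof
          show "f ` {v. cone_rel \<epsilon> a g v \<and> cone_rel \<epsilon> b v h} \<subseteq> {v. cone_rel \<epsilon> (\<sigma> a) g' v \<and> cone_rel \<epsilon> (\<sigma> b) v h'}"
            using eq by blast
          show "{v. cone_rel \<epsilon> (\<sigma> a) g' v \<and> cone_rel \<epsilon> (\<sigma> b) v h'} \<subseteq> f ` {v. cone_rel \<epsilon> a g v \<and> cone_rel \<epsilon> b v h}"
          proof
            fix w assume w: "w \<in> {v. cone_rel \<epsilon> (\<sigma> a) g' v \<and> cone_rel \<epsilon> (\<sigma> b) v h'}"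
            obtain v where v: "w = f v" using bij_is_surj[OF f(1)] by (rule surjE)
            show "w \<in> f ` {v. cone_rel \<epsilon> a g v \<and> cone_rel \<epsilon> b v h}"
              unfolding v using w[unfolded v] eq[of v] by blast
          qed
        qed
      qed
      \<comment> \<open>The count reveals membership in the cone \<open>k\<close>: it is 1 on it and
        q + 1 off it, on both sides.\<close>
      then show ?thesis
        unfolding card_paths[OF s] card_paths[OF s'] k[symmetric] k'[symmetric] by (auto split: if_splits)
    qed
    then show ?thesis unfolding R_def by blast
  qed
  \<comment> \<open>The identity \<infinity> stands for no cone, hence the trivial case.\<close>
  have all: "case x of None \<Rightarrow> True | Some j \<Rightarrow> \<exists>m. R j m" if "x \<in> generate (psi_group \<epsilon>) {Some i}" for x
    using that
  proof (induction rule: generate.induct)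
    case one
    then show ?case by (simp add: psi_group_def)
  next
    case (incl h)
    then show ?case using R_i by auto
  next
    case (inv h)
    then show ?case using R_neg[OF R_i] by (auto simp: inv_psi_group_Some)
  next
    case (eng h1 h2)
    then show ?case
      using R_psi by (cases h1; cases h2) (auto simp: psi_group_def split: option.splits if_splits)
  qed
  have "\<exists>m. R j m" for j
  proof -
    have "Some j \<in> generate (psi_group \<epsilon>) {Some i}"
      using gen by (simp add: psi_generators_def psi_group_def)
    then show ?thesis using all[of "Some j"] by simp
  qed
  then obtain r where r: "R j (r j)" for j by metis
  \<comment> \<open>The field is finite, so one round serves all cones.\<close>
  define M where "M = Max (range r)"
  have "cone_rel \<epsilon> k g h \<longleftrightarrow> cone_rel \<epsilon> (\<sigma> k) g' h'" if "Q M g h g' h'" for k g h g' h'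
  proof -
    have "r k \<le> M" unfolding M_def by (rule Max_ge) auto
    then show ?thesis using r[of k] mono'[OF that] unfolding R_def by blast
  qed
  then show ?thesis using that by blast
qed

text \<open>A pair is traced as two entries of a tuple. Overwriting any place other than that of the
  endpoint to be kept exposes the relation of this endpoint to \<open>v\<close>; such a place exists
  as soon as the tuple has two entries.\<close>

lemma colours_recognise_cones:
  assumes gen: "i \<in> psi_generators \<epsilon>" and k: "2 \<le> k"
  obtains m where "\<And>xs ys a b j. length xs = k \<Longrightarrow>
    wl_tuple_colour (cone_digraph \<epsilon> i) m xs = wl_tuple_colour (cone_digraph \<epsilon> i) m ys \<Longrightarrow>
    a < k \<Longrightarrow> b < k \<Longrightarrow> cone_rel \<epsilon> j (xs ! a) (xs ! b) \<longleftrightarrow> cone_rel \<epsilon> j (ys ! a) (ys ! b)"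
proof -
  let ?c = "wl_tuple_colour (cone_digraph \<epsilon> i)"
  define Q where "Q m g h g' h' \<longleftrightarrow> (\<exists>xs ys a b. length xs = k \<and> ?c m xs = ?c m ys \<and> a < k \<and> b < k \<and>
    g = xs ! a \<and> h = xs ! b \<and> g' = ys ! a \<and> h' = ys ! b)" for m g h g' h'
  have len: "length ys = length xs" if "?c m xs = ?c m ys" for m xs ys
    using tuple_type_eqD(1)[OF wl_tuple_colour_type[OF that]] by simp
  obtain m where m: "\<And>j g h g' h'. Q m g h g' h' \<Longrightarrow> cone_rel \<epsilon> j g h \<longleftrightarrow> cone_rel \<epsilon> j g' h'"
  proof (rule cones_recognised[where Q = Q and \<sigma> = "\<lambda>x. x", OF gen])
    show "psi \<epsilon> (Some a) (Some b) = map_option (\<lambda>x. x) (psi \<epsilon> (Some a) (Some b))" for a b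
      by (simp add: option.map_ident)
    show "Q m g h g' h'" if "Q (Suc m) g h g' h'" for m g h g' h'
      using that wl_tuple_colour_mono[of _ "Suc m" _ _ _ m] unfolding Q_def by (metis le_SucI order_refl)
    show "Q m h g h' g'" if "Q m g h g' h'" for m g h g' h'
      using that unfolding Q_def by blast
    show "cone_rel \<epsilon> i g h \<longleftrightarrow> cone_rel \<epsilon> i g' h'" if Q: "Q m g h g' h'" for m g h g' h'
    proof -
      obtain xs ys a b where *: "length xs = k" "?c m xs = ?c m ys" "a < k" "b < k"
        "g = xs ! a" "h = xs ! b" "g' = ys ! a" "h' = ys ! b" using Q unfolding Q_def by blast
      show ?thesis using tuple_type_eqD(3)[OF wl_tuple_colour_type[OF *(2)], of a b] * by simp
    qed
    show "\<exists>f. bij f \<and> (\<forall>v. Q m g v g' (f v) \<and> Q m v h (f v) h')" if Q: "Q (Suc m) g h g' h'" for m g h g' h'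
    proof -
      obtain xs ys a b where *: "length xs = k" "?c (Suc m) xs = ?c (Suc m) ys" "a < k" "b < k"
        "g = xs ! a" "h = xs ! b" "g' = ys ! a" "h' = ys ! b" using Q unfolding Q_def by blast
      have ly: "length ys = k" using len[OF *(2)] * by simp
      obtain f where f: "bij f"
        and eq: "\<And>v a. a < k \<Longrightarrow> ?c m (xs[a := v]) = ?c m (ys[a := f v])"
        using wl_tuple_colour_step[OF _ _ *(2)] * by (auto simp del: wl_tuple_colour.simps)
      have other: "\<exists>c<k. c \<noteq> a" for a
        using k by (intro exI[of _ "if a = 0 then 1 else 0"]) auto
      have "Q m g v g' (f v)" for v
      proof -
        obtain c where c: "c < k" "c \<noteq> a" using other by blast
        show ?thesis unfolding Q_def
          by (rule exI[of _ "xs[c := v]"], rule exI[of _ "ys[c := f v]"], rule exI[of _ a], rule exI[of _ c])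
            (use c * ly eq in auto)
      qed
      moreover have "Q m v h (f v) h'" for v
      proof -
        obtain c where c: "c < k" "c \<noteq> b" using other by blast
        show ?thesis unfolding Q_def
          by (rule exI[of _ "xs[c := v]"], rule exI[of _ "ys[c := f v]"], rule exI[of _ c], rule exI[of _ b])
            (use c * ly eq in auto)
      qed
      ultimately show ?thesis using f by blast
    qed
  qed blast
  then show ?thesis using that unfolding Q_def by blast
qed

text \<open>Individualising \<open>(0, 0, 0)\<close> and \<open>(1, 0, 0)\<close> individualises every point of their two fibres,
  and the cones through these points determine all coordinates.\<close>

lemma wl_identifies_3:
  assumes gen: "i \<in> psi_generators \<epsilon>"
  shows "wl_identifies 3 (cone_digraph \<epsilon> i)"
proof -
  let ?c = "wl_tuple_colour (cone_digraph \<epsilon> i)"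
  obtain m where m: "\<And>xs ys a b j. \<lbrakk>length xs = 3; ?c m xs = ?c m ys; a < 3; b < 3\<rbrakk> \<Longrightarrow>
      cone_rel \<epsilon> j (xs ! a) (xs ! b) \<longleftrightarrow> cone_rel \<epsilon> j (ys ! a) (ys ! b)"
    using colours_recognise_cones[OF gen, of 3] by auto
  let ?e = "(0::'a, 0::'a, 0::'a)" and ?y = "(1::'a, 0::'a, 0::'a)"
  have "z = z'" if eq: "?c (Suc m) [?e, ?y, z] = ?c (Suc m) [?e, ?y, z']" for z z'
  proof -
    obtain f where f0: "\<And>v a. v \<in> pverts (cone_digraph \<epsilon> i) \<Longrightarrow> a < length [?e, ?y, z] \<Longrightarrow>
        ?c m ([?e, ?y, z][a := v]) = ?c m ([?e, ?y, z'][a := f v])"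
      by (rule wl_tuple_colour_step[OF _ _ eq]) (simp, simp, blast)
    have f: "?c m ([?e, ?y, z][a := v]) = ?c m ([?e, ?y, z'][a := f v])" if "a < 3" for a v
      by (rule f0) (use that in auto)
    have e: "cone_rel \<epsilon> j ?e v \<longleftrightarrow> cone_rel \<epsilon> j ?e (f v)" and y: "cone_rel \<epsilon> j ?y v \<longleftrightarrow> cone_rel \<epsilon> j ?y (f v)" for j v
      using m[OF _ f[of 2 v], of 0 2 j] m[OF _ f[of 2 v], of 1 2 j] by (simp_all add: numeral_2_eq_2)
    have z: "cone_rel \<epsilon> j v z \<longleftrightarrow> cone_rel \<epsilon> j (f v) z'" for j v
      using m[OF _ f[of 0 v], of 0 2 j] by (simp add: numeral_2_eq_2)
    \<comment> \<open>A point of the fibre of \<open>?e\<close> other than \<open>?e\<close> lies on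
      no cone from \<open>?e\<close>, so its image stays in that fibre. Seen from \<open>?y\<close>,
      this fibre has norm 1, so the cones from \<open>?y\<close> read off the last
      coordinate.\<close>
    have fe: "f (0, 0, t) = (0, 0, t)" for t
    proof -
      obtain x' y' t' where ft: "f (0, 0, t) = (x', y', t')" by (metis prod.exhaust)
      show ?thesis
      proof (cases "t = 0")
        case True
        have "t' = 0" "t' = norm_form \<epsilon> x' y'"
          using e[of 0 "(0, 0, t)"] e[of 1 "(0, 0, t)"] True ft
          by (simp_all add: cone_rel_def norm_form_def)
        then show ?thesis using ft True by simp
      next
        case False
        have "\<not> cone_rel \<epsilon> (t' / norm_form \<epsilon> x' y') ?e (x', y', t')"
          using e[of "t' / norm_form \<epsilon> x' y'" "(0, 0, t)"] ft False by (simp add: cone_rel_def norm_form_def)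
        then have "norm_form \<epsilon> x' y' = 0" by (auto simp: cone_rel_def split: if_splits)
        then have xy: "x' = 0" "y' = 0" by auto
        have "cone_rel \<epsilon> t ?y (0, 0, t)" by (simp add: cone_rel_def norm_form_def)
        then have "cone_rel \<epsilon> t ?y (0, 0, t')" using y[of t "(0, 0, t)"] ft xy by simp
        then show ?thesis using ft xy by (simp add: cone_rel_def norm_form_def)
      qed
    qed
    have fy: "f (1, 0, t) = (1, 0, t)" for t
    proof -
      obtain x' y' t' where ft: "f (1, 0, t) = (x', y', t')" by (metis prod.exhaust)
      show ?thesis
      proof (cases "t = 0")
        case True
        have "t' - y' / 2 * (-1) = 0" "t' - y' / 2 * (-1) = norm_form \<epsilon> (x' - 1) y'"
          using y[of 0 "(1, 0, t)"] y[of 1 "(1, 0, t)"] True ft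
          by (simp_all add: cone_rel_def norm_form_def)
        then have "norm_form \<epsilon> (x' - 1) y' = 0" by metis
        then have "x' = 1" "y' = 0" unfolding norm_form_0_iff by auto
        with \<open>t' - y' / 2 * (-1) = 0\<close> show ?thesis using ft True by simp
      next
        case False
        have "\<not> cone_rel \<epsilon> ((t' + y' / 2) / norm_form \<epsilon> (x' - 1) y') ?y (x', y', t')"
          using y[of "(t' + y' / 2) / norm_form \<epsilon> (x' - 1) y'" "(1, 0, t)"] ft False
          by (simp add: cone_rel_def norm_form_def)
        then have "norm_form \<epsilon> (x' - 1) y' = 0" by (auto simp: cone_rel_def split: if_splits)
        then have xy: "x' = 1" "y' = 0" unfolding norm_form_0_iff by auto
        have "cone_rel \<epsilon> t ?e (1, 0, t)" by (simp add: cone_rel_def norm_form_def)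
        then have "cone_rel \<epsilon> t ?e (1, 0, t')" using e[of t "(1, 0, t)"] ft xy by simp
        then show ?thesis using ft xy by (simp add: cone_rel_def norm_form_def)
      qed
    qed
    have z0: "cone_rel \<epsilon> j (0, 0, t) z \<longleftrightarrow> cone_rel \<epsilon> j (0, 0, t) z'" for j t
      using z[of j "(0, 0, t)"] fe by simp
    have z1: "cone_rel \<epsilon> j (1, 0, t) z \<longleftrightarrow> cone_rel \<epsilon> j (1, 0, t) z'" for j t
      using z[of j "(1, 0, t)"] fy by simp
    obtain u v t u' v' t' where zz: "z = (u, v, t)" "z' = (u', v', t')" by (metis prod.exhaust)
    \<comment> \<open>The fixed fibre points yield in turn \<open>t\<close>, the norm,
      \<open>v\<close> and the norm seen from (1, 0); the difference of the two norms gives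
      \<open>u\<close>.\<close>
    have t: "t = t'" using z0[of 0 t] zz by (simp add: cone_rel_def)
    have n: "norm_form \<epsilon> u v = norm_form \<epsilon> u' v'"
      using z0[of 1 "t - norm_form \<epsilon> u v"] zz t by (simp add: cone_rel_def)
    have "v / 2 = v' / 2" using z1[of 0 "t + v / 2"] zz t by (simp add: cone_rel_def)
    then have v: "v = v'" by simp
    have "norm_form \<epsilon> (u - 1) v = norm_form \<epsilon> (u' - 1) v'"
      using z1[of 1 "t + v / 2 - norm_form \<epsilon> (u - 1) v"] zz t v by (simp add: cone_rel_def)
    then have "2 * u = 2 * u'" using n v by (simp add: norm_form_def power2_eq_square algebra_simps)
    then have "u = u'" by simp
    then show ?thesis using zz t v by simp
  qed
  then have "inj_on (\<lambda>z. ?c (Suc m) [?e, ?y, z]) UNIV" by (auto intro: inj_onI simp del: wl_tuple_colour.simps)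
  then show ?thesis using wl3_identifiesI[OF pair_fin_digraph_cone_digraph, of ?e \<epsilon> i ?y "Suc m"] by simp
qed

end

section \<open>Failure of the one-dimensional algorithm\<close>

text \<open>A two-by-two table is determined by its total, two margins and one cell.\<close>

lemma bool_pair_image_mset_eqI:
  assumes fin: "finite A" "finite B" and card: "card A = card B"
    and P: "card {a \<in> A. P a} = card {b \<in> B. P' b}"
    and Q: "card {a \<in> A. Q a} = card {b \<in> B. Q' b}"
    and PQ: "card {a \<in> A. P a \<and> Q a} = card {b \<in> B. P' b \<and> Q' b}"
  shows "image_mset (\<lambda>a. (P a, Q a)) (mset_set A) = image_mset (\<lambda>b. (P' b, Q' b)) (mset_set B)"
proof -
  have diff: "card {x \<in> S. F x \<and> \<not> H x} = card {x \<in> S. F x} - card {x \<in> S. F x \<and> H x}"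
    if "finite S" for S :: "'x set" and F H
  proof -
    have "{x \<in> S. F x \<and> \<not> H x} = {x \<in> S. F x} - {x \<in> S. F x \<and> H x}" by blast
    then show ?thesis using that by (simp add: card_Diff_subset Collect_mono_iff)
  qed
  have count: "count (image_mset f (mset_set S)) x = card {s \<in> S. f s = x}"
    if "finite S" for f :: "'x \<Rightarrow> 'y" and S x
    using that by (simp add: count_image_mset' Collect_conj_eq sum.If_cases eq_commute
        flip: sum.inter_filter)
  show ?thesis
  proof (rule multiset_eqI)
    fix x :: "bool \<times> bool"
    have TF: "card {a \<in> A. P a \<and> \<not> Q a} = card {b \<in> B. P' b \<and> \<not> Q' b}"
      unfolding diff[OF fin(1)] diff[OF fin(2)] P PQ ..
    have FT: "card {a \<in> A. Q a \<and> \<not> P a} = card {b \<in> B. Q' b \<and> \<not> P' b}"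
      unfolding diff[OF fin(1)] diff[OF fin(2)] Q using PQ by (simp add: conj_commute)
    have nP: "card {a \<in> A. \<not> P a} = card {b \<in> B. \<not> P' b}"
      using diff[OF fin(1), of "\<lambda>_. True" P] diff[OF fin(2), of "\<lambda>_. True" P'] P card by simp
    have FF: "card {a \<in> A. \<not> P a \<and> \<not> Q a} = card {b \<in> B. \<not> P' b \<and> \<not> Q' b}"
      unfolding diff[OF fin(1)] diff[OF fin(2)] nP using FT by (simp add: conj_commute)
    show "count (image_mset (\<lambda>a. (P a, Q a)) (mset_set A)) x =
        count (image_mset (\<lambda>b. (P' b, Q' b)) (mset_set B)) x"
      unfolding count[OF fin(1)] count[OF fin(2)]
      using PQ TF FT FF by (cases x; cases "fst x"; cases "snd x") (simp_all add: conj_commute)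
  qed
qed

text \<open>The competitor for the one-dimensional algorithm: for n = q^3 and s = q^2 it has the
  degrees of the cone digraph. Each vertex has arcs to a cyclic interval that starts at the vertex
  itself.\<close>

definition circulant :: "nat \<Rightarrow> nat \<Rightarrow> int pair_pre_digraph" where
  "circulant n s = \<lparr>pverts = {0..<int n},
     parcs = {(u, v). u \<in> {0..<int n} \<and> v \<in> {0..<int n} \<and> (v - u) mod int n < int s}\<rparr>"

lemma circulant_simps [simp]:
  "pverts (circulant n s) = {0..<int n}"
  "(u, v) \<in> parcs (circulant n s) \<longleftrightarrow> u \<in> {0..<int n} \<and> v \<in> {0..<int n} \<and> (v - u) mod int n < int s"
  by (auto simp: circulant_def)

lemma pair_wf_digraph_circulant: "pair_wf_digraph (circulant n s)"
  unfolding pair_wf_digraph_def circulant_def by auto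

lemma card_circulant_neighbours:
  assumes "s \<le> n" and u: "u \<in> {0..<int n}"
  shows "card {v \<in> {0..<int n}. (u, v) \<in> parcs (circulant n s)} = s"
    and "card {v \<in> {0..<int n}. (v, u) \<in> parcs (circulant n s)} = s"
proof -
  have n: "int n > 0" using u by auto
  have sub: "{0..<int s} \<subseteq> {0..<int n}" using assms by auto
  have inv: "((v - u) mod int n + u) mod int n = v" "((v + u) mod int n - u) mod int n = v"
    "(u - (u - v) mod int n) mod int n = v" if "v \<in> {0..<int n}" for v
    using that by (simp_all add: mod_add_left_eq mod_diff_left_eq mod_diff_right_eq)
  have range: "0 \<le> a mod int n" "a mod int n < int n" for a using n by simp_all
  have "bij_betw (\<lambda>v. (v - u) mod int n) {v \<in> {0..<int n}. (u, v) \<in> parcs (circulant n s)} {0..<int s}"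
  proof (rule bij_betw_byWitness[where f' = "\<lambda>d. (d + u) mod int n"])
    show "\<forall>v\<in>{v \<in> {0..<int n}. (u, v) \<in> parcs (circulant n s)}. ((v - u) mod int n + u) mod int n = v"
      using inv(1) by blast
    show "\<forall>d\<in>{0..<int s}. ((d + u) mod int n - u) mod int n = d" using inv(2) sub by blast
    show "(\<lambda>v. (v - u) mod int n) ` {v \<in> {0..<int n}. (u, v) \<in> parcs (circulant n s)} \<subseteq> {0..<int s}"
      using range(1) by fastforce
    show "(\<lambda>d. (d + u) mod int n) ` {0..<int s} \<subseteq> {v \<in> {0..<int n}. (u, v) \<in> parcs (circulant n s)}"
    proof (intro subsetI, elim imageE, simp only:)
      fix d assume d: "d \<in> {0..<int s}"
      then have "((d + u) mod int n - u) mod int n = d" using inv(2) sub by blast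
      then show "(d + u) mod int n \<in> {v \<in> {0..<int n}. (u, v) \<in> parcs (circulant n s)}"
        using d u range[of "d + u"] by simp
    qed
  qed
  then show "card {v \<in> {0..<int n}. (u, v) \<in> parcs (circulant n s)} = s"
    by (simp add: bij_betw_same_card)
  have "bij_betw (\<lambda>v. (u - v) mod int n) {v \<in> {0..<int n}. (v, u) \<in> parcs (circulant n s)} {0..<int s}"
  proof (rule bij_betw_byWitness[where f' = "\<lambda>d. (u - d) mod int n"])
    show "\<forall>v\<in>{v \<in> {0..<int n}. (v, u) \<in> parcs (circulant n s)}. (u - (u - v) mod int n) mod int n = v"
      using inv(3) by blast
    show "\<forall>d\<in>{0..<int s}. (u - (u - d) mod int n) mod int n = d" using inv(3) sub by blast
    show "(\<lambda>v. (u - v) mod int n) ` {v \<in> {0..<int n}. (v, u) \<in> parcs (circulant n s)} \<subseteq> {0..<int s}"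
      using range(1) by fastforce
    show "(\<lambda>d. (u - d) mod int n) ` {0..<int s} \<subseteq> {v \<in> {0..<int n}. (v, u) \<in> parcs (circulant n s)}"
    proof (intro subsetI, elim imageE, simp only:)
      fix d assume d: "d \<in> {0..<int s}"
      then have "(u - (u - d) mod int n) mod int n = d" using inv(3) sub by blast
      then show "(u - d) mod int n \<in> {v \<in> {0..<int n}. (v, u) \<in> parcs (circulant n s)}"
        using d u range[of "u - d"] by simp
    qed
  qed
  then show "card {v \<in> {0..<int n}. (v, u) \<in> parcs (circulant n s)} = s"
    by (simp add: bij_betw_same_card)
qed

text \<open>Nonzero opposite differences add up to n, so they cannot both be below s.\<close>

lemma circulant_antisymmetric:
  assumes "2 * s \<le> n" "0 < s" and u: "u \<in> {0..<int n}"
  shows "{v \<in> {0..<int n}. (u, v) \<in> parcs (circulant n s) \<and> (v, u) \<in> parcs (circulant n s)} = {u}"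
proof -
  have "v = u" if v: "v \<in> {0..<int n}" "(v - u) mod int n < int s" "(u - v) mod int n < int s" for v
  proof (rule ccontr)
    assume "v \<noteq> u"
    then have "(v - u) mod int n + (u - v) mod int n = int n"
    proof (cases "v < u")
      case True
      have "(v - u) mod int n = (v - u + int n) mod int n" by simp
      also have "\<dots> = v - u + int n" using True u v by (intro mod_pos_pos_trivial) auto
      finally have "(v - u) mod int n = v - u + int n" .
      moreover have "(u - v) mod int n = u - v" using True u v by (intro mod_pos_pos_trivial) auto
      ultimately show ?thesis by simp
    next
      case False
      have "(u - v) mod int n = (u - v + int n) mod int n" by simp
      also have "\<dots> = u - v + int n" using False \<open>v \<noteq> u\<close> u v by (intro mod_pos_pos_trivial) auto
      finally have "(u - v) mod int n = u - v + int n" .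
      moreover have "(v - u) mod int n = v - u" using False u v by (intro mod_pos_pos_trivial) auto
      ultimately show ?thesis by simp
    qed
    then show False using v assms(1) by linarith
  qed
  then show ?thesis using u assms(2) by auto
qed

context odd_nonsquare
begin

lemma three_le_card: "3 \<le> CARD('a)"
proof -
  have "CARD('a) \<ge> 2" using card_mono[of UNIV "{0, 1::'a}"] by simp
  moreover have "CARD('a) \<noteq> 2" using odd_card by auto
  ultimately show ?thesis by simp
qed

text \<open>As psi(0, 0) = \<infinity>, the element 0 generates only itself and \<infinity>, and 1
  is missed.\<close>

lemma generator_neq_0:
  assumes "i \<in> psi_generators \<epsilon>"
  shows "i \<noteq> 0"
proof
  assume "i = 0"
  have "x \<in> {None, Some 0}" if "x \<in> generate (psi_group \<epsilon>) {Some i}" for x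
    using that
  proof (induction rule: generate.induct)
    case (inv h)
    then show ?case using \<open>i = 0\<close> by (auto simp: inv_psi_group_Some)
  qed (auto simp: \<open>i = 0\<close> psi_group_def)
  moreover have "Some 1 \<in> generate (psi_group \<epsilon>) {Some i}"
    using assms by (simp add: psi_generators_def psi_group_def)
  ultimately show False by fastforce
qed

text \<open>Closed walks that leave \<open>u\<close> along a cone and return along its inverse count
  the degree.\<close>

lemma card_cone_rel: "card {v. cone_rel \<epsilon> i u v} = CARD('a)\<^sup>2" "card {v. cone_rel \<epsilon> i v u} = CARD('a)\<^sup>2"
proof -
  show *: "card {v. cone_rel \<epsilon> i u v} = CARD('a)\<^sup>2" for i
    using card_paths_inverse[of i u u] cone_rel_sym[of i u] base_norm_sym cone_rel_sym[of "- i" _ u]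
    by (cases u) (simp add: norm_form_def)
  show "card {v. cone_rel \<epsilon> i v u} = CARD('a)\<^sup>2" unfolding cone_rel_sym[of i _ u] by (rule *)
qed

lemma cone_rel_antisym:
  assumes "i \<noteq> 0"
  shows "{v. cone_rel \<epsilon> i u v \<and> cone_rel \<epsilon> i v u} = {u}"
proof -
  have "u = v" if "cone_rel \<epsilon> i u v" "cone_rel \<epsilon> i v u" for v
  proof -
    have h: "height u v = i * base_norm \<epsilon> u v" using that(1) by (simp add: cone_rel_def)
    have "height u v = (- i) * base_norm \<epsilon> u v"
      using that(2) unfolding cone_rel_sym[of i v u] by (simp add: cone_rel_def)
    then have "2 * (i * base_norm \<epsilon> u v) = 0" using h by simp
    then have "base_norm \<epsilon> u v = 0" using assms by simp
    then show ?thesis using base_norm_eq_0 h by simp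
  qed
  then show ?thesis by auto
qed

text \<open>The circulant has the same out-, in- and mutual degrees, but at least q^2 walks of
  length two from 0 to q^2 - 1, whereas the cone digraph allows at most q + 1 between any two
  vertices.\<close>

lemma not_wl_identifies_1:
  assumes "i \<noteq> 0"
  shows "\<not> wl_identifies 1 (cone_digraph \<epsilon> i)"
proof (rule not_wl_identifiesI[of _ "circulant (CARD('a) ^ 3) (CARD('a)\<^sup>2)"])
  let ?q = "CARD('a)" and ?D = "cone_digraph \<epsilon> i"
  let ?E = "circulant (?q ^ 3) (?q\<^sup>2)"
  have q: "3 \<le> ?q" by (rule three_le_card)
  have s: "2 * ?q\<^sup>2 \<le> ?q ^ 3"
    using mult_right_mono[of 2 ?q "?q\<^sup>2"] q by (simp add: power3_eq_cube power2_eq_square)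
  then have s': "?q\<^sup>2 \<le> ?q ^ 3" by simp
  have s0: "0 < ?q\<^sup>2" by simp
  show "pair_wf_digraph ?D"
    using pair_fin_digraph_cone_digraph by (auto simp: pair_fin_digraph_def)
  show "pair_wf_digraph ?E" by (rule pair_wf_digraph_circulant)
  show "finite (pverts ?E)" by simp
  show "\<not> arc_isomorphism f ?D ?E" for f
  proof
    assume f: "arc_isomorphism f ?D ?E"
    then have bij: "bij_betw f UNIV {0..<int (?q ^ 3)}"
      and arc: "\<And>u v. cone_rel \<epsilon> i u v \<longleftrightarrow> (f u, f v) \<in> parcs ?E"
      unfolding arc_isomorphism_def by auto
    have qi: "int (?q\<^sup>2) \<le> int (?q ^ 3)" "0 < int (?q\<^sup>2)" using s' s0 by (simp_all only: zle_int of_nat_0_less_iff)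
    then have "0 \<in> range f" "int (?q\<^sup>2) - 1 \<in> range f"
      using bij unfolding bij_betw_def by auto
    then obtain g h where gh: "f g = 0" "f h = int (?q\<^sup>2) - 1" by (metis imageE)
    have path: "{0..<int (?q\<^sup>2)} \<subseteq> f ` {v. cone_rel \<epsilon> i g v \<and> cone_rel \<epsilon> i v h}"
    proof
      fix z assume z: "z \<in> {0..<int (?q\<^sup>2)}"
      then have "z \<in> range f" using bij qi unfolding bij_betw_def by auto
      then obtain v where v: "z = f v" by blast
      have "cone_rel \<epsilon> i g v" "cone_rel \<epsilon> i v h"
        unfolding arc using z qi gh unfolding v by (auto simp: mod_pos_pos_trivial)
      then show "z \<in> f ` {v. cone_rel \<epsilon> i g v \<and> cone_rel \<epsilon> i v h}" using v by blast
    qed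
    have "?q\<^sup>2 = card {0..<int (?q\<^sup>2)}"
      by (simp only: card_atLeastLessThan_int diff_zero nat_int)
    also have "\<dots> \<le> card (f ` {v. cone_rel \<epsilon> i g v \<and> cone_rel \<epsilon> i v h})"
      by (rule card_mono[OF _ path]) simp
    also have "\<dots> \<le> card {v. cone_rel \<epsilon> i g v \<and> cone_rel \<epsilon> i v h}" by (rule card_image_le) simp
    also have "\<dots> \<le> ?q + 1" using card_paths[of i i g h] assms by auto
    finally have "?q * ?q \<le> ?q + 1" by (simp add: power2_eq_square)
    moreover have "3 * ?q \<le> ?q * ?q" using q by simp
    ultimately show False using q by simp
  qed
  have cardE: "card (UNIV :: ('a \<times> 'a \<times> 'a) set) = card {0..<int (?q ^ 3)}"
    by (simp only: card_atLeastLessThan_int diff_zero nat_int) (simp add: power3_eq_cube)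
  let ?M = "image_mset (\<lambda>v. ((0, v) \<in> parcs ?E, (v, 0) \<in> parcs ?E)) (mset_set {0..<int (?q ^ 3)})"
  have 0: "0 \<in> {0..<int (?q ^ 3)}" by simp
  show "\<not> wl_distinguishes 1 ?D ?E"
  proof (rule regular_not_wl1_distinguishes[where M = ?M])
    show "finite (pverts ?D)" "finite (pverts ?E)" "card (pverts ?D) = card (pverts ?E)"
      using cardE by simp_all
    show "(u, u) \<in> parcs ?D" for u by simp
    show "(u, u) \<in> parcs ?E" if "u \<in> pverts ?E" for u using that by simp
    show "image_mset (\<lambda>v. ((u, v) \<in> parcs ?D, (v, u) \<in> parcs ?D)) (mset_set (pverts ?D)) = ?M" for u
    proof (rule bool_pair_image_mset_eqI)
      show "card {a \<in> pverts ?D. (u, a) \<in> parcs ?D} = card {b \<in> {0..<int (?q ^ 3)}. (0, b) \<in> parcs ?E}"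
        "card {a \<in> pverts ?D. (a, u) \<in> parcs ?D} = card {b \<in> {0..<int (?q ^ 3)}. (b, 0) \<in> parcs ?E}"
        unfolding card_circulant_neighbours[OF s' 0] using card_cone_rel[of i u] by simp_all
      show "card {a \<in> pverts ?D. (u, a) \<in> parcs ?D \<and> (a, u) \<in> parcs ?D} =
          card {b \<in> {0..<int (?q ^ 3)}. (0, b) \<in> parcs ?E \<and> (b, 0) \<in> parcs ?E}"
        unfolding circulant_antisymmetric[OF s s0 0] using cone_rel_antisym[OF assms, of u] by simp
    qed (use cardE in simp_all)
    show "image_mset (\<lambda>v. ((u, v) \<in> parcs ?E, (v, u) \<in> parcs ?E)) (mset_set (pverts ?E)) = ?M"
      if "u \<in> pverts ?E" for u
    proof (rule bool_pair_image_mset_eqI)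
      have u: "u \<in> {0..<int (?q ^ 3)}" using that by simp
      show "card {a \<in> pverts ?E. (u, a) \<in> parcs ?E} = card {b \<in> {0..<int (?q ^ 3)}. (0, b) \<in> parcs ?E}"
        "card {a \<in> pverts ?E. (a, u) \<in> parcs ?E} = card {b \<in> {0..<int (?q ^ 3)}. (b, 0) \<in> parcs ?E}"
        unfolding card_circulant_neighbours[OF s' 0] circulant_simps(1) card_circulant_neighbours[OF s' u]
        by simp_all
      show "card {a \<in> pverts ?E. (u, a) \<in> parcs ?E \<and> (a, u) \<in> parcs ?E} =
          card {b \<in> {0..<int (?q ^ 3)}. (0, b) \<in> parcs ?E \<and> (b, 0) \<in> parcs ?E}"
        unfolding circulant_antisymmetric[OF s s0 0] circulant_simps(1) circulant_antisymmetric[OF s s0 u]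
        by simp
    qed simp_all
  qed
qed

end

section \<open>Failure of the two-dimensional algorithm\<close>

text \<open>The basis relations of a coherent configuration of rank q + 2. Unlike the relations
  \<open>cone_rel\<close>, they are disjoint, the diagonal being split off.\<close>

datatype 'a rel_type = Same | Fibre | Cone 'a

fun rel_inverse :: "'a::uminus rel_type \<Rightarrow> 'a rel_type" where
  "rel_inverse (Cone a) = Cone (- a)"
| "rel_inverse r = r"

context odd_nonsquare
begin

definition rel :: "'a \<times> 'a \<times> 'a \<Rightarrow> 'a \<times> 'a \<times> 'a \<Rightarrow> 'a rel_type" where
  "rel g h = (if g = h then Same else if base_norm \<epsilon> g h = 0 then Fibre
     else Cone (height g h / base_norm \<epsilon> g h))"

text \<open>The intersection numbers. The subtracted \<open>of_bool\<close> terms remove the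
  endpoints from the counts for \<open>cone_rel\<close>, which contains the diagonal; at d = psi(a,
  b) nothing is removed because this d differs from a and b.\<close>

fun paths :: "'a rel_type \<Rightarrow> 'a rel_type \<Rightarrow> 'a rel_type \<Rightarrow> nat" where
  "paths Same t r = (if t = r then 1 else 0)"
| "paths s Same r = (if s = r then 1 else 0)"
| "paths Fibre Fibre r = (case r of Same \<Rightarrow> CARD('a) - 1 | Fibre \<Rightarrow> CARD('a) - 2 | Cone _ \<Rightarrow> 0)"
| "paths Fibre (Cone b) r = (case r of Cone d \<Rightarrow> if d = b then 0 else 1 | _ \<Rightarrow> 0)"
| "paths (Cone a) Fibre r = (case r of Cone d \<Rightarrow> if d = a then 0 else 1 | _ \<Rightarrow> 0)"
| "paths (Cone a) (Cone b) r = (if a + b = 0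
     then (case r of Same \<Rightarrow> CARD('a)\<^sup>2 - 1 | Fibre \<Rightarrow> 0 | Cone d \<Rightarrow> CARD('a) - of_bool (d = a) - of_bool (d = b))
     else (case r of Same \<Rightarrow> 0 | Fibre \<Rightarrow> CARD('a) + 1 |
       Cone d \<Rightarrow> if d = (a * b + \<delta>) / (a + b) then 1 else CARD('a) + 1 - of_bool (d = a) - of_bool (d = b)))"

lemma base_norm_refl [simp]: "base_norm \<epsilon> g g = 0"
  by (cases g) (simp add: norm_form_def)

lemma rel_eq_Same_iff [simp]: "rel g h = Same \<longleftrightarrow> g = h"
  by (simp add: rel_def)

lemma rel_refl [simp]: "rel g g = Same"
  by simp

lemma rel_eq_Fibre_iff: "rel g h = Fibre \<longleftrightarrow> g \<noteq> h \<and> base_norm \<epsilon> g h = 0"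
  by (simp add: rel_def)

lemma rel_eq_Cone_iff: "rel g h = Cone a \<longleftrightarrow> g \<noteq> h \<and> cone_rel \<epsilon> a g h"
  using base_norm_eq_0[of g h] unfolding rel_def cone_rel_def by (auto simp: field_simps)

lemma cone_rel_iff_rel: "cone_rel \<epsilon> a g h \<longleftrightarrow> rel g h = Same \<or> rel g h = Cone a"
  by (auto simp: rel_eq_Cone_iff)

lemma rel_sym: "rel h g = rel_inverse (rel g h)"
  unfolding rel_def using base_norm_sym[of h g] height_sym[of h g] by auto

lemma fibre_coordinates: "base_norm \<epsilon> (x, y, t) v = 0 \<longleftrightarrow> (\<exists>t'. v = (x, y, t'))"
  by (cases v) auto

text \<open>Exactly one point of the fibre of \<open>g\<close> is joined to \<open>h\<close> by
  \<open>cone_rel\<close> for \<open>b\<close>; it does not count when it is \<open>g\<close> or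
  \<open>h\<close> itself.\<close>

lemma card_fibre_cone:
  "card {v. rel g v = Fibre \<and> rel v h = Cone b} = paths Fibre (Cone b) (rel g h)"
proof -
  obtain x y t where g: "g = (x, y, t)" by (metis prod.exhaust)
  obtain x' y' t' where h: "h = (x', y', t')" by (metis prod.exhaust)
  define d where "d = height g h - b * base_norm \<epsilon> g h"
  have cone: "cone_rel \<epsilon> b (x, y, s) h \<longleftrightarrow> s = t + d" for s
    unfolding d_def g h cone_rel_def by (auto simp: algebra_simps)
  have "{v. rel g v = Fibre \<and> rel v h = Cone b} =
      {v. \<exists>s. v = (x, y, s) \<and> s \<noteq> t \<and> v \<noteq> h \<and> s = t + d}"
    unfolding rel_eq_Fibre_iff rel_eq_Cone_iff using cone
    by (auto simp: g fibre_coordinates)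
  also have "\<dots> = (if d = 0 \<or> h = (x, y, t + d) then {} else {(x, y, t + d)})" by auto
  finally have eq: "{v. rel g v = Fibre \<and> rel v h = Cone b} =
      (if d = 0 \<or> h = (x, y, t + d) then {} else {(x, y, t + d)})" .
  have d: "d = 0 \<longleftrightarrow> rel g h = Same \<or> rel g h = Cone b"
    unfolding cone_rel_iff_rel[symmetric] cone_rel_def d_def by simp
  have h': "h = (x, y, t + d) \<longleftrightarrow> rel g h = Same \<or> rel g h = Fibre"
  proof
    assume "h = (x, y, t + d)"
    then have "base_norm \<epsilon> g h = 0" unfolding g fibre_coordinates by blast
    then show "rel g h = Same \<or> rel g h = Fibre" by (auto simp: rel_eq_Fibre_iff)
  next
    assume "rel g h = Same \<or> rel g h = Fibre"
    then have "base_norm \<epsilon> g h = 0" by (auto simp: rel_eq_Fibre_iff)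
    then obtain s where s: "h = (x, y, s)" unfolding g fibre_coordinates by blast
    then have "cone_rel \<epsilon> b (x, y, s) h" by simp
    then show "h = (x, y, t + d)" using cone s by blast
  qed
  show ?thesis unfolding eq d h' by (cases "rel g h") auto
qed

text \<open>This makes the classes a coherent configuration. Walks that end with a fibre step are
  reversed; walks through two cones come from the counts for \<open>cone_rel\<close> by deleting
  endpoints.\<close>

lemma card_rel_paths: "card {v. rel g v = s \<and> rel v h = t} = paths s t (rel g h)"
proof -
  consider "s = Same" | "t = Same" | "s = Fibre" "t = Fibre" | b where "s = Fibre" "t = Cone b"
    | a where "s = Cone a" "t = Fibre" | a b where "s = Cone a" "t = Cone b"
    by (cases s; cases t) auto
  then show ?thesis
  proof cases
    case 1
    have "{v. rel g v = s \<and> rel v h = t} = (if t = rel g h then {g} else {})" using 1 by auto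
    then show ?thesis using 1 by simp
  next
    case 2
    have "{v. rel g v = s \<and> rel v h = t} = (if s = rel g h then {h} else {})" using 2 by auto
    then show ?thesis using 2 by (cases s) auto
  next
    case 3
    obtain x y t0 where g: "g = (x, y, t0)" by (metis prod.exhaust)
    obtain x' y' t1 where h: "h = (x', y', t1)" by (metis prod.exhaust)
    show ?thesis
    proof (cases "base_norm \<epsilon> g h = 0")
      case True
      then have xy: "x' = x" "y' = y" unfolding g h by auto
      have "{v. rel g v = s \<and> rel v h = t} = (\<lambda>u. (x, y, u)) ` (UNIV - {t0, t1})"
        unfolding 3 rel_eq_Fibre_iff using fibre_coordinates base_norm_sym
        by (auto simp: g h xy fibre_coordinates)
      then have "card {v. rel g v = s \<and> rel v h = t} = CARD('a) - card {t0, t1}"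
        by (simp add: card_image inj_on_def card_Diff_subset)
      then show ?thesis using True 3 unfolding rel_def by (auto simp: g h xy)
    next
      case False
      have "{v. rel g v = s \<and> rel v h = t} = {}"
        unfolding 3 rel_eq_Fibre_iff using False by (auto simp: g fibre_coordinates)
      then show ?thesis using False 3 unfolding rel_def by auto
    qed
  next
    case 4
    then show ?thesis using card_fibre_cone by simp
  next
    case (5 a)
    have "{v. rel g v = s \<and> rel v h = t} = {v. rel h v = Fibre \<and> rel v g = Cone (- a)}"
    proof -
      have "rel_inverse r = Fibre \<longleftrightarrow> r = Fibre" "rel_inverse r = Cone (- a) \<longleftrightarrow> r = Cone a" for r
        by (cases r; simp)+
      then have "rel g v = Cone a \<longleftrightarrow> rel v g = Cone (- a)" "rel v h = Fibre \<longleftrightarrow> rel h v = Fibre" for v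
        using rel_sym[where g = g and h = v] rel_sym[where g = v and h = h] by metis+
      then show ?thesis unfolding 5 by blast
    qed
    then show ?thesis
      unfolding 5 using card_fibre_cone[of h g "- a"] rel_sym[of h g]
      by (cases "rel g h") auto
  next
    case (6 a b)
    have split: "{v. cone_rel \<epsilon> a g v \<and> cone_rel \<epsilon> b v h} = {v. rel g v = s \<and> rel v h = t} \<union>
        ((if rel g h = Same \<or> rel g h = Cone b then {g} else {}) \<union>
         (if rel g h = Same \<or> rel g h = Cone a then {h} else {}))"
      unfolding cone_rel_iff_rel 6 by auto
    have "card {v. cone_rel \<epsilon> a g v \<and> cone_rel \<epsilon> b v h} = card {v. rel g v = s \<and> rel v h = t} +
        card ((if rel g h = Same \<or> rel g h = Cone b then {g} else {}) \<union>
         (if rel g h = Same \<or> rel g h = Cone a then {h} else {}))"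
      unfolding split by (rule card_Un_disjoint) (auto simp: 6)
    moreover have "card ((if rel g h = Same \<or> rel g h = Cone b then {g} else {}) \<union>
         (if rel g h = Same \<or> rel g h = Cone a then {h} else {})) =
        (if rel g h = Same then 1 else of_bool (rel g h = Cone a) + of_bool (rel g h = Cone b))"
    proof (cases "g = h")
      case False
      then have "rel g h \<noteq> Same" by simp
      then show ?thesis using False by (auto simp: card_insert_if)
    qed simp
    ultimately have card: "card {v. rel g v = s \<and> rel v h = t} =
        card {v. cone_rel \<epsilon> a g v \<and> cone_rel \<epsilon> b v h} -
        (if rel g h = Same then 1 else of_bool (rel g h = Cone a) + of_bool (rel g h = Cone b))"
      by linarith
    show ?thesis
    proof (cases "a + b = 0")
      case True
      then have b: "b = - a" by (simp add: add_eq_0_iff)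
      have "base_norm \<epsilon> g h = 0 \<longleftrightarrow> rel g h = Same \<or> rel g h = Fibre" by (auto simp: rel_def)
      then show ?thesis
        unfolding card b card_paths_inverse using 6 b by (cases "rel g h") auto
    next
      case False
      define k where "k = (a * b + \<delta>) / (a + b)"
      \<comment> \<open>psi(a, b) = a would mean a^2 = \<delta>, and likewise for b.\<close>
      have "(a * b + d) / (a + b) \<noteq> c" if "c = a \<or> c = b" "c\<^sup>2 \<noteq> d" for c d
        using False that by (auto simp: divide_eq_eq power2_eq_square algebra_simps)
      then have "k \<noteq> a" "k \<noteq> b"
        using square_neq_delta[of a] square_neq_delta[of b] unfolding k_def by blast+
      then show ?thesis
        unfolding card card_paths[OF False] k_def[symmetric] cone_rel_iff_rel[where a = k]
        using 6 False by (cases "rel g h") (auto simp: k_def[symmetric])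
    qed
  qed
qed

text \<open>\<sigma> permutes the cones and preserves \<open>paths\<close>. So \<open>rel\<close>
  relabelled by \<sigma> on one side and plain \<open>rel\<close> on the other meet the coherence
  conditions, and the arcs of the two digraphs correspond.\<close>

lemma psi_automorphism_not_wl2_distinguishes:
  assumes bij: "bij \<sigma>"
    and hom: "\<And>a b. psi \<epsilon> (Some (\<sigma> a)) (Some (\<sigma> b)) = map_option \<sigma> (psi \<epsilon> (Some a) (Some b))"
  shows "\<not> wl_distinguishes 2 (cone_digraph \<epsilon> i) (cone_digraph \<epsilon> (\<sigma> i))"
proof -
  have inj: "\<sigma> a = \<sigma> b \<longleftrightarrow> a = b" for a b using bij by (metis bij_is_inj inj_eq)
  let ?r = "map_rel_type \<sigma>"
  have injr: "?r s = ?r t \<longleftrightarrow> s = t" for s t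
    by (cases s; cases t) (auto simp: inj)
  have surjr: "\<exists>s. t = ?r s" for t
  proof (cases t)
    case (Cone a)
    obtain b where "a = \<sigma> b" using bij_is_surj[OF bij] by (rule surjE)
    then show ?thesis using Cone by (intro exI[of _ "Cone b"]) simp
  next
    case Same
    then show ?thesis by (intro exI[of _ Same]) simp
  next
    case Fibre
    then show ?thesis by (intro exI[of _ Fibre]) simp
  qed
  have sum0: "\<sigma> a + \<sigma> b = 0 \<longleftrightarrow> a + b = 0" for a b
    using hom[of a b] by (auto split: if_splits)
  have psi: "\<sigma> d = (\<sigma> a * \<sigma> b + \<delta>) / (\<sigma> a + \<sigma> b) \<longleftrightarrow> d = (a * b + \<delta>) / (a + b)" if "a + b \<noteq> 0" for a b d
  proof -
    have "(\<sigma> a * \<sigma> b + \<delta>) / (\<sigma> a + \<sigma> b) = \<sigma> ((a * b + \<delta>) / (a + b))"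
      using hom[of a b] that sum0[of a b] by simp
    then show ?thesis using inj by simp
  qed
  have neg: "\<sigma> (- a) = - \<sigma> a" for a using sum0[of "- a" a] by (simp add: eq_neg_iff_add_eq_0)
  have inv: "rel_inverse (?r r) = ?r (rel_inverse r)" for r by (cases r) (auto simp: neg)
  have paths: "paths (?r s) (?r t) (?r r) = paths s t r" for s t r
    by (cases s; cases t; cases r) (auto simp: inj sum0 psi)
  have step: "image_mset (\<lambda>z. (?r (rel x z), ?r (rel z y))) (mset_set UNIV) =
      image_mset (\<lambda>z. (rel x' z, rel z y')) (mset_set UNIV)" if eq: "?r (rel x y) = rel x' y'" for x y x' y'
  proof (rule multiset_eqI)
    fix p
    obtain s t where p: "p = (?r s, ?r t)" using surjr by (metis prod.exhaust)
    have "{z. (?r (rel x z), ?r (rel z y)) = p} = {z. rel x z = s \<and> rel z y = t}"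
      by (auto simp: p injr)
    moreover have "{z. (rel x' z, rel z y') = p} = {z. rel x' z = ?r s \<and> rel z y' = ?r t}"
      by (auto simp: p)
    moreover have "card {z. rel x z = s \<and> rel z y = t} = card {z. rel x' z = ?r s \<and> rel z y' = ?r t}"
      unfolding card_rel_paths eq[symmetric] paths ..
    ultimately show "count (image_mset (\<lambda>z. (?r (rel x z), ?r (rel z y))) (mset_set UNIV)) p =
        count (image_mset (\<lambda>z. (rel x' z, rel z y')) (mset_set UNIV)) p"
      by (simp add: count_image_mset' eq_commute flip: sum.inter_filter)
  qed
  have total: "image_mset (\<lambda>(x, y). ?r (rel x y)) (mset_set (UNIV \<times> UNIV)) =
      image_mset (\<lambda>(x, y). rel x y) (mset_set (UNIV \<times> UNIV))"
  proof (rule multiset_eqI)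
    fix p
    obtain s where p: "p = ?r s" using surjr by metis
    \<comment> \<open>Closed walks along \<open>r\<close> and back count the neighbours of
      \<open>x\<close> in the class \<open>r\<close>.\<close>
    have one: "card {y. rel x y = r} = paths r (rel_inverse r) Same" for x r
    proof -
      have "rel y x = rel_inverse (rel x y)" for y by (rule rel_sym)
      then have "{y. rel x y = r \<and> rel y x = rel_inverse r} = {y. rel x y = r}" by auto
      then show ?thesis using card_rel_paths[of x r x "rel_inverse r"] by simp
    qed
    have "card {(x, y). rel x y = r} = card (SIGMA x:UNIV. {y. rel x y = r})" for r
      by (rule arg_cong[of _ _ card]) auto
    also have "\<dots> r = card (UNIV :: ('a \<times> 'a \<times> 'a) set) * paths r (rel_inverse r) Same" for r
      by (subst card_SigmaI) (auto simp: one)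
    finally have all: "card {(x, y). rel x y = r} = card (UNIV :: ('a \<times> 'a \<times> 'a) set) * paths r (rel_inverse r) Same" for r .
    have "card {z. (\<lambda>(x, y). ?r (rel x y)) z = p} = card {(x, y). rel x y = s}"
      by (rule arg_cong[of _ _ card]) (auto simp: p injr)
    also have "\<dots> = card {(x, y). rel x y = p}"
      unfolding all p using paths[of s "rel_inverse s" Same] inv[of s] by simp
    finally show "count (image_mset (\<lambda>(x, y). ?r (rel x y)) (mset_set (UNIV \<times> UNIV))) p =
        count (image_mset (\<lambda>(x, y). rel x y) (mset_set (UNIV \<times> UNIV))) p"
      by (simp add: count_image_mset' eq_commute case_prod_unfold flip: sum.inter_filter)
  qed
  show ?thesis
  proof (rule coherent_not_wl2_distinguishes[where \<rho> = "\<lambda>x y. ?r (rel x y)" and \<rho>' = rel])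
    fix x y x' y'
    assume eq: "?r (rel x y) = rel x' y'"
    show "image_mset (\<lambda>z. (?r (rel x z), ?r (rel z y))) (mset_set (pverts (cone_digraph \<epsilon> i))) =
          image_mset (\<lambda>z. (rel x' z, rel z y')) (mset_set (pverts (cone_digraph \<epsilon> (\<sigma> i))))"
      using step[OF eq] by simp
    have eq': "?r (rel y x) = rel y' x'"
      unfolding rel_sym[of y x] rel_sym[of y' x'] eq[symmetric] inv ..
    have same: "?r r = Same \<longleftrightarrow> r = Same" and cone: "?r r = Cone (\<sigma> i) \<longleftrightarrow> r = Cone i" for r
      by (cases r; simp add: inj)+
    have "cone_rel \<epsilon> i x y \<longleftrightarrow> cone_rel \<epsilon> (\<sigma> i) x' y'"
      unfolding cone_rel_iff_rel eq[symmetric] same cone ..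
    moreover have "cone_rel \<epsilon> i y x \<longleftrightarrow> cone_rel \<epsilon> (\<sigma> i) y' x'"
      unfolding cone_rel_iff_rel eq'[symmetric] same cone ..
    moreover have "x = y \<longleftrightarrow> x' = y'" "y = x \<longleftrightarrow> y' = x'"
      using same[of "rel x y"] same[of "rel y x"] unfolding eq eq' by simp_all
    ultimately show "tuple_type (cone_digraph \<epsilon> i) [x, y] = tuple_type (cone_digraph \<epsilon> (\<sigma> i)) [x', y']"
      by (simp add: tuple_type_def upt_rec)
  qed (use total in simp_all)
qed

section \<open>The group on the projective line and its power maps\<close>

lemma psi_assoc: "psi \<epsilon> (psi \<epsilon> x y) z = psi \<epsilon> x (psi \<epsilon> y z)"
proof -
  define d where "d = \<delta>"
  have psi: "psi \<epsilon> (Some a) (Some b) = (if a + b = 0 then None else Some ((a * b + d) / (a + b)))" for a b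
    by (simp add: d_def)
  \<comment> \<open>Both sides are \<open>Some c\<close>; as \<delta> is a nonsquare, the
    denominator d - b^2 on the right does not vanish.\<close>
  have zero_sum: "psi \<epsilon> (psi \<epsilon> (Some a) (Some b)) (Some c) = psi \<epsilon> (Some a) (psi \<epsilon> (Some b) (Some c))"
    if ab: "a + b = 0" for a b c
  proof (cases "b + c = 0")
    case True
    then have "a = c" using ab by (metis add.commute add_left_cancel)
    then show ?thesis using ab True by simp
  next
    case False
    have a: "a = - b" using ab by (simp add: eq_neg_iff_add_eq_0)
    have "d - b * b \<noteq> 0" using square_neq_delta[of b] by (simp add: d_def power2_eq_square)
    moreover have "a + (b * c + d) / (b + c) = (d - b * b) / (b + c)"
      "a * ((b * c + d) / (b + c)) + d = c * ((d - b * b) / (b + c))"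
      using False unfolding a by (simp_all add: field_simps)
    ultimately show ?thesis using ab False by (simp add: psi del: psi.simps(1))
  qed
  show ?thesis
  proof (cases x)
    case x: (Some a)
    show ?thesis
    proof (cases y)
      case y: (Some b)
      show ?thesis
      proof (cases z)
        case z: (Some c)
        consider "a + b = 0" | "b + c = 0" | "a + b \<noteq> 0" "b + c \<noteq> 0" by blast
        then show ?thesis
        proof cases
          case 1
          then show ?thesis unfolding x y z by (rule zero_sum)
        next
          case 2
          then have "c + b = 0" by (simp add: add.commute)
          have "psi \<epsilon> (psi \<epsilon> x y) z = psi \<epsilon> z (psi \<epsilon> y x)"
            unfolding psi_commute[of _ z] psi_commute[of x y] ..
          also have "\<dots> = psi \<epsilon> (psi \<epsilon> z y) x" unfolding x y z using zero_sum[OF \<open>c + b = 0\<close>] ..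
          also have "\<dots> = psi \<epsilon> x (psi \<epsilon> y z)"
            unfolding psi_commute[of _ x] psi_commute[of z y] ..
          finally show ?thesis .
        next
          case 3
          \<comment> \<open>\<open>S\<close> and \<open>N\<close> are symmetric in a, b, c, and both
            bracketings equal N / S, or \<infinity> when S = 0.\<close>
          define S where "S = a * b + a * c + b * c + d"
          define N where "N = a * b * c + d * (a + b + c)"
          have "(a * b + d) / (a + b) + c = S / (a + b)" "(a * b + d) / (a + b) * c + d = N / (a + b)"
            "a + (b * c + d) / (b + c) = S / (b + c)" "a * ((b * c + d) / (b + c)) + d = N / (b + c)"
            using 3 unfolding S_def N_def by (simp_all add: field_simps)
          then show ?thesis using 3 unfolding x y z by (simp add: psi del: psi.simps(1))
        qed
      next
        case z: None
        have "psi \<epsilon> w None = w" for w by (cases w) simp_all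
        then show ?thesis unfolding z by simp
      qed
    qed (cases z; simp add: x)
  qed (cases y; cases z; simp)
qed

lemma comm_group_psi_group: "comm_group (psi_group \<epsilon>)"
proof (rule comm_groupI)
  show "x \<otimes>\<^bsub>psi_group \<epsilon>\<^esub> y \<otimes>\<^bsub>psi_group \<epsilon>\<^esub> z = x \<otimes>\<^bsub>psi_group \<epsilon>\<^esub> (y \<otimes>\<^bsub>psi_group \<epsilon>\<^esub> z)" for x y z
    by (simp add: psi_group_def psi_assoc)
  show "x \<otimes>\<^bsub>psi_group \<epsilon>\<^esub> y = y \<otimes>\<^bsub>psi_group \<epsilon>\<^esub> x" for x y
    by (simp add: psi_group_def psi_commute)
  show "\<one>\<^bsub>psi_group \<epsilon>\<^esub> \<otimes>\<^bsub>psi_group \<epsilon>\<^esub> x = x" for x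
    by (cases x) (simp_all add: psi_group_def)
  show "\<exists>y\<in>carrier (psi_group \<epsilon>). y \<otimes>\<^bsub>psi_group \<epsilon>\<^esub> x = \<one>\<^bsub>psi_group \<epsilon>\<^esub>" for x
  proof (cases x)
    case (Some a)
    then show ?thesis by (intro bexI[of _ "Some (- a)"]) (simp_all add: psi_group_def)
  qed (auto simp: psi_group_def intro: exI[of _ None])
qed (simp_all add: psi_group_def)

sublocale G: comm_group "psi_group \<epsilon>"
  by (rule comm_group_psi_group)

lemma carrier_psi [simp]: "x \<in> carrier (psi_group \<epsilon>)"
  by (simp add: psi_group_def)

lemma one_psi: "\<one>\<^bsub>psi_group \<epsilon>\<^esub> = None" and mult_psi: "x \<otimes>\<^bsub>psi_group \<epsilon>\<^esub> y = psi \<epsilon> x y"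
  by (simp_all add: psi_group_def)

lemma order_psi_group: "order (psi_group \<epsilon>) = CARD('a) + 1"
  by (simp add: order_def psi_group_def card_UNIV_option)

lemma psi_pow_card: "x [^]\<^bsub>psi_group \<epsilon>\<^esub> (CARD('a) + 1) = None"
  using G.pow_order_eq_1[of x] by (simp only: order_psi_group one_psi carrier_psi)

text \<open>An exponent coprime to the group order is invertible modulo it, so the power map is a
  bijective homomorphism. It fixes \<infinity> and hence restricts to the field.\<close>

lemma power_automorphism:
  assumes k: "coprime k (CARD('a) + 1)"
  obtains \<sigma> :: "'a \<Rightarrow> 'a" where "bij \<sigma>"
    "\<And>a b. psi \<epsilon> (Some (\<sigma> a)) (Some (\<sigma> b)) = map_option \<sigma> (psi \<epsilon> (Some a) (Some b))"
    "\<And>a. Some a [^]\<^bsub>psi_group \<epsilon>\<^esub> k = Some (\<sigma> a)"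
proof -
  let ?f = "\<lambda>x. x [^]\<^bsub>psi_group \<epsilon>\<^esub> k"
  obtain k' where "[k * k' = 1] (mod (CARD('a) + 1))"
    using cong_solve_coprime_nat[OF k] by auto
  then have "k * k' mod (CARD('a) + 1) = 1" by (simp add: cong_def)
  then obtain d where kk: "k * k' = (CARD('a) + 1) * d + 1"
    by (metis mult_div_mod_eq)
  have inv: "?f x [^]\<^bsub>psi_group \<epsilon>\<^esub> k' = x" for x
  proof -
    have "?f x [^]\<^bsub>psi_group \<epsilon>\<^esub> k' = x [^]\<^bsub>psi_group \<epsilon>\<^esub> ((CARD('a) + 1) * d) \<otimes>\<^bsub>psi_group \<epsilon>\<^esub> x [^]\<^bsub>psi_group \<epsilon>\<^esub> (1::nat)"
      unfolding G.nat_pow_pow[OF carrier_psi] kk G.nat_pow_mult[OF carrier_psi] ..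
    also have "\<dots> = \<one>\<^bsub>psi_group \<epsilon>\<^esub> [^]\<^bsub>psi_group \<epsilon>\<^esub> d \<otimes>\<^bsub>psi_group \<epsilon>\<^esub> x [^]\<^bsub>psi_group \<epsilon>\<^esub> (1::nat)"
      unfolding G.nat_pow_pow[OF carrier_psi, symmetric] psi_pow_card one_psi ..
    also have "\<dots> = x" by (simp del: One_nat_def add: G.nat_pow_eone)
    finally show ?thesis .
  qed
  have inj: "x = y" if "?f x = ?f y" for x y using inv that by metis
  have f0: "?f None = None" by (simp only: one_psi[symmetric] G.nat_pow_one)
  then have "?f (Some a) \<noteq> None" for a using inj[of "Some a" None] by auto
  then have "\<forall>a. \<exists>b. ?f (Some a) = Some b" by auto
  then obtain \<sigma> where \<sigma>: "\<And>a. ?f (Some a) = Some (\<sigma> a)" by metis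
  have "inj \<sigma>"
  proof (rule injI)
    fix a b assume "\<sigma> a = \<sigma> b"
    then have "?f (Some a) = ?f (Some b)" unfolding \<sigma> by simp
    then show "a = b" using inj by blast
  qed
  then have "bij \<sigma>" by (simp add: bij_def finite_UNIV_inj_surj)
  moreover have "psi \<epsilon> (Some (\<sigma> a)) (Some (\<sigma> b)) = map_option \<sigma> (psi \<epsilon> (Some a) (Some b))" for a b
  proof -
    have "psi \<epsilon> (Some (\<sigma> a)) (Some (\<sigma> b)) = ?f (psi \<epsilon> (Some a) (Some b))"
      using G.pow_mult_distrib[of "Some a" "Some b" k] G.m_comm[of "Some a" "Some b"]
      by (simp add: mult_psi \<sigma>)
    then show ?thesis by (cases "psi \<epsilon> (Some a) (Some b)") (simp_all only: f0 \<sigma> option.map)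
  qed
  ultimately show ?thesis using that \<sigma> by blast
qed

text \<open>The half power squares to the identity, and psi(a, a) = \<infinity> only for a =
  0.\<close>

lemma half_power: "x [^]\<^bsub>psi_group \<epsilon>\<^esub> ((CARD('a) + 1) div 2) \<in> {None, Some 0}"
proof -
  let ?y = "x [^]\<^bsub>psi_group \<epsilon>\<^esub> ((CARD('a) + 1) div 2)"
  have "(CARD('a) + 1) div 2 + (CARD('a) + 1) div 2 = CARD('a) + 1" using odd_card by presburger
  then have "psi \<epsilon> ?y ?y = None"
    using G.nat_pow_mult[of x "(CARD('a) + 1) div 2" "(CARD('a) + 1) div 2"] psi_pow_card[of x]
    by (simp only: mult_psi carrier_psi)
  then show ?thesis
    by (cases ?y) (auto split: if_splits simp flip: mult_2)
qed

text \<open>The kernel of the half power map without \<infinity>. Once a generator exists, this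
  kernel is the subgroup of squares, of index two.\<close>

definition even_elems :: "'a set" where
  "even_elems = {a. Some a [^]\<^bsub>psi_group \<epsilon>\<^esub> ((CARD('a) + 1) div 2) = None}"

lemma generator_not_even:
  assumes gen: "i \<in> psi_generators \<epsilon>"
  shows "i \<notin> even_elems"
proof
  assume "i \<in> even_elems"
  then have "Some i [^]\<^bsub>psi_group \<epsilon>\<^esub> ((CARD('a) + 1) div 2) = \<one>\<^bsub>psi_group \<epsilon>\<^esub>"
    by (simp add: even_elems_def one_psi)
  then have "G.ord (Some i) dvd (CARD('a) + 1) div 2" using G.pow_eq_id[of "Some i"] by simp
  moreover have "G.ord (Some i) = CARD('a) + 1"
    using G.generate_pow_card[of "Some i"] gen order_psi_group
    by (simp add: psi_generators_def order_def)
  ultimately have "CARD('a) + 1 \<le> (CARD('a) + 1) div 2" by (intro dvd_imp_le) auto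
  then show False by simp
qed

text \<open>Multiplication by a generator exchanges the kernel of the half power with its
  complement, so each has (q + 1) / 2 elements; then \<infinity> is dropped.\<close>

lemma card_even_elems:
  assumes gen: "i \<in> psi_generators \<epsilon>"
  shows "card even_elems = (CARD('a) - 1) div 2"
proof -
  let ?h = "\<lambda>x. x [^]\<^bsub>psi_group \<epsilon>\<^esub> ((CARD('a) + 1) div 2)"
  let ?E = "{x. ?h x = None}"
  have hi: "?h (Some i) = Some 0"
    using half_power[of "Some i"] generator_not_even[OF gen] by (auto simp: even_elems_def)
  have mult: "?h (psi \<epsilon> (Some i) x) = psi \<epsilon> (Some 0) (?h x)" for x
    using G.pow_mult_distrib[of "Some i" x "(CARD('a) + 1) div 2"] G.m_comm[of "Some i" x]
    by (simp only: mult_psi hi carrier_psi)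
  have "bij_betw (psi \<epsilon> (Some i)) ?E (- ?E)"
  proof (rule bij_betw_byWitness[where f' = "psi \<epsilon> (Some (- i))"])
    have cancel: "psi \<epsilon> (Some (- i)) (psi \<epsilon> (Some i) x) = x" "psi \<epsilon> (Some i) (psi \<epsilon> (Some (- i)) x) = x" for x
      by (simp_all add: psi_assoc[symmetric]) (cases x; simp)+
    show "\<forall>x\<in>?E. psi \<epsilon> (Some (- i)) (psi \<epsilon> (Some i) x) = x"
      "\<forall>x\<in>- ?E. psi \<epsilon> (Some i) (psi \<epsilon> (Some (- i)) x) = x" using cancel by blast+
    show "psi \<epsilon> (Some i) ` ?E \<subseteq> - ?E" using mult by auto
    show "psi \<epsilon> (Some (- i)) ` (- ?E) \<subseteq> ?E"
    proof (intro subsetI, elim imageE, simp only:)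
      fix x assume "x \<in> - ?E"
      then have x: "?h x = Some 0" using half_power[of x] by auto
      have "?h x = psi \<epsilon> (Some 0) (?h (psi \<epsilon> (Some (- i)) x))"
        using mult[of "psi \<epsilon> (Some (- i)) x"] cancel(2) by simp
      then have "?h (psi \<epsilon> (Some (- i)) x) \<noteq> Some 0" using x by auto
      then show "psi \<epsilon> (Some (- i)) x \<in> ?E" using half_power[of "psi \<epsilon> (Some (- i)) x"] by auto
    qed
  qed
  then have "card ?E = card (- ?E)" by (rule bij_betw_same_card)
  moreover have "card ?E + card (- ?E) = CARD('a) + 1"
    using card_Un_disjoint[of ?E "- ?E"] by (simp add: card_UNIV_option)
  ultimately have "card ?E = (CARD('a) + 1) div 2" by simp
  moreover have "?E = insert None (Some ` even_elems)"
  proof -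
    have "None \<in> ?E" by (simp only: one_psi[symmetric] G.nat_pow_one mem_Collect_eq)
    moreover have "Some a \<in> ?E \<longleftrightarrow> a \<in> even_elems" for a by (simp add: even_elems_def)
    moreover have "Some a \<in> insert None (Some ` even_elems) \<longleftrightarrow> a \<in> even_elems" for a by auto
    ultimately have mem: "x \<in> ?E \<longleftrightarrow> x \<in> insert None (Some ` even_elems)" for x
      by (cases x) (simp_all only: insertI1)
    show ?thesis by (rule Set.set_eqI, rule mem)
  qed
  ultimately have "Suc (card even_elems) = (CARD('a) + 1) div 2"
    by (simp add: card_image)
  then show ?thesis by simp
qed

text \<open>By \<open>cones_recognised\<close> the isomorphism carries every cone k to the cone
  \<sigma> k. It sends the fibre over (0, 0) into one fibre, with new last coordinates
  \<open>T t\<close>. The point (1, 0, s) has height s - t and norm 1 over (0, 0, t), which gives T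
  s - T t = \<sigma>(s - t) n with n constant and nonzero. The values s = a and t = -b then split
  \<sigma>(a + b).\<close>

lemma isomorphism_imp_additive:
  assumes gen: "i \<in> psi_generators \<epsilon>" and bij: "bij \<sigma>"
    and hom: "\<And>a b. psi \<epsilon> (Some (\<sigma> a)) (Some (\<sigma> b)) = map_option \<sigma> (psi \<epsilon> (Some a) (Some b))"
    and iso: "arc_isomorphism f (cone_digraph \<epsilon> i) (cone_digraph \<epsilon> (\<sigma> i))"
  shows "\<sigma> (a + b) = \<sigma> a + \<sigma> b"
proof -
  have bijf: "bij f" and arc: "\<And>u v. cone_rel \<epsilon> i u v \<longleftrightarrow> cone_rel \<epsilon> (\<sigma> i) (f u) (f v)"
    using iso unfolding arc_isomorphism_def by auto
  define Q where "Q m g h g' h' \<longleftrightarrow> g' = f g \<and> h' = f h" for m :: nat and g h g' h'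
  obtain m where m: "\<And>k g h g' h'. Q m g h g' h' \<Longrightarrow> cone_rel \<epsilon> k g h \<longleftrightarrow> cone_rel \<epsilon> (\<sigma> k) g' h'"
  proof (rule cones_recognised[OF gen hom, of Q])
    fix m :: nat and g h g' h' assume Q: "Q (Suc m) g h g' h'"
    show "\<exists>F. bij F \<and> (\<forall>v. Q m g v g' (F v) \<and> Q m v h (F v) h')"
      by (rule exI[of _ f]) (use bijf Q in \<open>simp add: Q_def\<close>)
    show "Q m g h g' h'" using Q by (simp add: Q_def)
  next
    fix m :: nat and g h g' h' assume Q: "Q m g h g' h'"
    show "Q m h g h' g'" using Q by (simp add: Q_def)
    show "cone_rel \<epsilon> i g h \<longleftrightarrow> cone_rel \<epsilon> (\<sigma> i) g' h'" using Q arc[of g h] by (simp add: Q_def)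
  qed blast
  have cones: "cone_rel \<epsilon> k g h \<longleftrightarrow> cone_rel \<epsilon> (\<sigma> k) (f g) (f h)" for k g h
    by (rule m) (simp add: Q_def)
  have sum0: "\<sigma> a + \<sigma> b = 0 \<longleftrightarrow> a + b = 0" for a b
    using hom[of a b] by (auto split: if_splits)
  have neg: "\<sigma> (- a) = - \<sigma> a" for a using sum0[of "- a" a] by (simp add: eq_neg_iff_add_eq_0)
  have zero: "\<sigma> 0 = 0" using sum0[of 0 0] by (simp flip: mult_2)
  have nz: "\<sigma> a = 0 \<longleftrightarrow> a = 0" for a using bij zero by (metis bij_is_inj injD)
  obtain x0 y0 t0 where f0: "f (0, 0, 0) = (x0, y0, t0)" by (metis prod.exhaust)
  have "\<exists>u. f (0, 0, t) = (x0, y0, u)" for t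
  proof (cases "t = 0")
    case False
    have "\<not> cone_rel \<epsilon> k (0, 0, 0) (0, 0, t)" for k using False by (simp add: cone_rel_def norm_form_def)
    then have "\<not> cone_rel \<epsilon> (\<sigma> k) (f (0, 0, 0)) (f (0, 0, t))" for k using cones by blast
    then have no: "\<not> cone_rel \<epsilon> k (f (0, 0, 0)) (f (0, 0, t))" for k
      using bij_is_surj[OF bij] by (metis surjD)
    have "base_norm \<epsilon> (f (0, 0, 0)) (f (0, 0, t)) = 0"
      using no[of "height (f (0, 0, 0)) (f (0, 0, t)) / base_norm \<epsilon> (f (0, 0, 0)) (f (0, 0, t))"]
      by (auto simp: cone_rel_def split: if_splits)
    then show ?thesis unfolding f0 fibre_coordinates .
  qed (use f0 in auto)
  then obtain T where T: "\<And>t. f (0, 0, t) = (x0, y0, T t)" by metis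
  define n where "n s = base_norm \<epsilon> (x0, y0, 0) (f (1, 0, s))" for s
  define c where "c s = height (x0, y0, 0) (f (1, 0, s))" for s
  have eq: "c s - T t = \<sigma> (s - t) * n s" for s t
  proof -
    obtain x' y' t' where f1: "f (1, 0, s) = (x', y', t')" by (metis prod.exhaust)
    have "cone_rel \<epsilon> (s - t) (0, 0, t) (1, 0, s)" by (simp add: cone_rel_def norm_form_def)
    then have "cone_rel \<epsilon> (\<sigma> (s - t)) (x0, y0, T t) (x', y', t')"
      using cones[of "s - t" "(0, 0, t)" "(1, 0, s)"] unfolding T f1 by blast
    then have "t' - T t - (x' * y0 - x0 * y') / 2 = \<sigma> (s - t) * n s"
      by (simp add: cone_rel_def n_def f1)
    moreover have "c s - T t = t' - T t - (x' * y0 - x0 * y') / 2"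
      by (simp add: c_def f1)
    ultimately show ?thesis by simp
  qed
  have cT: "c s = T s" for s using eq[of s s] by (simp add: zero)
  have n_const: "n s = n t" for s t
  proof (cases "s = t")
    case False
    have "T s - T t = \<sigma> (s - t) * n s" "T t - T s = \<sigma> (t - s) * n t"
      using eq[of s t] eq[of t s] by (simp_all add: cT)
    moreover have "\<sigma> (t - s) = - \<sigma> (s - t)" using neg[of "s - t"] by simp
    ultimately have "\<sigma> (s - t) * n s = \<sigma> (s - t) * n t" by (metis minus_diff_eq minus_mult_left minus_minus)
    then show ?thesis using nz[of "s - t"] False by simp
  qed simp
  have "n 0 \<noteq> 0"
  proof
    assume "n 0 = 0"
    then have "T 1 = T 0" using eq[of 1 0] n_const[of 1 0] by (simp add: cT)
    then have "f (0, 0, 1) = f (0, 0, 0)" by (simp add: T)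
    then show False using bijf by (metis bij_is_inj injD prod.inject zero_neq_one)
  qed
  have "T s - T t = \<sigma> (s - t) * n 0" for s t using eq[of s t] n_const[of s 0] by (simp add: cT)
  from this[of a "- b"] this[of a 0] this[of "- b" 0]
  have "\<sigma> (a + b) * n 0 = \<sigma> a * n 0 - \<sigma> (- b) * n 0" by (simp add: algebra_simps)
  also have "\<dots> = (\<sigma> a + \<sigma> b) * n 0" by (simp add: neg algebra_simps)
  finally show ?thesis using \<open>n 0 \<noteq> 0\<close> by simp
qed

end

section \<open>Power maps that are not additive\<close>

lemma card_poly_roots_le:
  fixes p :: "'a::idom poly"
  assumes "p \<noteq> 0" "S \<subseteq> {x. poly p x = 0}"
  shows "card S \<le> Polynomial.degree p"
  using card_mono[OF poly_roots_finite[OF assms(1)] assms(2)] card_poly_roots_bound[OF assms(1)]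
  by linarith

context odd_nonsquare
begin

text \<open>Here \<open>\<sigma>\<close> is the power map with exponent \<open>h + 1\<close>, where \<open>2 h = q + 1\<close>; it fixes the even
  elements and multiplies the odd ones by the involution.\<close>

lemma not_additive_3_mod_4:
  assumes gen: "i \<in> psi_generators \<epsilon>" and mod4: "CARD('a) mod 4 = 3" and q: "5 < CARD('a)"
    and pow: "\<And>a. Some a [^]\<^bsub>psi_group \<epsilon>\<^esub> ((CARD('a) + 1) div 2 + 1) = Some (\<sigma> a)"
    and add: "\<And>a b. \<sigma> (a + b) = \<sigma> a + \<sigma> b"
  shows False
proof -
  obtain d where d: "d = \<delta>" by blast
  have sq: "a * a \<noteq> d" for a using square_neq_delta[of a] by (simp add: d power2_eq_square)
  let ?h = "\<lambda>a. Some a [^]\<^bsub>psi_group \<epsilon>\<^esub> ((CARD('a) + 1) div 2)"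
  have pow': "Some (\<sigma> a) = psi \<epsilon> (?h a) (Some a)" for a
    unfolding pow[symmetric] G.nat_pow_mult[OF carrier_psi, symmetric] mult_psi by simp
  have even: "\<sigma> a = a" if "a \<in> even_elems" for a
    using pow'[of a] that by (simp add: even_elems_def)
  have odd: "a \<noteq> 0 \<and> \<sigma> a * a = d" if "a \<notin> even_elems" for a
  proof -
    have "?h a = Some 0" using half_power[of "Some a"] that by (auto simp: even_elems_def)
    then have "Some (\<sigma> a) = psi \<epsilon> (Some 0) (Some a)" using pow'[of a] by simp
    then show ?thesis unfolding d by (auto split: if_splits)
  qed
  have i: "i \<noteq> 0" "\<sigma> i * i = d" using odd generator_not_even[OF gen] by auto
  \<comment> \<open>For an even f, i + f cannot be even: additivity would then fix i, so i^2 = d.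
    Hence i + f is odd, and (d / i + f) (i + f) = d leaves two values of f.\<close>
  have "even_elems \<subseteq> {0, - (d + i * i) / i}"
  proof
    fix f assume "f \<in> even_elems"
    then have sum: "(\<sigma> (i + f)) * i = d + f * i"
      using add[of i f] even[of f] i by (simp add: algebra_simps)
    have "i + f \<notin> even_elems"
    proof
      assume "i + f \<in> even_elems"
      then have "i * i = d" using sum even[of "i + f"] by (simp add: algebra_simps)
      then show False using sq by blast
    qed
    then have "\<sigma> (i + f) * (i + f) = d" using odd by blast
    then have "(d + f * i) * (i + f) = d * i"
      unfolding sum[symmetric] by (metis mult.assoc mult.commute)
    then have "f * (f * i + (d + i * i)) = 0" by (simp add: algebra_simps)
    then consider "f = 0" | "f * i = - (d + i * i)"
      unfolding eq_neg_iff_add_eq_0 mult_eq_0_iff by blast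
    then show "f \<in> {0, - (d + i * i) / i}"
    proof cases
      case 2
      then have "f = - (d + i * i) / i" by (subst nonzero_eq_divide_eq[OF i(1)])
      then show ?thesis by blast
    qed simp
  qed
  then have "card even_elems \<le> card {0, - (d + i * i) / i}" by (intro card_mono) auto
  also have "\<dots> \<le> 2" by (simp add: card_insert_if)
  finally have "(CARD('a) - 1) div 2 \<le> 2" unfolding card_even_elems[OF gen] .
  then have "CARD('a) = 6" using q by linarith
  then show False using mod4 by simp
qed

text \<open>Here \<open>\<sigma>\<close> is the power map with exponent \<open>h + 2\<close>, where \<open>2 h = q + 1\<close>; it squares the even
  elements, and squares the odd ones and multiplies them by the involution.\<close>

lemma not_additive_1_mod_4:
  assumes gen: "i \<in> psi_generators \<epsilon>" and mod4: "CARD('a) mod 4 = 1" and q: "9 < CARD('a)"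
    and pow: "\<And>a. Some a [^]\<^bsub>psi_group \<epsilon>\<^esub> ((CARD('a) + 1) div 2 + 2) = Some (\<sigma> a)"
    and add: "\<And>a b. \<sigma> (a + b) = \<sigma> a + \<sigma> b"
  shows False
proof -
  obtain d where d: "d = \<delta>" by blast
  have d0: "d \<noteq> 0" by (simp add: d)
  have psi: "psi \<epsilon> (Some a) (Some b) = (if a + b = 0 then None else Some ((a * b + d) / (a + b)))" for a b
    by (simp add: d)
  let ?h = "\<lambda>a. Some a [^]\<^bsub>psi_group \<epsilon>\<^esub> ((CARD('a) + 1) div 2)"
  have pow': "Some (\<sigma> a) = psi \<epsilon> (?h a) (psi \<epsilon> (Some a) (Some a))" for a
  proof -
    have "Some a [^]\<^bsub>psi_group \<epsilon>\<^esub> (2::nat) = psi \<epsilon> (Some a) (Some a)"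
      by (simp add: numeral_2_eq_2 mult_psi flip: G.nat_pow_Suc) (simp add: one_psi)
    then show ?thesis
      unfolding pow[symmetric] G.nat_pow_mult[OF carrier_psi, symmetric] mult_psi by simp
  qed
  have square: "psi \<epsilon> (Some a) (Some a) = (if a = 0 then None else Some ((a * a + d) / (2 * a)))" for a
    by (simp add: psi del: psi.simps(1) flip: mult_2)
  have even: "a \<noteq> 0 \<and> 2 * a * \<sigma> a = a * a + d" if "a \<in> even_elems" for a
    using pow'[of a] that unfolding square
    by (auto simp: even_elems_def square split: if_splits)
  have odd: "a * a + d \<noteq> 0 \<and> \<sigma> a * (a * a + d) = 2 * d * a" if "a \<notin> even_elems" for a
  proof -
    have "?h a = Some 0" using half_power[of "Some a"] that by (auto simp: even_elems_def)
    then have "Some (\<sigma> a) = psi \<epsilon> (Some 0) (psi \<epsilon> (Some a) (Some a))" using pow'[of a] by simp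
    then show ?thesis unfolding square using d0
      by (auto simp: psi simp del: psi.simps(1) split: if_splits)
  qed
  have card: "card even_elems = (CARD('a) - 1) div 2" by (rule card_even_elems[OF gen])
  show False
  proof (cases "(3::'a) = 0")
    case False
    \<comment> \<open>Outside characteristic 3, j is compared with 2 j. For even j, an even 2 j
      would give 3 d = 0; so 2 j is odd, and the two formulas combine to 4 j^4 + d j^2 + d^2 =
      0.\<close>
    have "even_elems \<subseteq> {j. poly [:d\<^sup>2, 0, d, 0, 4:] j = 0}"
    proof
      fix j assume j: "j \<in> even_elems"
      have s: "\<sigma> (2 * j) = 2 * \<sigma> j" using add[of j j] by (simp only: mult_2)
      have ej: "2 * j * \<sigma> j = j * j + d" using even[OF j] by blast
      have "2 * j \<notin> even_elems"
      proof
        assume "2 * j \<in> even_elems"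
        then have "4 * (2 * j * \<sigma> j) = 4 * (j * j) + d"
          using even[of "2 * j"] s by (simp add: algebra_simps)
        moreover have "3 * d = 4 * (j * j + d) - (4 * (j * j) + d)" by (simp add: algebra_simps)
        ultimately have "3 * d = 0" unfolding ej by (metis diff_self)
        then show False using False d0 by simp
      qed
      then have o: "2 * \<sigma> j * (2 * j * (2 * j) + d) = 2 * d * (2 * j)"
        using odd[of "2 * j"] unfolding s by blast
      have "(2 * j * \<sigma> j) * (4 * (j * j) + d) = j * (2 * \<sigma> j * (2 * j * (2 * j) + d))"
        by (simp add: algebra_simps)
      also have "\<dots> = j * (4 * d * j)" unfolding o by (simp add: algebra_simps)
      finally have "(j * j + d) * (4 * (j * j) + d) = j * (4 * d * j)" unfolding ej .
      then show "j \<in> {j. poly [:d\<^sup>2, 0, d, 0, 4:] j = 0}"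
        by (simp add: algebra_simps power2_eq_square)
    qed
    then have "card even_elems \<le> Polynomial.degree [:d\<^sup>2, 0, d, 0, 4:]"
      by (intro card_poly_roots_le) simp_all
    then have "(CARD('a) - 1) div 2 \<le> 4" unfolding card by simp
    then have "CARD('a) \<le> 10" by linarith
    then have "CARD('a) = 10" using q by linarith
    then show False using mod4 by simp
  next
    case True
    have "card even_elems > 0" unfolding card using q by simp
    then obtain j where j: "j \<in> even_elems" by (metis card.empty ex_in_conv less_numeral_extra(3))
    have j0: "j \<noteq> 0" and ej: "2 * j * \<sigma> j = j * j + d" using even[OF j] by auto
    \<comment> \<open>In characteristic 3 doubling is negation and yields nothing, so a fixed even j
      is added to every even p. \<open>A\<close> covers the case j + p even; \<open>B\<close> and
      \<open>C\<close> cover j + p odd, \<open>B\<close> being the factor j + p that splits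
      off.\<close>
    define A where "A = [:j * j, j, 1:]"
    define B where "B = [:j, 1:]"
    define C where "C = [:d * (j * j + d), j * (j * j + d) - 2 * j * d, 2 * (j * j) + d, j:]"
    have ABC: "A \<noteq> 0" "B \<noteq> 0" "C \<noteq> 0" "Polynomial.degree A = 2" "Polynomial.degree B = 1" "Polynomial.degree C = 3"
      using j0 by (simp_all add: A_def B_def C_def)
    have "even_elems \<subseteq> {p. poly (A * B * C) p = 0}"
    proof
      fix p assume p: "p \<in> even_elems"
      have p0: "p \<noteq> 0" and ep: "2 * p * \<sigma> p = p * p + d" using even[OF p] by auto
      have s: "2 * j * p * \<sigma> (j + p) = (j + p) * (j * p + d)"
      proof -
        have "2 * j * p * \<sigma> (j + p) = p * (2 * j * \<sigma> j) + j * (2 * p * \<sigma> p)"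
          by (simp add: add algebra_simps)
        also have "\<dots> = (j + p) * (j * p + d)" unfolding ej ep by (simp add: algebra_simps)
        finally show ?thesis .
      qed
      show "p \<in> {p. poly (A * B * C) p = 0}"
      proof (cases "j + p \<in> even_elems")
        case True
        then have e: "2 * (j + p) * \<sigma> (j + p) = (j + p) * (j + p) + d" using even by blast
        have "(j + p) * (2 * j * p * \<sigma> (j + p)) = j * p * (2 * (j + p) * \<sigma> (j + p))"
          by (simp add: ac_simps)
        also have "\<dots> = j * p * ((j + p) * (j + p) + d)" unfolding e ..
        finally have "d * (p * p + j * p + j * j) = 0" unfolding s by (simp add: algebra_simps)
        then have "p * p + j * p + j * j = 0" using d0 mult_eq_0_iff by blast
        then have "poly A p = 0" by (simp add: A_def algebra_simps)
        then show ?thesis by simp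
      next
        case False
        then have o: "\<sigma> (j + p) * ((j + p) * (j + p) + d) = 2 * d * (j + p)" using odd by blast
        have "(2 * j * p * \<sigma> (j + p)) * ((j + p) * (j + p) + d) =
            2 * j * p * (\<sigma> (j + p) * ((j + p) * (j + p) + d))" by (simp only: mult.assoc)
        also have "\<dots> = 4 * d * j * p * (j + p)" unfolding o by simp
        finally have "(p + j) * ((j * p + d) * ((j + p) * (j + p) + d) - 4 * d * j * p) = 0"
          unfolding s by (simp add: algebra_simps)
        moreover have "poly C p = (j * p + d) * ((j + p) * (j + p) + d) - 4 * d * j * p"
          by (simp add: C_def algebra_simps)
        moreover have "poly B p = p + j" by (simp add: B_def)
        ultimately show ?thesis by (metis (mono_tags) mem_Collect_eq mult_eq_0_iff poly_mult)
      qed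
    qed
    then have "card even_elems \<le> Polynomial.degree (A * B * C)"
      by (intro card_poly_roots_le) (use ABC in simp_all)
    also have "\<dots> = 6" using ABC by (simp add: degree_mult_eq)
    finally have "(CARD('a) - 1) div 2 \<le> 6" unfolding card .
    then have le: "CARD('a) \<le> 14" by linarith
    have "CHAR('a) dvd 3" using of_nat_eq_0_iff_char_dvd[of 3, where ?'a = 'a] True by simp
    moreover have "CHAR('a) \<noteq> 1" by simp
    ultimately have "CHAR('a) = 3" using prime_nat_iff[of 3] by auto
    then have "3 dvd CARD('a)" using CHAR_dvd_CARD[where ?'a = 'a] by simp
    then obtain c where "CARD('a) = 3 * c" by blast
    \<comment> \<open>No multiple of 3 from 10 to 14 is 1 modulo 4.\<close>
    then show False using le q mod4 by presburger
  qed
qed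

lemma not_wl_identifies_2:
  assumes gen: "i \<in> psi_generators \<epsilon>" and q: "9 < CARD('a)"
  shows "\<not> wl_identifies 2 (cone_digraph \<epsilon> i)"
proof -
  define h where "h = (CARD('a) + 1) div 2"
  have h: "CARD('a) + 1 = 2 * h" using odd_card unfolding h_def by presburger
  have mod4: "CARD('a) mod 4 = 3 \<or> CARD('a) mod 4 = 1" using odd_card by presburger
  \<comment> \<open>Coprimality to 2 h needs an odd exponent coprime to h: h + 1 works for even h, h
    + 2 for odd h.\<close>
  define k where "k = (if CARD('a) mod 4 = 3 then h + 1 else h + 2)"
  have "coprime k (CARD('a) + 1)"
  proof -
    have "odd k" using mod4 odd_card unfolding k_def h_def by presburger
    moreover have "coprime k h"
    proof (cases "CARD('a) mod 4 = 3")
      case True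
      then show ?thesis by (simp add: k_def coprime_commute)
    next
      case False
      then have "odd h" using mod4 unfolding h_def by presburger
      then have "gcd 2 h = 1" by (simp flip: coprime_iff_gcd_eq_1)
      then have "gcd (2 + h) h = 1" by (simp only: gcd_add1)
      then show ?thesis using False by (simp add: k_def coprime_iff_gcd_eq_1)
    qed
    ultimately show ?thesis unfolding h by (simp add: coprime_commute)
  qed
  then obtain \<sigma> :: "'a \<Rightarrow> 'a" where \<sigma>: "bij \<sigma>"
    "\<And>a b. psi \<epsilon> (Some (\<sigma> a)) (Some (\<sigma> b)) = map_option \<sigma> (psi \<epsilon> (Some a) (Some b))"
    and pow: "\<And>a. Some a [^]\<^bsub>psi_group \<epsilon>\<^esub> k = Some (\<sigma> a)"
    using power_automorphism by blast
  show ?thesis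
  proof (rule not_wl_identifiesI)
    have wf: "pair_wf_digraph (cone_digraph \<epsilon> j)" for j
      using pair_fin_digraph_cone_digraph by (auto simp: pair_fin_digraph_def)
    show "pair_wf_digraph (cone_digraph \<epsilon> i)" "pair_wf_digraph (cone_digraph \<epsilon> (\<sigma> i))"
      by (rule wf)+
    show "finite (pverts (cone_digraph \<epsilon> (\<sigma> i)))" by simp
    show "\<not> wl_distinguishes 2 (cone_digraph \<epsilon> i) (cone_digraph \<epsilon> (\<sigma> i))"
      by (rule psi_automorphism_not_wl2_distinguishes[OF \<sigma>])
    show "\<not> arc_isomorphism f (cone_digraph \<epsilon> i) (cone_digraph \<epsilon> (\<sigma> i))" for f
    proof
      assume "arc_isomorphism f (cone_digraph \<epsilon> i) (cone_digraph \<epsilon> (\<sigma> i))"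
      then have add: "\<sigma> (a + b) = \<sigma> a + \<sigma> b" for a b
        using isomorphism_imp_additive[OF gen \<sigma>] by blast
      show False
      proof (cases "CARD('a) mod 4 = 3")
        case True
        show False
          by (rule not_additive_3_mod_4[OF gen True _ _ add]) (use q pow True in \<open>auto simp: k_def h_def\<close>)
      next
        case False
        then have "CARD('a) mod 4 = 1" using mod4 by blast
        then show False
          by (rule not_additive_1_mod_4[OF gen _ q _ add]) (use pow False in \<open>auto simp: k_def h_def\<close>)
      qed
    qed
  qed
qed

end

section \<open>Configurations on 27 points\<close>

text \<open>\<open>paths\<close> between cones for q = 3, in residues. There \<epsilon> = \<delta> =
  -1 and nonzero elements are their own inverses, so psi(a, b) becomes (a b - 1) (a + b).\<close>

definition paths3 :: "int \<Rightarrow> int \<Rightarrow> int \<Rightarrow> nat" where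
  "paths3 a b d = (if (a + b) mod 3 = 0 then 3 - of_bool (d = a) - of_bool (d = b)
     else if d = ((a * b - 1) * (a + b)) mod 3 then 1 else 4 - of_bool (d = a) - of_bool (d = b))"

text \<open>Splits a count into the 24 types, whose multiplicities become the unknowns of a linear
  system.\<close>

lemma card_types_sum:
  assumes "finite J" "\<And>w. w \<in> J \<Longrightarrow> n w \<in> {1, 2} \<and> A w \<in> {1, 2} \<and> B w \<in> {1, 2} \<and> C w \<in> {0, 1, 2 :: int}"
  shows "card {w \<in> J. \<phi> (n w) (A w) (B w) (C w)} =
    (\<Sum>i\<in>{1, 2::int}. \<Sum>j\<in>{1, 2::int}. \<Sum>k\<in>{1, 2::int}. \<Sum>l\<in>{0, 1, 2}.
      if \<phi> i j k l then card {w \<in> J. n w = i \<and> A w = j \<and> B w = k \<and> C w = l} else 0)"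
proof -
  let ?T = "{1, 2::int} \<times> {1, 2::int} \<times> {1, 2::int} \<times> {0, 1, 2::int}"
  let ?f = "\<lambda>w. (n w, A w, B w, C w)"
  let ?S = "{w \<in> J. \<phi> (n w) (A w) (B w) (C w)}"
  have "card ?S = (\<Sum>\<tau>\<in>?T. card {w \<in> ?S. ?f w = \<tau>})"
  proof (rule sum_card_fibres[symmetric])
    show "finite ?S" using assms(1) by simp
    show "finite ?T" by (intro finite_cartesian_product) simp_all
    show "?f ` ?S \<subseteq> ?T" using assms(2) by blast
  qed
  also have "\<dots> = (\<Sum>(i, j, k, l)\<in>?T.
      if \<phi> i j k l then card {w \<in> J. n w = i \<and> A w = j \<and> B w = k \<and> C w = l} else 0)"
  proof (rule sum.cong[OF refl], clarsimp, intro conjI impI)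
    fix i j k l
    assume "\<phi> i j k l"
    then have "{w \<in> ?S. ?f w = (i, j, k, l)} = {w \<in> J. n w = i \<and> A w = j \<and> B w = k \<and> C w = l}" by auto
    then show "card {w \<in> J. \<phi> (n w) (A w) (B w) (C w) \<and> n w = i \<and> A w = j \<and> B w = k \<and> C w = l} =
        card {w \<in> J. n w = i \<and> A w = j \<and> B w = k \<and> C w = l}" by (simp add: conj_assoc)
  next
    fix i j k l
    assume "\<not> \<phi> i j k l"
    then have "{w \<in> J. \<phi> (n w) (A w) (B w) (C w) \<and> n w = i \<and> A w = j \<and> B w = k \<and> C w = l} = {}" by auto
    then show "card {w \<in> J. \<phi> (n w) (A w) (B w) (C w) \<and> n w = i \<and> A w = j \<and> B w = k \<and> C w = l} = 0"
      by (simp only: card.empty)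
  qed
  also have "\<dots> = (\<Sum>i\<in>{1, 2::int}. \<Sum>j\<in>{1, 2::int}. \<Sum>k\<in>{1, 2::int}. \<Sum>l\<in>{0, 1, 2}.
      if \<phi> i j k l then card {w \<in> J. n w = i \<and> A w = j \<and> B w = k \<and> C w = l} else 0)"
    by (simp only: sum.cartesian_product split_def)
  finally show ?thesis .
qed

text \<open>The path counts form a linear system for the numbers of \<open>w\<close> of the 24 possible types; its only
  nonnegative solution is the one below.  The functions \<open>f\<close>, \<open>h\<close>, \<open>F\<close>, \<open>H\<close> group the types by
  \<open>(A, B)\<close>, which makes the system sparse.\<close>

lemma third_point_types:
  assumes fin: "finite J" and J: "card J = 7"
    and types: "\<And>w. w \<in> J \<Longrightarrow> n w \<in> {1, 2} \<and> A w \<in> {1, 2} \<and> B w \<in> {1, 2} \<and> C w \<in> {0, 1, 2 :: int}"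
    and \<nu>: "\<nu> \<in> {1, 2}"
    and count: "\<And>s t a b. s \<in> {0, 1, 2} \<Longrightarrow> t \<in> {0, 1, 2} \<Longrightarrow> a \<in> {0, 1, 2} \<Longrightarrow> b \<in> {0, 1, 2} \<Longrightarrow>
      card {w \<in> J. (A w * t + B w * (s + a * n w) + C w) mod 3 = b} = paths3 a b ((\<nu> * (t - s)) mod 3)"
    and ijkl: "i \<in> {1, 2}" "j \<in> {1, 2}" "k \<in> {1, 2}" "l \<in> {0, 1, 2}"
  shows "card {w \<in> J. n w = i \<and> A w = j \<and> B w = k \<and> C w = l} =
    of_bool (k = 3 - j \<and> (l = 0 \<longleftrightarrow> i = \<nu> \<and> j = \<nu>))"
proof -
  define N where "N i j k l = int (card {w \<in> J. n w = i \<and> A w = j \<and> B w = k \<and> C w = l})" for i j k l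
  have N0: "N i j k l \<ge> 0" for i j k l by (simp add: N_def)
  have sums: "int (card {w \<in> J. \<phi> (n w) (A w) (B w) (C w)}) =
    (\<Sum>i\<in>{1, 2::int}. \<Sum>j\<in>{1, 2::int}. \<Sum>k\<in>{1, 2::int}. \<Sum>l\<in>{0, 1, 2}. if \<phi> i j k l then N i j k l else 0)" for \<phi>
  proof -
    have "int (card {w \<in> J. \<phi> (n w) (A w) (B w) (C w)}) =
      int (\<Sum>i\<in>{1, 2::int}. \<Sum>j\<in>{1, 2::int}. \<Sum>k\<in>{1, 2::int}. \<Sum>l\<in>{0, 1, 2}.
        if \<phi> i j k l then card {w \<in> J. n w = i \<and> A w = j \<and> B w = k \<and> C w = l} else 0)"
      by (rule arg_cong[of _ _ int], rule card_types_sum[OF fin types])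
    then show ?thesis unfolding of_nat_sum N_def if_distrib[of int] of_nat_0 .
  qed
  have sums24: "int (card {w \<in> J. \<phi> (n w) (A w) (B w) (C w)}) =
      (if \<phi> 1 1 1 0 then N 1 1 1 0 else 0) + (if \<phi> 1 1 1 1 then N 1 1 1 1 else 0) + (if \<phi> 1 1 1 2 then N 1 1 1 2 else 0) +
      (if \<phi> 1 1 2 0 then N 1 1 2 0 else 0) + (if \<phi> 1 1 2 1 then N 1 1 2 1 else 0) + (if \<phi> 1 1 2 2 then N 1 1 2 2 else 0) +
      (if \<phi> 1 2 1 0 then N 1 2 1 0 else 0) + (if \<phi> 1 2 1 1 then N 1 2 1 1 else 0) + (if \<phi> 1 2 1 2 then N 1 2 1 2 else 0) +
      (if \<phi> 1 2 2 0 then N 1 2 2 0 else 0) + (if \<phi> 1 2 2 1 then N 1 2 2 1 else 0) + (if \<phi> 1 2 2 2 then N 1 2 2 2 else 0) +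
      (if \<phi> 2 1 1 0 then N 2 1 1 0 else 0) + (if \<phi> 2 1 1 1 then N 2 1 1 1 else 0) + (if \<phi> 2 1 1 2 then N 2 1 1 2 else 0) +
      (if \<phi> 2 1 2 0 then N 2 1 2 0 else 0) + (if \<phi> 2 1 2 1 then N 2 1 2 1 else 0) + (if \<phi> 2 1 2 2 then N 2 1 2 2 else 0) +
      (if \<phi> 2 2 1 0 then N 2 2 1 0 else 0) + (if \<phi> 2 2 1 1 then N 2 2 1 1 else 0) + (if \<phi> 2 2 1 2 then N 2 2 1 2 else 0) +
      (if \<phi> 2 2 2 0 then N 2 2 2 0 else 0) + (if \<phi> 2 2 2 1 then N 2 2 2 1 else 0) + (if \<phi> 2 2 2 2 then N 2 2 2 2 else 0)" for \<phi>
    unfolding sums by simp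
  define f where "f x u = N 1 1 1 ((u - x) mod 3) + N 2 1 1 ((u + x) mod 3)" for x u
  define h where "h x u = N 1 2 2 ((u + x) mod 3) + N 2 2 2 ((u - x) mod 3)" for x u
  define F where "F x u = N 1 1 2 ((u + x) mod 3) + N 2 1 2 ((u - x) mod 3)" for x u
  define H where "H x u = N 1 2 1 ((u - x) mod 3) + N 2 2 1 ((u + x) mod 3)" for x u
  have total: "f 0 0 + f 0 1 + f 0 2 + h 0 0 + h 0 1 + h 0 2 + F 0 0 + F 0 1 + F 0 2 +
      H 0 0 + H 0 1 + H 0 2 = 7"
    using sums[of "\<lambda>_ _ _ _. True"] J by (simp add: f_def h_def F_def H_def)
  \<comment> \<open>The arguments arise from solving A t + B (s + a n) + C = b for C in each of the
    four groups (A, B).\<close>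
  have eq: "f a ((b - s - t) mod 3) + h a ((b + s + t) mod 3) + F a ((b + s - t) mod 3) + H a ((b - s + t) mod 3) =
      int (paths3 a b ((\<nu> * (t - s)) mod 3))"
    if "s \<in> {0, 1}" "t \<in> {0, 1, 2}" "a \<in> {0, 1}" "b \<in> {0, 1}" for s t a b
  proof -
    have "f a ((b - s - t) mod 3) + h a ((b + s + t) mod 3) + F a ((b + s - t) mod 3) + H a ((b - s + t) mod 3) =
      int (card {w \<in> J. (A w * t + B w * (s + a * n w) + C w) mod 3 = b})"
      unfolding sums24[of "\<lambda>i j k l. (j * t + k * (s + a * i) + l) mod 3 = b"] f_def h_def F_def H_def
      using that by (elim insertE emptyE; hypsubst; simp)
    also have "card {w \<in> J. (A w * t + B w * (s + a * n w) + C w) mod 3 = b} = paths3 a b ((\<nu> * (t - s)) mod 3)"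
      by (rule count) (use that in auto)
    finally show ?thesis .
  qed
  have "N i j k l = of_bool (k = 3 - j \<and> (l = 0 \<longleftrightarrow> i = \<nu> \<and> j = \<nu>))"
  proof (cases "\<nu> = 1")
    case True
    have sys0:
      "f 0 0 + h 0 0 + F 0 0 + H 0 0 = 1"
      "f 0 2 + h 0 1 + F 0 2 + H 0 1 = 3"
      "f 0 1 + h 0 2 + F 0 1 + H 0 2 = 3"
      "f 0 2 + h 0 1 + F 0 1 + H 0 2 = 3"
      "f 0 1 + h 0 2 + F 0 0 + H 0 0 = 1"
      "f 0 1 + h 0 1 + F 0 1 + H 0 1 = 3"
      "f 0 0 + h 0 2 + F 0 0 + H 0 2 = 3"
      "f 0 0 + h 0 2 + F 0 2 + H 0 0 = 1"
      "f 0 2 + h 0 0 + F 0 1 + H 0 1 = 3"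
      using eq[of 0 0 0 0] eq[of 0 1 0 0] eq[of 0 2 0 0] eq[of 1 0 0 0] eq[of 1 1 0 0] eq[of 0 0 0 1]
        eq[of 0 1 0 1] eq[of 1 0 0 1] eq[of 1 1 0 1]
      by (simp_all add: paths3_def True)
    \<comment> \<open>The counts with first cone 0 determine each function up to an additive
      constant; those with first cone 1 then separate n = 1 from n = 2.\<close>
    have diff0: "f 0 0 = f 0 2" "f 0 1 = f 0 2" "h 0 0 = h 0 2" "h 0 1 = h 0 2"
      "F 0 0 = F 0 2" "F 0 1 = F 0 2" "H 0 0 = H 0 2 - 2" "H 0 1 = H 0 2"
      using sys0 by linarith+
    have sys1:
      "f 1 0 + h 1 0 + F 1 0 + H 1 0 = 3"
      "f 1 2 + h 1 1 + F 1 2 + H 1 1 = 3"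
      "f 1 1 + h 1 2 + F 1 1 + H 1 2 = 1"
      "f 1 2 + h 1 1 + F 1 1 + H 1 2 = 1"
      "f 1 1 + h 1 2 + F 1 0 + H 1 0 = 3"
      "f 1 1 + h 1 1 + F 1 1 + H 1 1 = 1"
      "f 1 0 + h 1 2 + F 1 0 + H 1 2 = 2"
      "f 1 0 + h 1 2 + F 1 2 + H 1 0 = 4"
      "f 1 2 + h 1 0 + F 1 1 + H 1 1 = 1"
      using eq[of 0 0 1 0] eq[of 0 1 1 0] eq[of 0 2 1 0] eq[of 1 0 1 0] eq[of 1 1 1 0] eq[of 0 0 1 1]
        eq[of 0 1 1 1] eq[of 1 0 1 1] eq[of 1 1 1 1]
      by (simp_all add: paths3_def True)
    have diff1: "f 1 0 = f 1 2" "f 1 1 = f 1 2" "h 1 0 = h 1 2" "h 1 1 = h 1 2"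
      "F 1 0 = F 1 2 - 1" "F 1 1 = F 1 2 - 2" "H 1 0 = H 1 2 + 1" "H 1 1 = H 1 2"
      using sys1 by linarith+
    have f: "N 1 1 1 0 = N 1 1 1 2" "N 1 1 1 1 = N 1 1 1 2" "N 2 1 1 0 = N 2 1 1 2" "N 2 1 1 1 = N 2 1 1 2"
      using diff0(1,2)[unfolded f_def, simplified] diff1(1,2)[unfolded f_def, simplified]
      by linarith+
    have h: "N 1 2 2 0 = N 1 2 2 2" "N 1 2 2 1 = N 1 2 2 2" "N 2 2 2 0 = N 2 2 2 2" "N 2 2 2 1 = N 2 2 2 2"
      using diff0(3,4)[unfolded h_def, simplified] diff1(3,4)[unfolded h_def, simplified]
      by linarith+
    have F: "N 1 1 2 0 = 1 + N 1 1 2 2" "N 1 1 2 1 = N 1 1 2 2" "N 2 1 2 2 = 1 + N 2 1 2 0" "N 2 1 2 1 = N 2 1 2 2"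
      using diff0(5,6)[unfolded F_def, simplified] diff1(5,6)[unfolded F_def, simplified]
      by linarith+
    have H: "N 1 2 1 2 = 1 + N 1 2 1 0" "N 1 2 1 1 = N 1 2 1 2" "N 2 2 1 2 = 1 + N 2 2 1 0" "N 2 2 1 1 = N 2 2 1 2"
      using diff0(7,8)[unfolded H_def, simplified] diff1(7,8)[unfolded H_def, simplified]
      by linarith+
    have "N i j k l = of_bool (k = 3 - j \<and> (l = 0 \<longleftrightarrow> i = 1 \<and> j = 1))" if
      "i \<in> {1, 2}" "j \<in> {1, 2}" "k \<in> {1, 2}" "l \<in> {0, 1, 2}" for i j k l
    proof -
      note total' = total[unfolded f_def h_def F_def H_def, simplified, unfolded f h F H]
      \<comment> \<open>The forced surpluses 1, 2, 2 and 2 already account for all seven points, so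
        the remaining unknowns vanish.\<close>
      have zero: "N 1 1 1 2 = 0" "N 2 1 1 2 = 0" "N 1 2 2 2 = 0" "N 2 2 2 2 = 0" "N 1 1 2 2 = 0" "N 2 1 2 0 = 0" "N 1 2 1 0 = 0" "N 2 2 1 0 = 0"
        using total' N0[of 1 1 1 2] N0[of 2 1 1 2] N0[of 1 2 2 2] N0[of 2 2 2 2] N0[of 1 1 2 2] N0[of 2 1 2 0] N0[of 1 2 1 0] N0[of 2 2 1 0]
        by linarith+
      show ?thesis
        using that by (elim insertE emptyE; hypsubst; simp add: f h F H zero)
    qed
    then show ?thesis using ijkl unfolding True by blast
  next
    case False
    then have nu: "\<nu> = 2" using \<nu> by simp
    have sys0:
      "f 0 0 + h 0 0 + F 0 0 + H 0 0 = 1"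
      "f 0 2 + h 0 1 + F 0 2 + H 0 1 = 3"
      "f 0 1 + h 0 2 + F 0 1 + H 0 2 = 3"
      "f 0 2 + h 0 1 + F 0 1 + H 0 2 = 3"
      "f 0 1 + h 0 2 + F 0 0 + H 0 0 = 1"
      "f 0 1 + h 0 1 + F 0 1 + H 0 1 = 3"
      "f 0 0 + h 0 2 + F 0 0 + H 0 2 = 1"
      "f 0 0 + h 0 2 + F 0 2 + H 0 0 = 3"
      "f 0 2 + h 0 0 + F 0 1 + H 0 1 = 3"
      using eq[of 0 0 0 0] eq[of 0 1 0 0] eq[of 0 2 0 0] eq[of 1 0 0 0] eq[of 1 1 0 0] eq[of 0 0 0 1]
        eq[of 0 1 0 1] eq[of 1 0 0 1] eq[of 1 1 0 1]
      by (simp_all add: paths3_def nu)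
    have diff0: "f 0 0 = f 0 2" "f 0 1 = f 0 2" "h 0 0 = h 0 2" "h 0 1 = h 0 2"
      "F 0 0 = F 0 2 - 2" "F 0 1 = F 0 2" "H 0 0 = H 0 2" "H 0 1 = H 0 2"
      using sys0 by linarith+
    have sys1:
      "f 1 0 + h 1 0 + F 1 0 + H 1 0 = 3"
      "f 1 2 + h 1 1 + F 1 2 + H 1 1 = 1"
      "f 1 1 + h 1 2 + F 1 1 + H 1 2 = 3"
      "f 1 2 + h 1 1 + F 1 1 + H 1 2 = 3"
      "f 1 1 + h 1 2 + F 1 0 + H 1 0 = 3"
      "f 1 1 + h 1 1 + F 1 1 + H 1 1 = 1"
      "f 1 0 + h 1 2 + F 1 0 + H 1 2 = 4"
      "f 1 0 + h 1 2 + F 1 2 + H 1 0 = 2"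
      "f 1 2 + h 1 0 + F 1 1 + H 1 1 = 1"
      using eq[of 0 0 1 0] eq[of 0 1 1 0] eq[of 0 2 1 0] eq[of 1 0 1 0] eq[of 1 1 1 0] eq[of 0 0 1 1]
        eq[of 0 1 1 1] eq[of 1 0 1 1] eq[of 1 1 1 1]
      by (simp_all add: paths3_def nu)
    have diff1: "f 1 0 = f 1 2" "f 1 1 = f 1 2" "h 1 0 = h 1 2" "h 1 1 = h 1 2"
      "F 1 0 = F 1 2 + 1" "F 1 1 = F 1 2" "H 1 0 = H 1 2 - 1" "H 1 1 = H 1 2 - 2"
      using sys1 by linarith+
    have f: "N 1 1 1 0 = N 1 1 1 2" "N 1 1 1 1 = N 1 1 1 2" "N 2 1 1 0 = N 2 1 1 2" "N 2 1 1 1 = N 2 1 1 2"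
      using diff0(1,2)[unfolded f_def, simplified] diff1(1,2)[unfolded f_def, simplified]
      by linarith+
    have h: "N 1 2 2 0 = N 1 2 2 2" "N 1 2 2 1 = N 1 2 2 2" "N 2 2 2 0 = N 2 2 2 2" "N 2 2 2 1 = N 2 2 2 2"
      using diff0(3,4)[unfolded h_def, simplified] diff1(3,4)[unfolded h_def, simplified]
      by linarith+
    have F: "N 1 1 2 2 = 1 + N 1 1 2 0" "N 1 1 2 1 = N 1 1 2 2" "N 2 1 2 2 = 1 + N 2 1 2 0" "N 2 1 2 1 = N 2 1 2 2"
      using diff0(5,6)[unfolded F_def, simplified] diff1(5,6)[unfolded F_def, simplified]
      by linarith+
    have H: "N 1 2 1 2 = 1 + N 1 2 1 0" "N 1 2 1 1 = N 1 2 1 2" "N 2 2 1 0 = 1 + N 2 2 1 2" "N 2 2 1 1 = N 2 2 1 2"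
      using diff0(7,8)[unfolded H_def, simplified] diff1(7,8)[unfolded H_def, simplified]
      by linarith+
    have "N i j k l = of_bool (k = 3 - j \<and> (l = 0 \<longleftrightarrow> i = 2 \<and> j = 2))" if
      "i \<in> {1, 2}" "j \<in> {1, 2}" "k \<in> {1, 2}" "l \<in> {0, 1, 2}" for i j k l
    proof -
      note total' = total[unfolded f_def h_def F_def H_def, simplified, unfolded f h F H]
      have zero: "N 1 1 1 2 = 0" "N 2 1 1 2 = 0" "N 1 2 2 2 = 0" "N 2 2 2 2 = 0" "N 1 1 2 0 = 0" "N 2 1 2 0 = 0" "N 1 2 1 0 = 0" "N 2 2 1 2 = 0"
        using total' N0[of 1 1 1 2] N0[of 2 1 1 2] N0[of 1 2 2 2] N0[of 2 2 2 2] N0[of 1 1 2 0] N0[of 2 1 2 0] N0[of 1 2 1 0] N0[of 2 2 1 2]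
        by linarith+
      show ?thesis
        using that by (elim insertE emptyE; hypsubst; simp add: f h F H zero)
    qed
    then show ?thesis using ijkl unfolding nu by blast
  qed
  then have "int (card {w \<in> J. n w = i \<and> A w = j \<and> B w = k \<and> C w = l}) =
      int (of_bool (k = 3 - j \<and> (l = 0 \<longleftrightarrow> i = \<nu> \<and> j = \<nu>)))"
    unfolding N_def of_nat_of_bool .
  then show ?thesis unfolding of_nat_eq_iff .
qed

text \<open>All six permutations of three residues are affine.\<close>

lemma injection_mod_3:
  fixes g :: "int \<Rightarrow> int"
  assumes "\<And>t. t \<in> {0, 1, 2} \<Longrightarrow> g t \<in> {0, 1, 2}" "inj_on g {0, 1, 2}" "t \<in> {0, 1, 2}"
  shows "g t = (g 0 + (g 1 - g 0) * t) mod 3"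
proof -
  have "g 0 \<in> {0, 1, 2}" "g 1 \<in> {0, 1, 2}" "g 2 \<in> {0, 1, 2}" using assms(1) by auto
  moreover have "g 0 \<noteq> g 1" "g 0 \<noteq> g 2" "g 1 \<noteq> g 2" using assms(2) by (auto simp: inj_on_def)
  ultimately show ?thesis using assms(3) by (elim insertE emptyE; simp)
qed

lemma diff_mod_3:
  fixes p q :: int
  assumes "p \<in> {0, 1, 2}" "q \<in> {0, 1, 2}" "p \<noteq> q"
  shows "(p - q) mod 3 \<in> {1, 2}"
  using assms by (elim insertE emptyE; simp)

text \<open>Rows and columns are affine as permutations of three residues, so only the equality of
  the row slopes is at stake. With opposite slopes in the first two rows, the third row,
  extrapolated along the columns, would repeat an entry.\<close>

lemma latin_square_3:
  fixes f :: "int \<Rightarrow> int \<Rightarrow> int"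
  assumes range: "\<And>s t. s \<in> {0, 1, 2} \<Longrightarrow> t \<in> {0, 1, 2} \<Longrightarrow> f s t \<in> {0, 1, 2}"
    and rows: "\<And>s. s \<in> {0, 1, 2} \<Longrightarrow> inj_on (f s) {0, 1, 2}"
    and cols: "\<And>t. t \<in> {0, 1, 2} \<Longrightarrow> inj_on (\<lambda>s. f s t) {0, 1, 2}"
  obtains A B C where "A \<in> {1, 2}" "B \<in> {1, 2}" "C \<in> {0, 1, 2}"
    "\<And>s t. s \<in> {0, 1, 2} \<Longrightarrow> t \<in> {0, 1, 2} \<Longrightarrow> f s t = (A * t + B * s + C) mod 3"
proof -
  have row: "f s t = (f s 0 + (f s 1 - f s 0) * t) mod 3" if "s \<in> {0, 1, 2}" "t \<in> {0, 1, 2}" for s t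
    by (rule injection_mod_3) (use that range rows in auto)
  have col: "f s t = (f 0 t + (f 1 t - f 0 t) * s) mod 3" if "s \<in> {0, 1, 2}" "t \<in> {0, 1, 2}" for s t
    by (rule injection_mod_3[of "\<lambda>s. f s t"]) (use that range cols in auto)
  have ne: "f 0 0 \<noteq> f 0 1" "f 1 0 \<noteq> f 1 1" "f 0 0 \<noteq> f 1 0" "f 0 1 \<noteq> f 1 1" "f 2 0 \<noteq> f 2 1"
    using rows[of 0] rows[of 1] rows[of 2] cols[of 0] cols[of 1] by (auto simp: inj_on_def)
  have in3: "f 0 0 \<in> {0, 1, 2}" "f 0 1 \<in> {0, 1, 2}" "f 1 0 \<in> {0, 1, 2}" "f 1 1 \<in> {0, 1, 2}"
    using range by auto
  have s2: "f 2 0 = (f 0 0 + (f 1 0 - f 0 0) * 2) mod 3" "f 2 1 = (f 0 1 + (f 1 1 - f 0 1) * 2) mod 3"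
    by (rule col; simp)+
  have "(z - r) mod 3 = (q - p) mod 3"
    if "p \<in> {0, 1, 2}" "q \<in> {0, 1, 2}" "r \<in> {0, 1, 2}" "z \<in> {0, 1, 2}" "p \<noteq> q" "r \<noteq> z" "p \<noteq> r"
      "q \<noteq> z" "(p + (r - p) * 2) mod 3 \<noteq> (q + (z - q) * 2) mod 3" for p q r z :: int
  proof (rule ccontr)
    assume "(z - r) mod 3 \<noteq> (q - p) mod 3"
    moreover have "(z - r) mod 3 \<in> {1, 2}" "(q - p) mod 3 \<in> {1, 2}"
      using that by (auto intro!: diff_mod_3)
    ultimately have "(z - r) mod 3 + (q - p) mod 3 = 3" by auto
    then have "((z - r) + (q - p)) mod 3 = 0" unfolding mod_add_eq[of "z - r" 3 "q - p", symmetric] by simp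
    then have "3 dvd (z - r) + (q - p)" by (simp only: mod_eq_0_iff_dvd)
    then obtain c where c: "(z - r) + (q - p) = 3 * c" by (rule dvdE)
    have "q + (z - q) * 2 = p + (r - p) * 2 + 3 * ((z - r) - c)"
      using c by (simp add: algebra_simps)
    then have "(p + (r - p) * 2) mod 3 = (q + (z - q) * 2) mod 3" by (simp only: mod_mult_self2)
    then show False using that(9) by blast
  qed
  from this[OF in3] have slope: "(f 1 1 - f 1 0) mod 3 = (f 0 1 - f 0 0) mod 3"
    using ne unfolding s2 by blast
  define A B C where "A = (f 0 1 - f 0 0) mod 3" and "B = (f 1 0 - f 0 0) mod 3" and "C = f 0 0"
  have "A \<in> {1, 2}" "B \<in> {1, 2}"
    unfolding A_def B_def using diff_mod_3[OF in3(2,1)] diff_mod_3[OF in3(3,1)] ne by simp_all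
  moreover have "C \<in> {0, 1, 2}" unfolding C_def using in3 by blast
  moreover have "f s t = (A * t + B * s + C) mod 3" if st: "s \<in> {0, 1, 2}" "t \<in> {0, 1, 2}" for s t
  proof -
    have 0: "f s 0 = (f 0 0 + (f 1 0 - f 0 0) * s) mod 3" "f s 1 = (f 0 1 + (f 1 1 - f 0 1) * s) mod 3"
      using col[OF st(1)] by auto
    have "((p + (r - p) * s) mod 3 + ((q + (z - q) * s) mod 3 - (p + (r - p) * s) mod 3) * t) mod 3 =
        ((q - p) mod 3 * t + (r - p) mod 3 * s + p) mod 3" if "(z - r) mod 3 = (q - p) mod 3" for p q r z
    proof -
      have "3 dvd (z - r) - (q - p)" using that by (simp only: mod_eq_dvd_iff)
      then obtain u where "(z - r) - (q - p) = 3 * u" by (rule dvdE)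
      then have z: "z = r + (q - p + 3 * u)" by linarith
      have "((p + (r - p) * s) mod 3 + ((q + (z - q) * s) mod 3 - (p + (r - p) * s) mod 3) * t) mod 3 =
          ((p + (r - p) * s) + ((q + (z - q) * s) - (p + (r - p) * s)) * t) mod 3"
        by (intro mod_add_cong mod_mult_cong mod_diff_cong) simp_all
      also have "(p + (r - p) * s) + ((q + (z - q) * s) - (p + (r - p) * s)) * t =
          ((q - p) * t + (r - p) * s + p) + 3 * (u * s * t)"
        unfolding z by (simp add: algebra_simps)
      also have "(((q - p) * t + (r - p) * s + p) + 3 * (u * s * t)) mod 3 =
          ((q - p) * t + (r - p) * s + p) mod 3" by (rule mod_mult_self2)
      also have "\<dots> = ((q - p) mod 3 * t + (r - p) mod 3 * s + p) mod 3"
        by (intro mod_add_cong mod_mult_cong) simp_all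
      finally show ?thesis .
    qed
    from this[OF slope] show ?thesis
      unfolding row[OF st] 0 A_def B_def C_def .
  qed
  ultimately show ?thesis using that by blast
qed

section \<open>Configurations with the intersection numbers of q = 3\<close>

fun rel_inverse_mod3 :: "int rel_type \<Rightarrow> int rel_type" where
  "rel_inverse_mod3 (Cone c) = Cone ((- c) mod 3)"
| "rel_inverse_mod3 r = r"

fun cone_value :: "int rel_type \<Rightarrow> int" where
  "cone_value (Cone c) = c"
| "cone_value r = 0"

text \<open>Stated for an arbitrary vertex set, so that it applies both to the cone digraph and to
  an unknown digraph that two-dimensional colours cannot separate from it.\<close>

locale config3 =
  fixes V :: "'v set" and r :: "'v \<Rightarrow> 'v \<Rightarrow> int rel_type"
  assumes fin: "finite V" and card_V: "card V = 27"
    and same: "x \<in> V \<Longrightarrow> y \<in> V \<Longrightarrow> r x y = Same \<longleftrightarrow> x = y"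
    and range: "x \<in> V \<Longrightarrow> y \<in> V \<Longrightarrow> r x y = Cone c \<Longrightarrow> c \<in> {0, 1, 2}"
    and sym: "x \<in> V \<Longrightarrow> y \<in> V \<Longrightarrow> r y x = rel_inverse_mod3 (r x y)"
    and fibre_fibre: "x \<in> V \<Longrightarrow> y \<in> V \<Longrightarrow> card {z \<in> V. r x z = Fibre \<and> r z y = Fibre} =
      (case r x y of Same \<Rightarrow> 2 | Fibre \<Rightarrow> 1 | Cone _ \<Rightarrow> 0)"
    and cone_fibre: "x \<in> V \<Longrightarrow> y \<in> V \<Longrightarrow> a \<in> {0, 1, 2} \<Longrightarrow> r x y = Cone d \<Longrightarrow>
      card {z \<in> V. r x z = Cone a \<and> r z y = Fibre} = of_bool (d \<noteq> a)"
    and cone_cone: "x \<in> V \<Longrightarrow> y \<in> V \<Longrightarrow> a \<in> {0, 1, 2} \<Longrightarrow> b \<in> {0, 1, 2} \<Longrightarrow> r x y = Cone d \<Longrightarrow>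
      card {z \<in> V. r x z = Cone a \<and> r z y = Cone b} = paths3 a b d"
    and cone_degree: "x \<in> V \<Longrightarrow> card {z \<in> V. r x z = Cone 0} = 8"
begin

definition fib :: "'v \<Rightarrow> 'v \<Rightarrow> bool" where
  "fib x y \<longleftrightarrow> r x y = Same \<or> r x y = Fibre"

lemma fibre_sym: "x \<in> V \<Longrightarrow> y \<in> V \<Longrightarrow> r y x = Fibre \<longleftrightarrow> r x y = Fibre"
  using sym[of x y] by (cases "r x y") auto

lemma fib_refl: "x \<in> V \<Longrightarrow> fib x x"
  using same unfolding fib_def by blast

lemma fib_sym: "x \<in> V \<Longrightarrow> y \<in> V \<Longrightarrow> fib y x \<longleftrightarrow> fib x y"
  using sym[of x y] unfolding fib_def by (cases "r x y") auto

text \<open>If \<open>x\<close> and \<open>z\<close> were in a cone class, no vertex could be in the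
  class \<open>Fibre\<close> with both.\<close>

lemma fib_trans:
  assumes V: "x \<in> V" "y \<in> V" "z \<in> V" and fib: "fib x y" "fib y z"
  shows "fib x z"
proof (cases "x = y \<or> y = z")
  case True
  then show ?thesis using fib by auto
next
  case False
  then have "y \<in> {w \<in> V. r x w = Fibre \<and> r w z = Fibre}"
    using fib V same unfolding fib_def by auto
  then have "card {w \<in> V. r x w = Fibre \<and> r w z = Fibre} \<noteq> 0" using fin by auto
  then show ?thesis
    unfolding fibre_fibre[OF V(1,3)] fib_def by (cases "r x z") auto
qed

lemma not_fib_iff: "\<not> fib x y \<longleftrightarrow> (\<exists>c. r x y = Cone c)"
  unfolding fib_def by (cases "r x y") auto

text \<open>Together with \<open>cone_exists\<close>, a cone from \<open>x\<close> meets every other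
  fibre exactly once: the walks along cone a followed by a fibre step number 0 for a = d and 1
  otherwise.\<close>

lemma cone_unique:
  assumes V: "x \<in> V" "z \<in> V" "z' \<in> V" and r: "r x z = Cone a" "r x z' = Cone a" and fib: "fib z z'"
  shows "z = z'"
proof (rule ccontr)
  assume "z \<noteq> z'"
  then have "z \<in> {w \<in> V. r x w = Cone a \<and> r w z' = Fibre}"
    using fib V same r unfolding fib_def by auto
  then have "card {w \<in> V. r x w = Cone a \<and> r w z' = Fibre} \<noteq> 0" using fin by auto
  then show False using cone_fibre[OF V(1,3) range[OF V(1,2) r(1)] r(2)] by simp
qed

lemma cone_exists:
  assumes V: "x \<in> V" "y \<in> V" and r: "r x y = Cone d" and a: "a \<in> {0, 1, 2}"
  shows "\<exists>z\<in>V. fib y z \<and> r x z = Cone a"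
proof (cases "a = d")
  case True
  then show ?thesis using V r fib_refl by blast
next
  case False
  then have "card {z \<in> V. r x z = Cone a \<and> r z y = Fibre} \<noteq> 0"
    using cone_fibre[OF V a r] by simp
  then have "{z \<in> V. r x z = Cone a \<and> r z y = Fibre} \<noteq> {}" by (metis card.empty)
  then obtain z where z: "z \<in> V" "r x z = Cone a" "r z y = Fibre" by blast
  then have "fib y z" using fibre_sym[OF z(1) V(2)] unfolding fib_def by blast
  then show ?thesis using z by blast
qed

end

text \<open>\<open>pt v 0, pt v 1, pt v 2\<close> are the points of the fibre of \<open>v \<in> K\<close>, labelled so that points of the
  base fibre are related by \<open>Cone 0\<close> exactly to the points with the same label.\<close>

locale labelled_config3 = config3 V r for V :: "'v set" and r +
  fixes K :: "'v set" and x0 :: 'v and pt :: "'v \<Rightarrow> int \<Rightarrow> 'v"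
  assumes K: "finite K" "card K = 9" "x0 \<in> K"
    and pt_bij: "bij_betw (case_prod pt) (K \<times> {0, 1, 2}) V"
    and pt_fib: "v \<in> K \<Longrightarrow> w \<in> K \<Longrightarrow> s \<in> {0, 1, 2} \<Longrightarrow> t \<in> {0, 1, 2} \<Longrightarrow> fib (pt v s) (pt w t) \<longleftrightarrow> v = w"
    and pt_base: "v \<in> K \<Longrightarrow> v \<noteq> x0 \<Longrightarrow> t \<in> {0, 1, 2} \<Longrightarrow> r (pt x0 t) (pt v t) = Cone 0"

text \<open>The representatives are a point and its eight neighbours in \<open>Cone 0\<close>, which
  lie in different fibres. Projecting the base fibre along \<open>Cone 0\<close> labels the other
  fibres; this is injective since \<open>Cone 0\<close> is symmetric, and 9 * 3 = 27 makes it
  onto.\<close>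

lemma (in config3) labelling_exists: "\<exists>K x0 pt. labelled_config3 V r K x0 pt"
proof -
  let ?L = "{0, 1, 2 :: int}"
  obtain x0 where x0: "x0 \<in> V" using card_V by fastforce
  have "{z \<in> V. r x0 z = Fibre \<and> r z x0 = Fibre} = {z \<in> V. r x0 z = Fibre}"
    using fibre_sym x0 by blast
  moreover have "r x0 x0 = Same" using same x0 by blast
  ultimately have "card {z \<in> V. r x0 z = Fibre} = 2" using fibre_fibre[OF x0 x0] by simp
  then obtain x1 x2 where x12: "{z \<in> V. r x0 z = Fibre} = {x1, x2}" "x1 \<noteq> x2" by (auto simp: card_2_iff)
  have x12': "x1 \<in> V" "x2 \<in> V" "r x0 x1 = Fibre" "r x0 x2 = Fibre" using x12(1) by blast+
  have ne: "x0 \<noteq> x1" "x0 \<noteq> x2" using x12' \<open>r x0 x0 = Same\<close> by auto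
  define \<beta> where "\<beta> t = (if t = 0 then x0 else if t = 1 then x1 else x2)" for t :: int
  have \<beta>V: "\<beta> t \<in> V" and \<beta>0: "fib x0 (\<beta> t)" for t
    unfolding \<beta>_def fib_def using x0 x12' \<open>r x0 x0 = Same\<close> by auto
  have \<beta>fib: "fib (\<beta> s) (\<beta> t)" for s t
    using fib_trans[of "\<beta> s" x0 "\<beta> t"] fib_sym[of x0 "\<beta> s"] \<beta>V \<beta>0 x0 by blast
  have \<beta>inj: "\<beta> s = \<beta> t \<Longrightarrow> s = t" if "s \<in> ?L" "t \<in> ?L" for s t
    using that ne x12(2) unfolding \<beta>_def by (auto split: if_splits)
  define K where "K = insert x0 {v \<in> V. r x0 v = Cone 0}"
  have KV: "v \<in> V" if "v \<in> K" for v using that x0 by (auto simp: K_def)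
  have finK: "finite K" using fin by (simp add: K_def)
  have cardK: "card K = 9"
    using cone_degree[OF x0] fin \<open>r x0 x0 = Same\<close> by (simp add: K_def)
  have Kfib: "v = w" if "v \<in> K" "w \<in> K" "fib v w" for v w
  proof -
    have not: "\<not> fib x0 u" if "r x0 u = Cone 0" for u using that by (simp add: fib_def)
    show ?thesis
      using that not cone_unique[OF x0, of v w 0] fib_sym[of v w] KV unfolding K_def by blast
  qed
  have ex: "\<exists>z. z \<in> V \<and> fib v z \<and> r (\<beta> t) z = Cone 0" if v: "v \<in> K" "v \<noteq> x0" for v t
  proof -
    have "\<not> fib (\<beta> t) v"
      using fib_trans[OF x0 \<beta>V KV[OF v(1)] \<beta>0] Kfib[OF _ v(1), of x0] v(2) by (auto simp: K_def)
    then obtain d where "r (\<beta> t) v = Cone d" unfolding not_fib_iff by blast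
    then show ?thesis using cone_exists[OF \<beta>V KV[OF v(1)], of t d 0] by blast
  qed
  define pt where "pt v t = (if v = x0 then \<beta> t else SOME z. z \<in> V \<and> fib v z \<and> r (\<beta> t) z = Cone 0)" for v t
  have pt: "pt v t \<in> V \<and> fib v (pt v t) \<and> r (\<beta> t) (pt v t) = Cone 0" if "v \<in> K" "v \<noteq> x0" for v t
    using someI_ex[OF ex[OF that, of t]] that(2) unfolding pt_def by simp
  have ptx: "pt x0 t = \<beta> t" for t by (simp add: pt_def)
  have ptV: "pt v t \<in> V" and ptf: "fib v (pt v t)" if "v \<in> K" for v t
    using pt[OF that] ptx \<beta>V \<beta>0 by (cases "v = x0"; simp)+
  have pt_fib: "fib (pt v s) (pt w t) \<longleftrightarrow> v = w" if vw: "v \<in> K" "w \<in> K" for v w s t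
  proof
    assume "fib (pt v s) (pt w t)"
    then have "fib v (pt w t)" using fib_trans[OF KV[OF vw(1)] ptV[OF vw(1)] ptV[OF vw(2)] ptf[OF vw(1)]] by blast
    then have "fib v w"
      using fib_trans[OF KV[OF vw(1)] ptV[OF vw(2)] KV[OF vw(2)]] fib_sym[OF KV[OF vw(2)] ptV[OF vw(2)]]
        ptf[OF vw(2)] by blast
    then show "v = w" using Kfib vw by blast
  next
    assume "v = w"
    then show "fib (pt v s) (pt w t)"
      using fib_trans[OF ptV[OF vw(1)] KV[OF vw(1)] ptV[OF vw(1)]] fib_sym[OF KV[OF vw(1)] ptV[OF vw(1)]]
        ptf[OF vw(1)] by blast
  qed
  have pt_inj: "s = t" if "v \<in> K" "s \<in> ?L" "t \<in> ?L" "pt v s = pt v t" for v s t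
  proof (cases "v = x0")
    case True
    then have "\<beta> s = \<beta> t" using that(4) by (simp only: ptx)
    then show ?thesis using \<beta>inj that(2,3) by blast
  next
    case False
    have base_rel: "r (pt v u) (\<beta> u) = Cone 0" for u
      using pt[OF that(1) False, of u] sym[OF \<beta>V ptV[OF that(1)], of u u] by simp
    have "r (pt v s) (\<beta> s) = Cone 0" "r (pt v s) (\<beta> t) = Cone 0"
      using base_rel[of s] base_rel[of t] unfolding that(4) by blast+
    then have "\<beta> s = \<beta> t" using cone_unique[OF ptV[OF that(1)] \<beta>V \<beta>V] \<beta>fib by blast
    then show ?thesis using \<beta>inj that by blast
  qed
  have "inj_on (case_prod pt) (K \<times> ?L)"
  proof (rule inj_onI, clarify)
    fix v s w t
    assume *: "v \<in> K" "w \<in> K" "s \<in> ?L" "t \<in> ?L" "pt v s = pt w t"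
    then have "v = w" using pt_fib[of v w s t] fib_refl[OF ptV[OF *(1)]] by metis
    then show "v = w \<and> s = t" using pt_inj * by blast
  qed
  moreover have "case_prod pt ` (K \<times> ?L) \<subseteq> V" using ptV by auto
  moreover have "card (K \<times> ?L) = card V" using cardK card_V by (simp add: card_cartesian_product)
  ultimately have "bij_betw (case_prod pt) (K \<times> ?L) V"
    unfolding bij_betw_def using card_subset_eq[OF fin] card_image by metis
  then have "labelled_config3 V r K x0 pt"
    using finK cardK pt_fib pt ptx
    by unfold_locales (auto simp: K_def)
  then show ?thesis by blast
qed

context labelled_config3
begin

abbreviation "L \<equiv> {0, 1, 2 :: int}"

lemma pt_in_V: "v \<in> K \<Longrightarrow> t \<in> L \<Longrightarrow> pt v t \<in> V"
  using bij_betwE[OF pt_bij] by auto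

lemma pt_eq_iff: "v \<in> K \<Longrightarrow> w \<in> K \<Longrightarrow> s \<in> L \<Longrightarrow> t \<in> L \<Longrightarrow> pt v s = pt w t \<longleftrightarrow> v = w \<and> s = t"
  using bij_betw_imp_inj_on[OF pt_bij] unfolding inj_on_def by force

text \<open>For two different fibres this table is a Latin square, since cones meet fibres in single
  points.\<close>

definition F :: "'v \<Rightarrow> 'v \<Rightarrow> int \<Rightarrow> int \<Rightarrow> int" where
  "F v w s t = cone_value (r (pt v s) (pt w t))"

lemma r_pt:
  assumes "v \<in> K" "w \<in> K" "s \<in> L" "t \<in> L" "v \<noteq> w"
  shows "r (pt v s) (pt w t) = Cone (F v w s t)"
proof -
  obtain c where "r (pt v s) (pt w t) = Cone c"
    using pt_fib[of v w s t] assms not_fib_iff by blast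
  then show ?thesis by (simp add: F_def)
qed

lemma F_range: "v \<in> K \<Longrightarrow> w \<in> K \<Longrightarrow> s \<in> L \<Longrightarrow> t \<in> L \<Longrightarrow> v \<noteq> w \<Longrightarrow> F v w s t \<in> L"
  using range[OF pt_in_V pt_in_V r_pt] by blast

lemma F_sym:
  assumes "v \<in> K" "w \<in> K" "s \<in> L" "t \<in> L" "v \<noteq> w"
  shows "F w v t s = (- F v w s t) mod 3"
  using sym[OF pt_in_V[OF assms(1,3)] pt_in_V[OF assms(2,4)]]
  unfolding r_pt[OF assms] r_pt[OF assms(2,1,4,3) assms(5)[symmetric]] by simp

lemma F_row_inj: "v \<in> K \<Longrightarrow> w \<in> K \<Longrightarrow> s \<in> L \<Longrightarrow> v \<noteq> w \<Longrightarrow> inj_on (F v w s) L"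
proof (rule inj_onI)
  fix t t' assume *: "v \<in> K" "w \<in> K" "s \<in> L" "v \<noteq> w" "t \<in> L" "t' \<in> L" "F v w s t = F v w s t'"
  have "pt w t = pt w t'"
    by (rule cone_unique[OF pt_in_V[OF *(1,3)] pt_in_V[OF *(2,5)] pt_in_V[OF *(2,6)] r_pt[OF *(1,2,3,5,4)]])
      (use r_pt[OF *(1,2,3,6,4)] *(7) pt_fib[OF *(2,2,5,6)] in simp_all)
  then show "t = t'" using pt_eq_iff * by blast
qed

lemma F_col_inj: "v \<in> K \<Longrightarrow> w \<in> K \<Longrightarrow> t \<in> L \<Longrightarrow> v \<noteq> w \<Longrightarrow> inj_on (\<lambda>s. F v w s t) L"
  using F_row_inj[of w v t] F_sym[of v w _ t] unfolding inj_on_def by metis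

lemma F_base: "w \<in> K \<Longrightarrow> w \<noteq> x0 \<Longrightarrow> t \<in> L \<Longrightarrow> F x0 w t t = 0"
  using pt_base by (simp add: F_def)

text \<open>Fibres are counted in place of midpoints: each fibre contains at most one midpoint
  because the rows of \<open>F\<close> are injective, and the fibres of the endpoints contain
  none.\<close>

lemma card_F_paths:
  assumes uv: "u \<in> K" "v \<in> K" "u \<noteq> v" and st: "s \<in> L" "t \<in> L" and ab: "a \<in> L" "b \<in> L"
  shows "card {w \<in> K - {u, v}. \<exists>p\<in>L. F u w s p = a \<and> F w v p t = b} = paths3 a b (F u v s t)"
proof -
  let ?x = "pt u s" and ?y = "pt v t"
  let ?Z = "{z \<in> V. r ?x z = Cone a \<and> r z ?y = Cone b}"
  let ?P = "{(w, p). w \<in> K - {u, v} \<and> p \<in> L \<and> F u w s p = a \<and> F w v p t = b}"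
  have rel: "pt w p \<in> ?Z \<longleftrightarrow> (w, p) \<in> ?P" if wp: "w \<in> K" "p \<in> L" for w p
  proof (cases "w = u \<or> w = v")
    case True
    then have "fib ?x (pt w p) \<or> fib (pt w p) ?y" using pt_fib uv st wp by blast
    then show ?thesis using True unfolding fib_def by auto
  next
    case False
    then show ?thesis using r_pt[of u w s p] r_pt[of w v p t] uv st wp pt_in_V by auto
  qed
  have "?Z = case_prod pt ` ?P"
  proof
    show "?Z \<subseteq> case_prod pt ` ?P"
    proof
      fix z assume z: "z \<in> ?Z"
      then have "z \<in> case_prod pt ` (K \<times> L)" using pt_bij unfolding bij_betw_def by blast
      then obtain w p where "w \<in> K" "p \<in> L" "z = pt w p" by auto
      then show "z \<in> case_prod pt ` ?P" using rel[of w p] z by force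
    qed
    show "case_prod pt ` ?P \<subseteq> ?Z" using rel by auto
  qed
  moreover have "inj_on (case_prod pt) ?P"
    using bij_betw_imp_inj_on[OF pt_bij] by (rule inj_on_subset) auto
  ultimately have "card ?Z = card ?P" by (simp add: card_image)
  moreover have "{w \<in> K - {u, v}. \<exists>p\<in>L. F u w s p = a \<and> F w v p t = b} = fst ` ?P" (is "?W = _")
  proof
    show "?W \<subseteq> fst ` ?P"
    proof
      fix w assume "w \<in> ?W"
      then obtain p where "(w, p) \<in> ?P" by blast
      then show "w \<in> fst ` ?P" by (rule image_eqI[rotated]) simp
    qed
    show "fst ` ?P \<subseteq> ?W"
    proof (rule image_subsetI)
      fix x assume x: "x \<in> ?P"
      obtain w p where wp: "x = (w, p)" by (metis prod.collapse)
      then have "w \<in> ?W" using x by blast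
      then show "fst x \<in> ?W" by (simp only: wp fst_conv)
    qed
  qed
  moreover have "inj_on fst ?P"
  proof (rule inj_onI)
    fix x y assume *: "x \<in> ?P" "y \<in> ?P" "fst x = fst y"
    then obtain w p p' where xy: "x = (w, p)" "y = (w, p')" by (metis prod.collapse)
    then have "p = p'" using * F_row_inj[of u w s] uv st by (auto dest: inj_onD)
    then show "x = y" using xy by simp
  qed
  ultimately show ?thesis
    using cone_cone[OF pt_in_V[OF uv(1) st(1)] pt_in_V[OF uv(2) st(2)] ab r_pt[OF uv(1,2) st uv(3)]]
    by (simp add: card_image)
qed

end

section \<open>Multipliers and shifts between fibres\<close>

lemma mod_3_solve:
  fixes s p a k n :: int
  assumes "n \<in> {1, 2}" "p \<in> {0, 1, 2}" "a \<in> {0, 1, 2}"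
  shows "(n * (p - s - k)) mod 3 = a \<longleftrightarrow> p = (s + k + a * n) mod 3"
proof -
  have nn: "3 dvd n * n - 1" using assms(1) by auto
  have "(n * (p - s - k)) mod 3 = a \<longleftrightarrow> 3 dvd n * (p - s - k) - a"
    using assms(3) mod_eq_dvd_iff[of "n * (p - s - k)" 3 a] by auto
  also have "\<dots> \<longleftrightarrow> 3 dvd p - (s + k + a * n)"
  proof
    assume "3 dvd n * (p - s - k) - a"
    then have "3 dvd n * (n * (p - s - k) - a)" by (rule dvd_mult)
    moreover have "3 dvd (n * n - 1) * (p - s - k)" using nn by (rule dvd_mult2)
    ultimately have "3 dvd n * (n * (p - s - k) - a) - (n * n - 1) * (p - s - k)" by (rule dvd_diff)
    then show "3 dvd p - (s + k + a * n)" by (simp add: algebra_simps)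
  next
    assume "3 dvd p - (s + k + a * n)"
    then have "3 dvd n * (p - (s + k + a * n))" by (rule dvd_mult)
    moreover have "3 dvd a * (n * n - 1)" using nn by (rule dvd_mult)
    ultimately have "3 dvd n * (p - (s + k + a * n)) + a * (n * n - 1)" by (rule dvd_add)
    then show "3 dvd n * (p - s - k) - a" by (simp add: algebra_simps)
  qed
  also have "\<dots> \<longleftrightarrow> p = (s + k + a * n) mod 3"
    using assms(2) mod_eq_dvd_iff[of p 3 "s + k + a * n"] by auto
  finally show ?thesis .
qed

lemma card_neq_0_if_mem: "finite A \<Longrightarrow> x \<in> A \<Longrightarrow> card A \<noteq> 0"
  by auto

lemma bex_determined:
  "(\<And>p. p \<in> A \<Longrightarrow> P p \<longleftrightarrow> p = c) \<Longrightarrow> c \<in> A \<Longrightarrow> (\<exists>p\<in>A. P p \<and> Q p) \<longleftrightarrow> Q c"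
  by blast

lemma mod_3_range: "x mod 3 \<in> {0, 1, 2 :: int}"
  using pos_mod_sign[of 3 x] pos_mod_bound[of 3 x] by auto

lemma mod_3_affine_unique:
  fixes A A' k k' :: int
  assumes "A \<in> {1, 2}" "A' \<in> {1, 2}" "k \<in> {0, 1, 2}" "k' \<in> {0, 1, 2}"
    and "(A * (0 - k)) mod 3 = (A' * (0 - k')) mod 3" "(A * (1 - k)) mod 3 = (A' * (1 - k')) mod 3"
  shows "A = A' \<and> k = k'"
  using assms by (elim insertE emptyE; simp)

lemma mod_3_neg_iff:
  fixes j \<kappa> l :: int
  assumes "j \<in> {1, 2}" "\<kappa> \<in> {0, 1, 2}" "l \<in> {0, 1, 2}"
  shows "(- j * \<kappa>) mod 3 = (- j * l) mod 3 \<longleftrightarrow> \<kappa> = l" "(- j * l) mod 3 = 0 \<longleftrightarrow> l = 0"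
  using assms by (elim insertE emptyE; simp)+

context labelled_config3
begin

lemma F_affine:
  assumes "v \<in> K" "w \<in> K" "v \<noteq> w"
  shows "\<exists>A B C. A \<in> {1, 2} \<and> B \<in> {1, 2} \<and> C \<in> L \<and> (\<forall>s\<in>L. \<forall>t\<in>L. F v w s t = (A * t + B * s + C) mod 3)"
proof -
  have range: "F v w s t \<in> L" if "s \<in> L" "t \<in> L" for s t
    by (rule F_range[OF assms(1,2) that assms(3)])
  have row: "inj_on (F v w s) L" if "s \<in> L" for s
    by (rule F_row_inj[OF assms(1,2) that assms(3)])
  have col: "inj_on (\<lambda>s. F v w s t) L" if "t \<in> L" for t
    by (rule F_col_inj[OF assms(1,2) that assms(3)])
  show ?thesis
  proof (rule latin_square_3[of "F v w", OF range row col])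
    fix A B C
    assume "A \<in> {1, 2}" "B \<in> {1, 2}" "C \<in> L"
      "\<And>s t. s \<in> L \<Longrightarrow> t \<in> L \<Longrightarrow> F v w s t = (A * t + B * s + C) mod 3"
    then show ?thesis by (intro exI[of _ A] exI[of _ B] exI[of _ C] conjI ballI)
  qed
qed

text \<open>The labels make the table vanish on the diagonal, which forces C = 0 and B = - A modulo
  3.\<close>

lemma F_from_base:
  assumes "w \<in> K" "w \<noteq> x0"
  shows "\<exists>A. A \<in> {1, 2} \<and> (\<forall>s\<in>L. \<forall>t\<in>L. F x0 w s t = (A * (t - s)) mod 3)"
proof -
  obtain A B C where ABC: "A \<in> {1, 2}" "B \<in> {1, 2}" "C \<in> L"
    and F: "\<And>s t. s \<in> L \<Longrightarrow> t \<in> L \<Longrightarrow> F x0 w s t = (A * t + B * s + C) mod 3"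
    using F_affine[OF K(3) assms(1) assms(2)[symmetric]] by blast
  have "C mod 3 = 0" "(A + B + C) mod 3 = 0"
    using F[of 0 0] F[of 1 1] F_base[OF assms, of 0] F_base[OF assms, of 1] by simp_all
  then have C0: "C = 0" and B3: "B = 3 - A" using ABC by auto
  have "A * t + B * s + C = A * (t - s) + 3 * s" for s t
    unfolding B3 C0 by (simp add: algebra_simps)
  then have "(A * t + B * s + C) mod 3 = (A * (t - s)) mod 3" for s t
    by (simp only: mod_mult_self2)
  then show ?thesis using ABC(1) F by metis
qed

text \<open>Walks from the base fibre to that of \<open>v\<close> satisfy the hypotheses of
  \<open>third_point_types\<close>. The type of \<open>w0\<close> occurs, so its count is not 0, and
  this forces B = - A modulo 3: the table depends only on t - s.\<close>

lemma F_good: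
  assumes v: "v \<in> K" "v \<noteq> x0" and w0: "w0 \<in> K" "w0 \<noteq> x0" "w0 \<noteq> v"
  shows "\<exists>A k. A \<in> {1, 2} \<and> k \<in> L \<and> (\<forall>s\<in>L. \<forall>t\<in>L. F w0 v s t = (A * (t - s - k)) mod 3)"
proof -
  let ?J = "K - {x0, v}"
  have "\<forall>w\<in>K - {x0}. \<exists>A. A \<in> {1, 2} \<and> (\<forall>s\<in>L. \<forall>t\<in>L. F x0 w s t = (A * (t - s)) mod 3)"
    using F_from_base by (intro ballI) (elim DiffE, simp only: singleton_iff not_False_eq_True)
  from bchoice[OF this] obtain n where n: "\<forall>w\<in>K - {x0}. n w \<in> {1, 2} \<and> (\<forall>s\<in>L. \<forall>t\<in>L. F x0 w s t = (n w * (t - s)) mod 3)"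
    by (elim exE)
  have n0: "F x0 w s t = (n w * (t - s)) mod 3" if "w \<in> K - {x0}" "s \<in> L" "t \<in> L" for w s t
    using bspec[OF conjunct2[OF bspec[OF n that(1)]] that(2)] that(3) by (rule bspec)
  have "\<forall>w\<in>?J. \<exists>c. fst c \<in> {1, 2} \<and> fst (snd c) \<in> {1, 2} \<and> snd (snd c) \<in> L \<and>
      (\<forall>s\<in>L. \<forall>t\<in>L. F w v s t = (fst c * t + fst (snd c) * s + snd (snd c)) mod 3)"
  proof
    fix w assume "w \<in> ?J"
    then obtain A B C where "A \<in> {1, 2}" "B \<in> {1, 2}" "C \<in> L"
      "\<forall>s\<in>L. \<forall>t\<in>L. F w v s t = (A * t + B * s + C) mod 3"
      using F_affine[of w v] v(1) by blast
    then show "\<exists>c. fst c \<in> {1, 2} \<and> fst (snd c) \<in> {1, 2} \<and> snd (snd c) \<in> L \<and>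
      (\<forall>s\<in>L. \<forall>t\<in>L. F w v s t = (fst c * t + fst (snd c) * s + snd (snd c)) mod 3)"
      by (intro exI[of _ "(A, B, C)"]) (simp only: fst_conv snd_conv simp_thms)
  qed
  from bchoice[OF this] obtain c where c: "\<forall>w\<in>?J. fst (c w) \<in> {1, 2} \<and> fst (snd (c w)) \<in> {1, 2} \<and> snd (snd (c w)) \<in> L \<and>
      (\<forall>s\<in>L. \<forall>t\<in>L. F w v s t = (fst (c w) * t + fst (snd (c w)) * s + snd (snd (c w))) mod 3)" by blast
  define A B C where "A w = fst (c w)" and "B w = fst (snd (c w))" and "C w = snd (snd (c w))" for w
  have types: "n w \<in> {1, 2} \<and> A w \<in> {1, 2} \<and> B w \<in> {1, 2} \<and> C w \<in> L" if "w \<in> ?J" for w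
    using n c that unfolding A_def B_def C_def by blast
  have F: "F w v s t = (A w * t + B w * s + C w) mod 3" if "w \<in> ?J" "s \<in> L" "t \<in> L" for w s t
    using c that unfolding A_def B_def C_def by blast
  have count: "card {w \<in> ?J. (A w * t + B w * (s + a * n w) + C w) mod 3 = b} = paths3 a b ((n v * (t - s)) mod 3)"
    if st: "s \<in> L" "t \<in> L" and ab: "a \<in> L" "b \<in> L" for s t a b
  proof -
    have "(\<exists>p\<in>L. F x0 w s p = a \<and> F w v p t = b) \<longleftrightarrow> (A w * t + B w * (s + a * n w) + C w) mod 3 = b"
      if w: "w \<in> ?J" for w
    proof -
      have in3: "(s + a * n w) mod 3 \<in> L" by (rule mod_3_range)
      have "F x0 w s p = a \<longleftrightarrow> p = (s + a * n w) mod 3" if "p \<in> L" for p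
      proof -
        have nw: "n w \<in> {1, 2}" using types[OF w] by (rule conjunct1)
        have "F x0 w s p = (n w * (p - s)) mod 3" by (rule n0[OF _ st(1) that]) (use w in blast)
        then show ?thesis using mod_3_solve[OF nw that ab(1), of s 0] by (simp only: diff_zero add_0_right)
      qed
      then have "(\<exists>p\<in>L. F x0 w s p = a \<and> F w v p t = b) \<longleftrightarrow> F w v ((s + a * n w) mod 3) t = b"
        by (rule bex_determined[OF _ in3])
      also have "F w v ((s + a * n w) mod 3) t = (A w * t + B w * (s + a * n w) + C w) mod 3"
        unfolding F[OF w in3 st(2)] by (intro mod_add_cong mod_mult_cong) simp_all
      finally show ?thesis .
    qed
    then have "{w \<in> ?J. (A w * t + B w * (s + a * n w) + C w) mod 3 = b} =
        {w \<in> ?J. \<exists>p\<in>L. F x0 w s p = a \<and> F w v p t = b}" by blast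
    moreover have "F x0 v s t = (n v * (t - s)) mod 3" by (rule n0[OF _ st]) (use v in blast)
    ultimately show ?thesis
      using card_F_paths[OF K(3) v(1) v(2)[symmetric] st ab] by simp
  qed
  have w0J: "w0 \<in> ?J" using w0 by blast
  have J7: "card ?J = 7" using K v by (simp add: card_Diff_subset)
  have "card {w \<in> ?J. n w = n w0 \<and> A w = A w0 \<and> B w = B w0 \<and> C w = C w0} =
      of_bool (B w0 = 3 - A w0 \<and> (C w0 = 0 \<longleftrightarrow> n w0 = n v \<and> A w0 = n v))"
  proof (rule third_point_types[OF _ _ types _ count])
    show "finite ?J" using K(1) by simp
    show "card ?J = 7" by (rule J7)
    show "n v \<in> {1, 2}" using n v by blast
  qed (use types[OF w0J] in \<open>simp_all only: simp_thms\<close>)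
  moreover have "w0 \<in> {w \<in> ?J. n w = n w0 \<and> A w = A w0 \<and> B w = B w0 \<and> C w = C w0}" using w0J by blast
  then have "card {w \<in> ?J. n w = n w0 \<and> A w = A w0 \<and> B w = B w0 \<and> C w = C w0} \<noteq> 0"
    by (rule card_neq_0_if_mem[rotated]) (use K(1) in simp)
  ultimately have B: "B w0 = 3 - A w0" by (cases "B w0 = 3 - A w0") simp_all
  \<comment> \<open>Since A^2 = 1 modulo 3, this choice gives A (t - s - k) = A t - A s + C.\<close>
  define k where "k = (- A w0 * C w0) mod 3"
  have "F w0 v s t = (A w0 * (t - s - k)) mod 3" if "s \<in> L" "t \<in> L" for s t
  proof -
    have "3 dvd A w0 * A w0 - 1" using types[OF w0J] by auto
    then obtain z where z: "A w0 * A w0 - 1 = 3 * z" by (rule dvdE)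
    have "(A w0 * (t - s - k)) mod 3 = (A w0 * (t - s - (- A w0 * C w0))) mod 3"
      unfolding k_def by (intro mod_mult_cong mod_diff_cong) simp_all
    also have "A w0 * (t - s - (- A w0 * C w0)) = A w0 * t - A w0 * s + C w0 + (A w0 * A w0 - 1) * C w0"
      by (simp add: algebra_simps)
    also have "\<dots> = (A w0 * t + (3 - A w0) * s + C w0) + 3 * (z * C w0 - s)"
      unfolding z by (simp add: algebra_simps)
    also have "((A w0 * t + (3 - A w0) * s + C w0) + 3 * (z * C w0 - s)) mod 3 =
      (A w0 * t + (3 - A w0) * s + C w0) mod 3" by (rule mod_mult_self2)
    finally show ?thesis unfolding F[OF w0J that] B by simp
  qed
  then have "\<forall>s\<in>L. \<forall>t\<in>L. F w0 v s t = (A w0 * (t - s - k)) mod 3" by (intro ballI)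
  moreover have "k \<in> L" unfolding k_def by (rule mod_3_range)
  moreover have "A w0 \<in> {1, 2}" using types[OF w0J] by (elim conjE)
  ultimately show ?thesis by (intro exI[of _ "A w0"] exI[of _ k] conjI)
qed

lemma F_form:
  assumes "v \<in> K" "w \<in> K" "v \<noteq> w"
  shows "\<exists>A k. A \<in> {1, 2} \<and> k \<in> L \<and> (\<forall>s\<in>L. \<forall>t\<in>L. F v w s t = (A * (t - s - k)) mod 3)"
proof -
  consider "v = x0" | "w = x0" | "v \<noteq> x0" "w \<noteq> x0" by blast
  then show ?thesis
  proof cases
    case 1
    then obtain A where "A \<in> {1, 2}" "\<forall>s\<in>L. \<forall>t\<in>L. F v w s t = (A * (t - s)) mod 3"
      using F_from_base[OF assms(2)] assms(3) by blast
    then have "A \<in> {1, 2}" "0 \<in> L" "\<forall>s\<in>L. \<forall>t\<in>L. F v w s t = (A * (t - s - 0)) mod 3"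
      by (simp_all only: diff_zero insertI1)
    then show ?thesis by blast
  next
    case 2
    then obtain A where A: "A \<in> {1, 2}" "\<forall>s\<in>L. \<forall>t\<in>L. F w v s t = (A * (t - s)) mod 3"
      using F_from_base[OF assms(1)] assms(3) by blast
    have "F v w s t = (A * (t - s - 0)) mod 3" if "s \<in> L" "t \<in> L" for s t
    proof -
      have "F v w s t = (- ((A * (s - t)) mod 3)) mod 3"
        using F_sym[OF assms(2,1) that(2,1)] assms(3) A(2) that by metis
      also have "\<dots> = (- (A * (s - t))) mod 3" by (rule mod_minus_eq)
      finally show ?thesis by (simp add: algebra_simps)
    qed
    then show ?thesis using A(1) by blast
  next
    case 3
    then show ?thesis using F_good[of w v] assms by blast
  qed
qed

end

text \<open>In the Heisenberg model \<open>m\<close> is the norm of the difference of base points,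
  equal to its inverse modulo 3, and \<open>k\<close> is the symplectic form up to sign.\<close>

locale affine_config3 = labelled_config3 V r K x0 pt
  for V :: "'v set" and r K x0 pt +
  fixes m k :: "'v \<Rightarrow> 'v \<Rightarrow> int"
  assumes mk: "v \<in> K \<Longrightarrow> w \<in> K \<Longrightarrow> v \<noteq> w \<Longrightarrow> m v w \<in> {1, 2} \<and> k v w \<in> {0, 1, 2} \<and>
    (\<forall>s\<in>{0, 1, 2}. \<forall>t\<in>{0, 1, 2}. F v w s t = (m v w * (t - s - k v w)) mod 3)"

lemma (in labelled_config3) affine_exists: "\<exists>m k. affine_config3 V r K x0 pt m k"
proof -
  have "\<forall>v w. \<exists>c. v \<in> K \<and> w \<in> K \<and> v \<noteq> w \<longrightarrow> fst c \<in> {1, 2} \<and> snd c \<in> L \<and>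
    (\<forall>s\<in>L. \<forall>t\<in>L. F v w s t = (fst c * (t - s - snd c)) mod 3)"
  proof (intro allI)
    fix v w
    show "\<exists>c. v \<in> K \<and> w \<in> K \<and> v \<noteq> w \<longrightarrow> fst c \<in> {1, 2} \<and> snd c \<in> L \<and>
      (\<forall>s\<in>L. \<forall>t\<in>L. F v w s t = (fst c * (t - s - snd c)) mod 3)"
      using F_form[of v w] by (metis fst_conv snd_conv)
  qed
  then obtain c where c: "\<And>v w. v \<in> K \<and> w \<in> K \<and> v \<noteq> w \<longrightarrow> fst (c v w) \<in> {1, 2} \<and> snd (c v w) \<in> L \<and>
    (\<forall>s\<in>L. \<forall>t\<in>L. F v w s t = (fst (c v w) * (t - s - snd (c v w))) mod 3)" by metis
  have "affine_config3 V r K x0 pt (\<lambda>v w. fst (c v w)) (\<lambda>v w. snd (c v w))"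
    by unfold_locales (use c in blast)
  then show ?thesis by blast
qed

context affine_config3
begin

lemma m_range: "v \<in> K \<Longrightarrow> w \<in> K \<Longrightarrow> v \<noteq> w \<Longrightarrow> m v w \<in> {1, 2}"
  and k_range: "v \<in> K \<Longrightarrow> w \<in> K \<Longrightarrow> v \<noteq> w \<Longrightarrow> k v w \<in> L"
  and F_eq: "v \<in> K \<Longrightarrow> w \<in> K \<Longrightarrow> v \<noteq> w \<Longrightarrow> s \<in> L \<Longrightarrow> t \<in> L \<Longrightarrow> F v w s t = (m v w * (t - s - k v w)) mod 3"
  using mk by blast+

text \<open>A map t -> A (t - k) with A nonzero is determined modulo 3 by its values at 0 and 1, so
  the reversal rule for cones passes to \<open>m\<close> and \<open>k\<close>.\<close>

lemma m_k_sym: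
  assumes "v \<in> K" "w \<in> K" "v \<noteq> w"
  shows "m w v = m v w \<and> k w v = (- k v w) mod 3"
proof -
  have "(m w v * (t - k w v)) mod 3 = (m v w * (t - (- k v w) mod 3)) mod 3" if "t \<in> {0, 1}" for t
  proof -
    have t: "t \<in> L" using that by blast
    have 0: "0 \<in> L" by blast
    have "(m w v * (t - 0 - k w v)) mod 3 = (- ((m v w * (0 - t - k v w)) mod 3)) mod 3"
      using F_sym[OF assms(1,2) t 0 assms(3)]
      unfolding F_eq[OF assms t 0] F_eq[OF assms(2,1) assms(3)[symmetric] 0 t] .
    also have "\<dots> = (m v w * (t - (- k v w))) mod 3"
      unfolding mod_minus_eq by (simp add: algebra_simps)
    also have "\<dots> = (m v w * (t - (- k v w) mod 3)) mod 3"
      by (intro mod_mult_cong mod_diff_cong) simp_all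
    finally show ?thesis by simp
  qed
  note eq = this
  have "(- k v w) mod 3 \<in> L" by (rule mod_3_range)
  then show ?thesis
    by (rule mod_3_affine_unique[OF m_range[OF assms(2,1) assms(3)[symmetric]] m_range[OF assms]
          k_range[OF assms(2,1) assms(3)[symmetric]] _ eq[of 0] eq[of 1]]) simp_all
qed

lemma k_base: "w \<in> K \<Longrightarrow> w \<noteq> x0 \<Longrightarrow> k x0 w = 0"
  using F_base[of w 0] F_eq[of x0 w 0 0] m_range[of x0 w] k_range[of x0 w] K(3) by auto

text \<open>\<open>third_point_types\<close> for arbitrary fibres, after shifting the label in
  \<open>v\<close> by \<open>k u v\<close>. The combination k u w + k w v - k u v does not change
  when the labels of a fibre are shifted; it acts as the oriented area of the triangle u, w,
  v.\<close>

lemma third_points: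
  assumes uv: "u \<in> K" "v \<in> K" "u \<noteq> v" and ij: "i \<in> {1, 2}" "j \<in> {1, 2}" and l: "l \<in> L"
  shows "card {w \<in> K - {u, v}. m u w = i \<and> m w v = j \<and> (k u w + k w v - k u v) mod 3 = l} =
    of_bool (l = 0 \<longleftrightarrow> i = m u v \<and> j = m u v)"
proof -
  let ?J = "K - {u, v}"
  define \<kappa> where "\<kappa> w = (k u w + k w v - k u v) mod 3" for w
  define C where "C w = (- m w v * \<kappa> w) mod 3" for w
  have \<kappa>: "\<kappa> w \<in> L" for w unfolding \<kappa>_def by (rule mod_3_range)
  have mJ: "m u w \<in> {1, 2}" "m w v \<in> {1, 2}" if "w \<in> ?J" for w using m_range uv that by blast+
  have types: "m u w \<in> {1, 2} \<and> m w v \<in> {1, 2} \<and> 3 - m w v \<in> {1, 2} \<and> C w \<in> L" if "w \<in> ?J" for w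
  proof -
    have "C w \<in> L" unfolding C_def by (rule mod_3_range)
    then show ?thesis using mJ[OF that] by auto
  qed
  have count: "card {w \<in> ?J. (m w v * t + (3 - m w v) * (s + a * m u w) + C w) mod 3 = b} =
      paths3 a b ((m u v * (t - s)) mod 3)"
    if st: "s \<in> L" "t \<in> L" and ab: "a \<in> L" "b \<in> L" for s t a b
  proof -
    let ?t = "(t + k u v) mod 3"
    have t: "?t \<in> L" by (rule mod_3_range)
    have "(\<exists>p\<in>L. F u w s p = a \<and> F w v p ?t = b) \<longleftrightarrow>
        (m w v * t + (3 - m w v) * (s + a * m u w) + C w) mod 3 = b" if w: "w \<in> ?J" for w
    proof -
      let ?p = "(s + k u w + a * m u w) mod 3"
      have p: "?p \<in> L" by (rule mod_3_range)
      have w': "w \<in> K" "u \<noteq> w" "w \<noteq> v" using w by blast+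
      have "F u w s p = a \<longleftrightarrow> p = ?p" if "p \<in> L" for p
        unfolding F_eq[OF uv(1) w'(1,2) st(1) that] by (rule mod_3_solve[OF mJ(1)[OF w] that ab(1)])
      then have "(\<exists>p\<in>L. F u w s p = a \<and> F w v p ?t = b) \<longleftrightarrow> F w v ?p ?t = b"
        by (rule bex_determined[OF _ p])
      also have "F w v ?p ?t = (m w v * (?t - ?p - k w v)) mod 3"
        by (rule F_eq[OF w'(1) uv(2) w'(3) p t])
      also have "\<dots> = (m w v * ((t + k u v) - (s + k u w + a * m u w) - k w v)) mod 3"
        by (intro mod_mult_cong mod_diff_cong) simp_all
      also have "m w v * ((t + k u v) - (s + k u w + a * m u w) - k w v) =
        (m w v * t + (3 - m w v) * (s + a * m u w) + (- m w v * (k u w + k w v - k u v))) + 3 * (- (s + a * m u w))"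
        by (simp add: algebra_simps)
      also have "((m w v * t + (3 - m w v) * (s + a * m u w) + (- m w v * (k u w + k w v - k u v))) +
          3 * (- (s + a * m u w))) mod 3 =
        (m w v * t + (3 - m w v) * (s + a * m u w) + (- m w v * (k u w + k w v - k u v))) mod 3"
        by (rule mod_mult_self2)
      also have "\<dots> = (m w v * t + (3 - m w v) * (s + a * m u w) + C w) mod 3"
        unfolding C_def \<kappa>_def
        by (rule mod_add_cong[OF refl], simp only: mod_mod_trivial, rule mod_mult_cong) simp_all
      finally show ?thesis .
    qed
    then have "{w \<in> ?J. (m w v * t + (3 - m w v) * (s + a * m u w) + C w) mod 3 = b} =
        {w \<in> ?J. \<exists>p\<in>L. F u w s p = a \<and> F w v p ?t = b}" by blast
    moreover have "F u v s ?t = (m u v * (t - s)) mod 3"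
    proof -
      have "F u v s ?t = (m u v * (?t - s - k u v)) mod 3" by (rule F_eq[OF uv st(1) t])
      also have "\<dots> = (m u v * ((t + k u v) - s - k u v)) mod 3"
        by (intro mod_mult_cong mod_diff_cong) simp_all
      finally show ?thesis by simp
    qed
    ultimately show ?thesis using card_F_paths[OF uv st(1) t ab] by simp
  qed
  have J: "finite ?J" "card ?J = 7" using K uv by (simp_all add: card_Diff_subset)
  have "card {w \<in> ?J. m u w = i \<and> m w v = j \<and> 3 - m w v = 3 - j \<and> C w = (- j * l) mod 3} =
      of_bool (3 - j = 3 - j \<and> ((- j * l) mod 3 = 0 \<longleftrightarrow> i = m u v \<and> j = m u v))"
  proof (rule third_point_types[OF J types m_range[OF uv] count ij])
    show "3 - j \<in> {1, 2}" using ij(2) by auto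
    show "(- j * l) mod 3 \<in> L" by (rule mod_3_range)
  qed
  moreover have "{w \<in> ?J. m u w = i \<and> m w v = j \<and> 3 - m w v = 3 - j \<and> C w = (- j * l) mod 3} =
      {w \<in> ?J. m u w = i \<and> m w v = j \<and> \<kappa> w = l}"
    using mod_3_neg_iff(1)[OF ij(2) \<kappa> l] unfolding C_def by blast
  ultimately show ?thesis unfolding mod_3_neg_iff(2)[OF ij(2) l l] \<kappa>_def by simp
qed

end

text \<open>The affine plane of order 3: the points are \<open>0, \<plusminus>a, \<plusminus>b, P = -a-b, Q = b-a, R = a-b, S = a+b\<close>
  in this order.  \<open>mult_table\<close> describes the norm of the difference and \<open>shift_table\<close> the
  symplectic form.\<close>

definition mult_table :: "nat \<Rightarrow> nat \<Rightarrow> int" where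
  "mult_table i j =
    [[0, 1, 1, 1, 1, 2, 2, 2, 2],
     [1, 0, 1, 2, 2, 2, 2, 1, 1],
     [1, 1, 0, 2, 2, 1, 1, 2, 2],
     [1, 2, 2, 0, 1, 2, 1, 2, 1],
     [1, 2, 2, 1, 0, 1, 2, 1, 2],
     [2, 2, 1, 2, 1, 0, 1, 1, 2],
     [2, 2, 1, 1, 2, 1, 0, 2, 1],
     [2, 1, 2, 2, 1, 1, 2, 0, 1],
     [2, 1, 2, 1, 2, 2, 1, 1, 0]] ! i ! j"

definition shift_table :: "nat \<Rightarrow> nat \<Rightarrow> int" where
  "shift_table i j =
    [[0, 0, 0, 0, 0, 0, 0, 0, 0],
     [0, 0, 0, 1, 2, 2, 1, 2, 1],
     [0, 0, 0, 2, 1, 1, 2, 1, 2],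
     [0, 2, 1, 0, 0, 1, 1, 2, 2],
     [0, 1, 2, 0, 0, 2, 2, 1, 1],
     [0, 1, 2, 2, 1, 0, 1, 2, 0],
     [0, 2, 1, 2, 1, 2, 0, 0, 1],
     [0, 1, 2, 1, 2, 1, 0, 0, 2],
     [0, 2, 1, 1, 2, 0, 2, 1, 0]] ! i ! j"

definition standard_rel :: "nat \<times> int \<Rightarrow> nat \<times> int \<Rightarrow> int rel_type" where
  "standard_rel = (\<lambda>(i, s) (j, t). if i = j then if s = t then Same else Fibre
     else Cone ((mult_table i j * (t - s - shift_table i j)) mod 3))"

lemma nat_less_9: "(i::nat) < 9 \<longleftrightarrow> i \<in> {0, 1, 2, 3, 4, 5, 6, 7, 8}"
  by auto

lemma tables_sym:
  assumes "i < 9" "j < 9"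
  shows "mult_table j i = mult_table i j" "shift_table j i = (- shift_table i j) mod 3"
  using assms unfolding nat_less_9 mult_table_def shift_table_def
  by (elim insertE emptyE; hypsubst; simp)+

lemma sum_mod_3_cases:
  fixes x y :: int
  assumes "x \<in> {1, 2}" "y \<in> {1, 2}"
  shows "(1 + x - y) mod 3 = 0 \<Longrightarrow> x = 1 \<and> y = 2" "(2 + x - y) mod 3 = 0 \<Longrightarrow> x = 2 \<and> y = 1"
  using assms by auto

section \<open>Lines and areas in the plane of nine fibres\<close>

context affine_config3
begin

lemma m_sym: "v \<in> K \<Longrightarrow> w \<in> K \<Longrightarrow> v \<noteq> w \<Longrightarrow> m w v = m v w"
  using m_k_sym by blast

text \<open>Summation over the area: the pattern in which all multipliers agree occurs for area 0
  only, every other pattern once for each of the two nonzero areas.\<close>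

lemma third_point_cases:
  assumes uv: "u \<in> K" "v \<in> K" "u \<noteq> v" and ij: "i \<in> {1, 2}" "j \<in> {1, 2}"
  shows "card {w \<in> K - {u, v}. m u w = i \<and> m w v = j} = (if i = m u v \<and> j = m u v then 1 else 2)"
proof -
  let ?A = "{w \<in> K - {u, v}. m u w = i \<and> m w v = j}"
  let ?\<kappa> = "\<lambda>w. (k u w + k w v - k u v) mod 3"
  have "card ?A = (\<Sum>l\<in>L. card {w \<in> ?A. ?\<kappa> w = l})"
  proof (rule sum_card_fibres[symmetric])
    show "finite ?A" using K(1) by simp
    show "?\<kappa> ` ?A \<subseteq> L" by (rule image_subsetI, rule mod_3_range)
  qed simp
  also have "\<dots> = (\<Sum>l\<in>L. of_bool (l = 0 \<longleftrightarrow> i = m u v \<and> j = m u v))"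
  proof (rule sum.cong[OF refl])
    fix l assume l: "l \<in> L"
    have "{w \<in> ?A. ?\<kappa> w = l} = {w \<in> K - {u, v}. m u w = i \<and> m w v = j \<and> ?\<kappa> w = l}" by blast
    then show "card {w \<in> ?A. ?\<kappa> w = l} = of_bool (l = 0 \<longleftrightarrow> i = m u v \<and> j = m u v)"
      using third_points[OF uv ij l] by (simp only:)
  qed
  also have "\<dots> = (if i = m u v \<and> j = m u v then 1 else 2)" by simp
  finally show ?thesis .
qed

lemma third_point_unique:
  assumes "u \<in> K" "v \<in> K" "u \<noteq> v"
    and "w \<in> K - {u, v}" "m u w = m u v" "m w v = m u v"
    and "w' \<in> K - {u, v}" "m u w' = m u v" "m w' v = m u v"
  shows "w = w'"
proof -
  have "card {w \<in> K - {u, v}. m u w = m u v \<and> m w v = m u v} = 1"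
    using third_point_cases[OF assms(1-3) m_range[OF assms(1-3)] m_range[OF assms(1-3)]] by simp
  then obtain z where "{w \<in> K - {u, v}. m u w = m u v \<and> m w v = m u v} = {z}" by (rule card_1_singletonE)
  then have "w = z" "w' = z" using assms by blast+
  then show ?thesis by simp
qed

lemma third_point_exists:
  assumes "u \<in> K" "v \<in> K" "u \<noteq> v"
  obtains w where "w \<in> K - {u, v}" "m u w = m u v" "m w v = m u v"
proof -
  have "card {w \<in> K - {u, v}. m u w = m u v \<and> m w v = m u v} = 1"
    using third_point_cases[OF assms m_range[OF assms] m_range[OF assms]] by simp
  then obtain z where "{w \<in> K - {u, v}. m u w = m u v \<and> m w v = m u v} = {z}" by (rule card_1_singletonE)
  then show ?thesis using that by blast
qed

lemma third_point_second:
  assumes uv: "u \<in> K" "v \<in> K" "u \<noteq> v" and ij: "i \<in> {1, 2}" "j \<in> {1, 2}" "\<not> (i = m u v \<and> j = m u v)"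
    and w: "w \<in> K - {u, v}" "m u w = i" "m w v = j"
  obtains w' where "w' \<in> K - {u, v}" "m u w' = i" "m w' v = j" "w' \<noteq> w"
proof -
  have "card {w \<in> K - {u, v}. m u w = i \<and> m w v = j} = 2"
    using third_point_cases[OF uv ij(1,2)] ij(3) by simp
  then obtain x y where "{w \<in> K - {u, v}. m u w = i \<and> m w v = j} = {x, y}" "x \<noteq> y" by (auto simp: card_2_iff)
  then show ?thesis using that w by blast
qed

lemma no_three_third_points:
  assumes uv: "u \<in> K" "v \<in> K" "u \<noteq> v" and ij: "i \<in> {1, 2}" "j \<in> {1, 2}"
    and "\<And>w. w \<in> {x, y, z} \<Longrightarrow> w \<in> K - {u, v} \<and> m u w = i \<and> m w v = j"
    and "x \<noteq> y" "x \<noteq> z" "y \<noteq> z"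
  shows False
proof -
  have "{x, y, z} \<subseteq> {w \<in> K - {u, v}. m u w = i \<and> m w v = j}" using assms(6) by blast
  then have "card {x, y, z} \<le> card {w \<in> K - {u, v}. m u w = i \<and> m w v = j}"
    using K(1) by (intro card_mono) simp_all
  also have "\<dots> \<le> 2" unfolding third_point_cases[OF uv ij] by simp
  finally show False using assms(7-9) by simp
qed

text \<open>\<open>w\<close> itself shows that the count in \<open>third_points\<close> for its own
  pattern and area is not 0. The triples of area 0 are the lines of the affine plane.\<close>

lemma line_iff:
  assumes uv: "u \<in> K" "v \<in> K" "u \<noteq> v" and w: "w \<in> K - {u, v}"
  shows "(k u w + k w v - k u v) mod 3 = 0 \<longleftrightarrow> m u w = m u v \<and> m w v = m u v"
proof -
  let ?l = "(k u w + k w v - k u v) mod 3"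
  let ?A = "{z \<in> K - {u, v}. m u z = m u w \<and> m z v = m w v \<and> (k u z + k z v - k u v) mod 3 = ?l}"
  have ij: "m u w \<in> {1, 2}" "m w v \<in> {1, 2}" using m_range uv w by blast+
  have "w \<in> ?A" using w by blast
  then have "card ?A \<noteq> 0" by (rule card_neq_0_if_mem[rotated]) (use K(1) in simp)
  then show ?thesis
    unfolding third_points[OF uv ij mod_3_range] by (cases "?l = 0"; simp)
qed

text \<open>A given pattern with a given area occurs at most once.\<close>

lemma shifts_differ:
  assumes uv: "u \<in> K" "v \<in> K" "u \<noteq> v" and w: "w \<in> K - {u, v}" "w' \<in> K - {u, v}" "w \<noteq> w'"
    and "m u w = m u w'" "m w v = m w' v"
  shows "(k u w + k w v - k u v) mod 3 \<noteq> (k u w' + k w' v - k u v) mod 3"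
proof
  assume eq: "(k u w + k w v - k u v) mod 3 = (k u w' + k w' v - k u v) mod 3"
  let ?l = "(k u w + k w v - k u v) mod 3"
  let ?A = "{z \<in> K - {u, v}. m u z = m u w \<and> m z v = m w v \<and> (k u z + k z v - k u v) mod 3 = ?l}"
  have ij: "m u w \<in> {1, 2}" "m w v \<in> {1, 2}" using m_range uv w by blast+
  have "{w, w'} \<subseteq> ?A" using w eq assms(7,8) by simp
  then have "card {w, w'} \<le> card ?A" using K(1) by (intro card_mono) simp_all
  also have "\<dots> \<le> 1" unfolding third_points[OF uv ij mod_3_range] by simp
  finally show False using w(3) by simp
qed

lemma k_sym: "v \<in> K \<Longrightarrow> w \<in> K \<Longrightarrow> v \<noteq> w \<Longrightarrow> k w v = (- k v w) mod 3"
  using m_k_sym by blast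

text \<open>All shifts from \<open>x0\<close> vanish, so areas of triangles at \<open>x0\<close> are
  single shifts. The following lemmas are the area rules in this special case.\<close>

lemma base_shift:
  assumes "w \<in> K" "v \<in> K" "w \<noteq> x0" "v \<noteq> x0" "w \<noteq> v"
  shows "(k x0 w + k w v - k x0 v) mod 3 = k w v"
  using k_base assms k_range[OF assms(1,2,5)] by auto

lemma base_line:
  assumes "w \<in> K" "v \<in> K" "w \<noteq> x0" "v \<noteq> x0" "w \<noteq> v"
  shows "k w v = 0 \<longleftrightarrow> m x0 w = m x0 v \<and> m w v = m x0 v"
  using line_iff[of x0 v w] K(3) assms unfolding base_shift[OF assms] by simp

lemma base_shift_range:
  assumes "w \<in> K" "v \<in> K" "w \<noteq> x0" "v \<noteq> x0" "w \<noteq> v" "\<not> (m x0 w = m x0 v \<and> m w v = m x0 v)"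
  shows "k w v \<in> {1, 2}"
  using k_range[OF assms(1,2,5)] base_line[OF assms(1-5)] assms(6) by auto

lemma base_shifts_differ:
  assumes "w \<in> K" "w' \<in> K" "v \<in> K" "w \<noteq> x0" "w' \<noteq> x0" "v \<noteq> x0" "w \<noteq> v" "w' \<noteq> v" "w \<noteq> w'"
    and "m x0 w = m x0 w'" "m w v = m w' v"
  shows "k w v \<noteq> k w' v"
  using shifts_differ[of x0 v w w'] K(3) assms base_shift[of w v] base_shift[of w' v] by simp

text \<open>Once a point \<open>a\<close> of multiplier 1 is chosen, the rest is forced:
  \<open>c\<close> = -a is the third point of x0 and a, while \<open>b\<close> and \<open>d\<close>
  = -b are the other points of multiplier 1, ordered by k b a = 2, which orients the plane.
  Multipliers follow from uniqueness of third points and the bound two for a pattern, shifts from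
  zero area on lines and nonzero area off them.\<close>

lemma nine_points:
  obtains e :: "nat \<Rightarrow> 'v" where "bij_betw e {..<9} K"
    "\<And>i j. i < 9 \<Longrightarrow> j < 9 \<Longrightarrow> i \<noteq> j \<Longrightarrow> m (e i) (e j) = mult_table i j \<and> k (e i) (e j) = shift_table i j"
proof -
  have card_pos: "\<exists>w. w \<in> A" if "card A \<noteq> 0" for A :: "'v set"
    using that by (metis card.empty ex_in_conv)
  have x0: "x0 \<in> K" by (rule K(3))
  have "card (K - {x0}) = 8" using K by simp
  \<comment> \<open>An auxiliary point: it serves to show that some point has multiplier 1 from
    x0.\<close>
  then obtain v where v: "v \<in> K" "v \<noteq> x0" using card_pos[of "K - {x0}"] by auto
  have "card {w \<in> K - {x0, v}. m x0 w = 1 \<and> m w v = 1} \<noteq> 0"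
    using third_point_cases[OF x0 v(1) v(2)[symmetric], of 1 1] by simp
  then obtain a where aK: "a \<in> K" "x0 \<noteq> a" and m_x0_a [simp]: "m x0 a = 1"
    using card_pos[of "{w \<in> K - {x0, v}. m x0 w = 1 \<and> m w v = 1}"] by blast
  obtain c where "c \<in> K - {x0, a}" and m_x0_c [simp]: "m x0 c = 1" and m_c_a [simp]: "m c a = 1"
    using third_point_exists[OF x0 aK] unfolding m_x0_a by blast
  then have cK: "c \<in> K" "x0 \<noteq> c" "a \<noteq> c" by blast+
  have "card {w \<in> K - {x0, a}. m x0 w = 1 \<and> m w a = 2} = 2"
    using third_point_cases[OF x0 aK, of 1 2] m_x0_a by simp
  then obtain y z where yz: "{w \<in> K - {x0, a}. m x0 w = 1 \<and> m w a = 2} = {y, z}" "y \<noteq> z"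
    by (auto simp: card_2_iff)
  have yz': "y \<in> K" "x0 \<noteq> y" "a \<noteq> y" "m x0 y = 1" "m y a = 2" "z \<in> K" "x0 \<noteq> z" "a \<noteq> z" "m x0 z = 1" "m z a = 2"
    using yz(1) by blast+
  have "k y a \<in> {1, 2}"
    by (rule base_shift_range) (use yz' aK m_x0_a in auto)
  moreover have "k z a \<in> {1, 2}"
    by (rule base_shift_range) (use yz' aK m_x0_a in auto)
  moreover have "k y a \<noteq> k z a"
    by (rule base_shifts_differ) (use yz' aK yz(2) in auto)
  ultimately have "k y a = 2 \<and> k z a = 1 \<or> k z a = 2 \<and> k y a = 1" by auto
  then obtain b d where bd: "b = y \<and> d = z \<or> b = z \<and> d = y" and k_b_a [simp]: "k b a = 2" and k_d_a [simp]: "k d a = 1"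
    by blast
  have bd_set: "{y, z} = {b, d}" using bd by auto
  have bd_all: "b \<in> K \<and> x0 \<noteq> b \<and> a \<noteq> b \<and> m x0 b = 1 \<and> m b a = 2 \<and>
      d \<in> K \<and> x0 \<noteq> d \<and> a \<noteq> d \<and> m x0 d = 1 \<and> m d a = 2 \<and> b \<noteq> d"
    using bd
  proof
    assume "b = y \<and> d = z"
    then show ?thesis using yz' yz(2) by simp
  next
    assume "b = z \<and> d = y"
    then show ?thesis using yz' yz(2) by simp
  qed
  have bK: "b \<in> K" "x0 \<noteq> b" "a \<noteq> b" and m_x0_b [simp]: "m x0 b = 1" and m_b_a [simp]: "m b a = 2"
    and dK: "d \<in> K" "x0 \<noteq> d" "a \<noteq> d" and m_x0_d [simp]: "m x0 d = 1" and m_d_a [simp]: "m d a = 2"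
    and bd_ne: "b \<noteq> d"
    using bd_all by blast+
  have cb: "c \<noteq> b" and cd: "c \<noteq> d" using m_c_a m_b_a m_d_a by fastforce+
  \<comment> \<open>The multiplier to \<open>a\<close> decides: 1 leaves only the unique third point
    \<open>c\<close>, 2 leaves \<open>b\<close> and \<open>d\<close>.\<close>
  have plus: "w \<in> {a, c, b, d}" if "w \<in> K" "w \<noteq> x0" "m x0 w = 1" for w
  proof (cases "w = a")
    case False
    show ?thesis
    proof (cases "m w a = 1")
      case True
      have "w = c"
        by (rule third_point_unique[OF x0 aK]) (use that False True cK m_x0_c m_c_a m_x0_a in auto)
      then show ?thesis by simp
    next
      case False
      then have "m w a = 2" using m_range[of w a] that aK \<open>w \<noteq> a\<close> by auto
      then have "w \<in> {y, z}" unfolding yz(1)[symmetric] using that \<open>w \<noteq> a\<close> by blast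
      then show ?thesis unfolding bd_set by blast
    qed
  qed simp
  note [simp] = x0 aK(1) cK(1) bK(1) dK(1) aK(2) cK(2,3) bK(2,3) dK(2,3) cb cd bd_ne aK(2)[symmetric]
    cK(2,3)[symmetric] bK(2,3)[symmetric] dK(2,3)[symmetric] cb[symmetric] cd[symmetric] bd_ne[symmetric]
  have m_a_x0 [simp]: "m a x0 = 1" using m_sym[of x0 a] m_x0_a by simp
  have m_a_c [simp]: "m a c = 1" using m_sym[of c a] m_c_a by simp
  have m_c_x0 [simp]: "m c x0 = 1" using m_sym[of x0 c] m_x0_c by simp
  have m_b_x0 [simp]: "m b x0 = 1" using m_sym[of x0 b] m_x0_b by simp
  have m_a_b [simp]: "m a b = 2" using m_sym[of b a] m_b_a by simp
  have m_d_x0 [simp]: "m d x0 = 1" using m_sym[of x0 d] m_x0_d by simp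
  have m_a_d [simp]: "m a d = 2" using m_sym[of d a] m_d_a by simp
  have m_d_b [simp]: "m d b = 1"
  proof -
    obtain w where w: "w \<in> K - {x0, b}" "m x0 w = m x0 b" "m w b = m x0 b"
      using third_point_exists[OF x0 bK(1) bK(2)] by blast
    then have w': "w \<in> {a, c, b, d}" "m w b = 1" "w \<noteq> b" using plus[of w] m_x0_b by auto
    have "w \<noteq> c"
    proof
      assume "w = c"
      then have 1: "m c b = 1" "m b c = 1" using w'(2) m_sym[of c b] by simp_all
      have "a = b"
        by (rule third_point_unique[of x0 c]) (use 1 in simp_all)
      then show False by simp
    qed
    moreover have "w \<noteq> a" using w'(2) m_a_b by auto
    ultimately show ?thesis using w' by auto
  qed
  have m_b_d [simp]: "m b d = 1" using m_sym[of d b] m_d_b by simp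
  have m_c_b [simp]: "m c b = 2"
  proof (rule ccontr)
    assume "m c b \<noteq> 2"
    then have 1: "m c b = 1" "m b c = 1"
      using m_range[of c b] m_sym[of c b] by auto
    have "c = d"
      by (rule third_point_unique[of x0 b]) (use 1 in simp_all)
    then show False by simp
  qed
  have m_b_c [simp]: "m b c = 2" using m_sym[of c b] m_c_b by simp
  have m_c_d [simp]: "m c d = 2"
  proof (rule ccontr)
    assume "m c d \<noteq> 2"
    then have 1: "m c d = 1" "m d c = 1"
      using m_range[of c d] m_sym[of c d] by auto
    have "c = b"
      by (rule third_point_unique[of x0 d]) (use 1 in simp_all)
    then show False by simp
  qed
  have m_d_c [simp]: "m d c = 2" using m_sym[of c d] m_c_d by simp
  obtain P where PK: "P \<in> K - {a, b}" and m_a_P [simp]: "m a P = 2" and m_P_b [simp]: "m P b = 2"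
    using third_point_exists[OF aK(1) bK(1,3)] unfolding m_a_b by blast
  \<comment> \<open>The pattern (2, 1) to a, b is attained twice: \<open>d\<close> is one point,
    \<open>Q\<close> the other. In the same way \<open>R\<close> is the partner of \<open>c\<close>
    and \<open>S\<close> that of \<open>x0\<close>.\<close>
  obtain Q where QK: "Q \<in> K - {a, b}" and m_a_Q [simp]: "m a Q = 2" and m_Q_b [simp]: "m Q b = 1" and Qd: "Q \<noteq> d"
  proof (rule third_point_second[of a b 2 1 d])
    show "\<not> (2 = m a b \<and> 1 = m a b)" using m_a_b by simp
  qed simp_all
  obtain R where RK: "R \<in> K - {a, b}" and m_a_R [simp]: "m a R = 1" and m_R_b [simp]: "m R b = 2" and Rc: "R \<noteq> c"
  proof (rule third_point_second[of a b 1 2 c])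
    show "\<not> (1 = m a b \<and> 2 = m a b)" using m_a_b by simp
  qed simp_all
  obtain S where SK: "S \<in> K - {a, b}" and m_a_S [simp]: "m a S = 1" and m_S_b [simp]: "m S b = 1" and Sx0: "S \<noteq> x0"
  proof (rule third_point_second[of a b 1 1 x0])
    show "\<not> (1 = m a b \<and> 1 = m a b)" using m_a_b by simp
  qed simp_all
  have elems2: "P \<in> K" "Q \<in> K" "R \<in> K" "S \<in> K" using PK QK RK SK by blast+
  have ne_P_x0: "P \<noteq> x0" by (rule notI, drule arg_cong[of _ _ "m a"], simp)
  have ne_P_a: "P \<noteq> a" using PK by blast
  have ne_P_c: "P \<noteq> c" by (rule notI, drule arg_cong[of _ _ "m a"], simp)
  have ne_P_b: "P \<noteq> b" using PK by blast
  have ne_P_d: "P \<noteq> d" by (rule notI, drule arg_cong[of _ _ "\<lambda>w. m w b"], simp)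
  have ne_Q_x0: "Q \<noteq> x0" by (rule notI, drule arg_cong[of _ _ "m a"], simp)
  have ne_Q_a: "Q \<noteq> a" using QK by blast
  have ne_Q_c: "Q \<noteq> c" by (rule notI, drule arg_cong[of _ _ "m a"], simp)
  have ne_Q_b: "Q \<noteq> b" using QK by blast
  have ne_Q_d: "Q \<noteq> d" by (rule Qd)
  have ne_R_x0: "R \<noteq> x0" by (rule notI, drule arg_cong[of _ _ "\<lambda>w. m w b"], simp)
  have ne_R_a: "R \<noteq> a" using RK by blast
  have ne_R_c: "R \<noteq> c" by (rule Rc)
  have ne_R_b: "R \<noteq> b" using RK by blast
  have ne_R_d: "R \<noteq> d" by (rule notI, drule arg_cong[of _ _ "m a"], simp)
  have ne_S_x0: "S \<noteq> x0" by (rule Sx0)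
  have ne_S_a: "S \<noteq> a" using SK by blast
  have ne_S_c: "S \<noteq> c" by (rule notI, drule arg_cong[of _ _ "\<lambda>w. m w b"], simp)
  have ne_S_b: "S \<noteq> b" using SK by blast
  have ne_S_d: "S \<noteq> d" by (rule notI, drule arg_cong[of _ _ "m a"], simp)
  have ne_P_Q: "P \<noteq> Q" by (rule notI, drule arg_cong[of _ _ "\<lambda>w. m w b"], simp)
  have ne_P_R: "P \<noteq> R" by (rule notI, drule arg_cong[of _ _ "m a"], simp)
  have ne_P_S: "P \<noteq> S" by (rule notI, drule arg_cong[of _ _ "m a"], simp)
  have ne_Q_R: "Q \<noteq> R" by (rule notI, drule arg_cong[of _ _ "m a"], simp)
  have ne_Q_S: "Q \<noteq> S" by (rule notI, drule arg_cong[of _ _ "m a"], simp)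
  have ne_R_S: "R \<noteq> S" by (rule notI, drule arg_cong[of _ _ "\<lambda>w. m w b"], simp)
  note [simp] = elems2
    ne_P_x0 ne_P_x0[symmetric] ne_P_a ne_P_a[symmetric] ne_P_c ne_P_c[symmetric] ne_P_b
    ne_P_b[symmetric] ne_P_d ne_P_d[symmetric] ne_Q_x0 ne_Q_x0[symmetric] ne_Q_a ne_Q_a[symmetric]
    ne_Q_c ne_Q_c[symmetric] ne_Q_b ne_Q_b[symmetric] ne_Q_d ne_Q_d[symmetric] ne_R_x0
    ne_R_x0[symmetric] ne_R_a ne_R_a[symmetric] ne_R_c ne_R_c[symmetric] ne_R_b ne_R_b[symmetric]
    ne_R_d ne_R_d[symmetric] ne_S_x0 ne_S_x0[symmetric] ne_S_a ne_S_a[symmetric] ne_S_c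
    ne_S_c[symmetric] ne_S_b ne_S_b[symmetric] ne_S_d ne_S_d[symmetric] ne_P_Q ne_P_Q[symmetric]
    ne_P_R ne_P_R[symmetric] ne_P_S ne_P_S[symmetric] ne_Q_R ne_Q_R[symmetric] ne_Q_S
    ne_Q_S[symmetric] ne_R_S ne_R_S[symmetric]
  have m_P_a [simp]: "m P a = 2" using m_sym[of a P] m_a_P by simp
  have m_b_P [simp]: "m b P = 2" using m_sym[of P b] m_P_b by simp
  have m_Q_a [simp]: "m Q a = 2" using m_sym[of a Q] m_a_Q by simp
  have m_b_Q [simp]: "m b Q = 1" using m_sym[of Q b] m_Q_b by simp
  have m_R_a [simp]: "m R a = 1" using m_sym[of a R] m_a_R by simp
  have m_b_R [simp]: "m b R = 2" using m_sym[of R b] m_R_b by simp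
  have m_S_a [simp]: "m S a = 1" using m_sym[of a S] m_a_S by simp
  have m_b_S [simp]: "m b S = 1" using m_sym[of S b] m_S_b by simp
  have m_x0_P [simp]: "m x0 P = 2"
    using plus[of P] m_range[of x0 P] by auto
  have m_P_x0 [simp]: "m P x0 = 2" using m_sym[of x0 P] m_x0_P by simp
  have m_x0_Q [simp]: "m x0 Q = 2"
    using plus[of Q] m_range[of x0 Q] by auto
  have m_Q_x0 [simp]: "m Q x0 = 2" using m_sym[of x0 Q] m_x0_Q by simp
  have m_x0_R [simp]: "m x0 R = 2"
    using plus[of R] m_range[of x0 R] by auto
  have m_R_x0 [simp]: "m R x0 = 2" using m_sym[of x0 R] m_x0_R by simp
  have m_x0_S [simp]: "m x0 S = 2"
    using plus[of S] m_range[of x0 S] by auto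
  have m_S_x0 [simp]: "m S x0 = 2" using m_sym[of x0 S] m_x0_S by simp
  have m_R_c [simp]: "m R c = 2"
  proof (rule ccontr)
    assume "m R c \<noteq> 2"
    then have 1: "m R c = 1" "m c R = 1"
      using m_range[of R c] m_sym[of R c] by auto
    have "R = x0"
      by (rule third_point_unique[of a c]) (use 1 in simp_all)
    then show False by simp
  qed
  have m_c_R [simp]: "m c R = 2" using m_sym[of R c] m_R_c by simp
  have m_S_c [simp]: "m S c = 2"
  proof (rule ccontr)
    assume "m S c \<noteq> 2"
    then have 1: "m S c = 1" "m c S = 1"
      using m_range[of S c] m_sym[of S c] by auto
    have "S = x0"
      by (rule third_point_unique[of a c]) (use 1 in simp_all)
    then show False by simp
  qed
  have m_c_S [simp]: "m c S = 2" using m_sym[of S c] m_S_c by simp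
  have m_P_c [simp]: "m P c = 1"
  proof (rule ccontr)
    assume "m P c \<noteq> 1"
    then have 1: "m P c = 2" "m c P = 2"
      using m_range[of P c] m_sym[of P c] by auto
    show False
      by (rule no_three_third_points[of a c 2 2 b d P]) (use 1 in auto)
  qed
  have m_c_P [simp]: "m c P = 1" using m_sym[of P c] m_P_c by simp
  have m_Q_c [simp]: "m Q c = 1"
  proof (rule ccontr)
    assume "m Q c \<noteq> 1"
    then have 1: "m Q c = 2" "m c Q = 2"
      using m_range[of Q c] m_sym[of Q c] by auto
    show False
      by (rule no_three_third_points[of a c 2 2 b d Q]) (use 1 in auto)
  qed
  have m_c_Q [simp]: "m c Q = 1" using m_sym[of Q c] m_Q_c by simp
  have m_Q_d [simp]: "m Q d = 2"
  proof (rule ccontr)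
    assume "m Q d \<noteq> 2"
    then have 1: "m Q d = 1" "m d Q = 1"
      using m_range[of Q d] m_sym[of Q d] by auto
    have "Q = x0"
      by (rule third_point_unique[of b d]) (use 1 in simp_all)
    then show False by simp
  qed
  have m_d_Q [simp]: "m d Q = 2" using m_sym[of Q d] m_Q_d by simp
  have m_S_d [simp]: "m S d = 2"
  proof (rule ccontr)
    assume "m S d \<noteq> 2"
    then have 1: "m S d = 1" "m d S = 1"
      using m_range[of S d] m_sym[of S d] by auto
    have "S = x0"
      by (rule third_point_unique[of b d]) (use 1 in simp_all)
    then show False by simp
  qed
  have m_d_S [simp]: "m d S = 2" using m_sym[of S d] m_S_d by simp
  have m_P_d [simp]: "m P d = 1"
  proof (rule ccontr)
    assume "m P d \<noteq> 1"
    then have 1: "m P d = 2" "m d P = 2"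
      using m_range[of P d] m_sym[of P d] by auto
    show False
      by (rule no_three_third_points[of b d 2 2 a c P]) (use 1 in auto)
  qed
  have m_d_P [simp]: "m d P = 1" using m_sym[of P d] m_P_d by simp
  have m_R_d [simp]: "m R d = 1"
  proof (rule ccontr)
    assume "m R d \<noteq> 1"
    then have 1: "m R d = 2" "m d R = 2"
      using m_range[of R d] m_sym[of R d] by auto
    show False
      by (rule no_three_third_points[of b d 2 2 a c R]) (use 1 in auto)
  qed
  have m_d_R [simp]: "m d R = 1" using m_sym[of R d] m_R_d by simp
  \<comment> \<open>Otherwise uniqueness of third points, for x0 with P and for x0 with Q, gives R
    and S multiplier 1 to both P and Q; with c there would be three points of the pattern (1,
    1).\<close>
  have m_P_Q [simp]: "m P Q = 1"
  proof (rule ccontr)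
    assume "m P Q \<noteq> 1"
    then have 1: "m P Q = 2" "m Q P = 2"
      using m_range[of P Q] m_sym[of P Q] by auto
    have "m R P \<noteq> 2"
    proof
      assume "m R P = 2"
      then have "R = Q"
        by (intro third_point_unique[of x0 P]) (use 1 in simp_all)
      then show False by simp
    qed
    then have RP: "m R P = 1" "m P R = 1"
      using m_range[of R P] m_sym[of R P] by auto
    have "m R Q \<noteq> 2"
    proof
      assume "m R Q = 2"
      then have "R = P"
        by (intro third_point_unique[of x0 Q]) (use 1 in simp_all)
      then show False by simp
    qed
    then have RQ: "m R Q = 1" "m Q R = 1"
      using m_range[of R Q] m_sym[of R Q] by auto
    have "m S P \<noteq> 2"
    proof
      assume "m S P = 2"
      then have "S = Q"
        by (intro third_point_unique[of x0 P]) (use 1 in simp_all)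
      then show False by simp
    qed
    then have SP: "m S P = 1" "m P S = 1"
      using m_range[of S P] m_sym[of S P] by auto
    have "m S Q \<noteq> 2"
    proof
      assume "m S Q = 2"
      then have "S = P"
        by (intro third_point_unique[of x0 Q]) (use 1 in simp_all)
      then show False by simp
    qed
    then have SQ: "m S Q = 1" "m Q S = 1"
      using m_range[of S Q] m_sym[of S Q] by auto
    show False
      by (rule no_three_third_points[of P Q 1 1 c R S]) (use 1 RP RQ SP SQ in auto)
  qed
  have m_Q_P [simp]: "m Q P = 1" using m_sym[of P Q] m_P_Q by simp
  have m_P_R [simp]: "m P R = 1"
  proof (rule ccontr)
    assume "m P R \<noteq> 1"
    then have 1: "m P R = 2" "m R P = 2"
      using m_range[of P R] m_sym[of P R] by auto
    have "m Q P \<noteq> 2"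
    proof
      assume "m Q P = 2"
      then have "Q = R"
        by (intro third_point_unique[of x0 P]) (use 1 in simp_all)
      then show False by simp
    qed
    then have QP: "m Q P = 1" "m P Q = 1"
      using m_range[of Q P] m_sym[of Q P] by auto
    have "m Q R \<noteq> 2"
    proof
      assume "m Q R = 2"
      then have "Q = P"
        by (intro third_point_unique[of x0 R]) (use 1 in simp_all)
      then show False by simp
    qed
    then have QR: "m Q R = 1" "m R Q = 1"
      using m_range[of Q R] m_sym[of Q R] by auto
    have "m S P \<noteq> 2"
    proof
      assume "m S P = 2"
      then have "S = R"
        by (intro third_point_unique[of x0 P]) (use 1 in simp_all)
      then show False by simp
    qed
    then have SP: "m S P = 1" "m P S = 1"
      using m_range[of S P] m_sym[of S P] by auto
    have "m S R \<noteq> 2"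
    proof
      assume "m S R = 2"
      then have "S = P"
        by (intro third_point_unique[of x0 R]) (use 1 in simp_all)
      then show False by simp
    qed
    then have SR: "m S R = 1" "m R S = 1"
      using m_range[of S R] m_sym[of S R] by auto
    show False
      by (rule no_three_third_points[of P R 1 1 d Q S]) (use 1 QP QR SP SR in auto)
  qed
  have m_R_P [simp]: "m R P = 1" using m_sym[of P R] m_P_R by simp
  have card9: "card {x0, a, c, b, d, P, Q, R, S} = 9" by simp
  have K_eq: "K = {x0, a, c, b, d, P, Q, R, S}"
    using card_subset_eq[of K "{x0, a, c, b, d, P, Q, R, S}"] K card9 by auto
  \<comment> \<open>All nine points are known now, and \<open>S\<close> is the only candidate left
    for the third point of x0 and P.\<close>
  have m_S_P [simp]: "m S P = 2"
  proof -
    obtain w where w: "w \<in> K - {x0, P}" "m x0 w = m x0 P" "m w P = m x0 P"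
      using third_point_exists[OF x0 elems2(1) ne_P_x0[symmetric]] by blast
    have "w \<in> {x0, a, c, b, d, P, Q, R, S}" using w(1) K_eq by blast
    then have "w = S" using w by auto
    then show ?thesis using w(3) by simp
  qed
  have m_P_S [simp]: "m P S = 2" using m_sym[of S P] m_S_P by simp
  have m_Q_S [simp]: "m Q S = 1"
  proof (rule ccontr)
    assume "m Q S \<noteq> 1"
    then have 1: "m Q S = 2" "m S Q = 2"
      using m_range[of Q S] m_sym[of Q S] by auto
    have "P = Q"
      by (rule third_point_unique[of x0 S]) (use 1 in simp_all)
    then show False by simp
  qed
  have m_S_Q [simp]: "m S Q = 1" using m_sym[of Q S] m_Q_S by simp
  have m_R_Q [simp]: "m R Q = 2"
  proof -
    obtain w where w: "w \<in> K - {x0, Q}" "m x0 w = m x0 Q" "m w Q = m x0 Q"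
      using third_point_exists[OF x0 elems2(2) ne_Q_x0[symmetric]] by blast
    have "w \<in> {x0, a, c, b, d, P, Q, R, S}" using w(1) K_eq by blast
    then have "w = R" using w by auto
    then show ?thesis using w(3) by simp
  qed
  have m_Q_R [simp]: "m Q R = 2" using m_sym[of R Q] m_R_Q by simp
  have m_R_S [simp]: "m R S = 1"
  proof (rule ccontr)
    assume "m R S \<noteq> 1"
    then have 1: "m R S = 2" "m S R = 2"
      using m_range[of R S] m_sym[of R S] by auto
    have "Q = S"
      by (rule third_point_unique[of x0 R]) (use 1 in simp_all)
    then show False by simp
  qed
  have m_S_R [simp]: "m S R = 1" using m_sym[of R S] m_R_S by simp
  have k_x0_a [simp]: "k x0 a = 0" by (rule k_base) simp_all
  have k_x0_c [simp]: "k x0 c = 0" by (rule k_base) simp_all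
  have k_x0_b [simp]: "k x0 b = 0" by (rule k_base) simp_all
  have k_x0_d [simp]: "k x0 d = 0" by (rule k_base) simp_all
  have k_x0_P [simp]: "k x0 P = 0" by (rule k_base) simp_all
  have k_x0_Q [simp]: "k x0 Q = 0" by (rule k_base) simp_all
  have k_x0_R [simp]: "k x0 R = 0" by (rule k_base) simp_all
  have k_x0_S [simp]: "k x0 S = 0" by (rule k_base) simp_all
  have k_a_c [simp]: "k a c = 0" using base_line[of a c] by simp
  have k_c_a [simp]: "k c a = 0" using k_sym[of a c] k_a_c by simp
  have k_b_d [simp]: "k b d = 0" using base_line[of b d] by simp
  have k_d_b [simp]: "k d b = 0" using k_sym[of b d] k_b_d by simp
  have k_P_S [simp]: "k P S = 0" using base_line[of P S] by simp
  have k_S_P [simp]: "k S P = 0" using k_sym[of P S] k_P_S by simp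
  have k_Q_R [simp]: "k Q R = 0" using base_line[of Q R] by simp
  have k_R_Q [simp]: "k R Q = 0" using k_sym[of Q R] k_Q_R by simp
  have k_a_b [simp]: "k a b = 1" using k_sym[of b a] k_b_a by simp
  have k_a_d [simp]: "k a d = 2" using k_sym[of d a] k_d_a by simp
  have kr_c_b: "k c b \<in> {1, 2}"
    by (rule base_shift_range) simp_all
  have k_c_b [simp]: "k c b = 2"
    using kr_c_b k_a_b base_shifts_differ[of a c b] by auto
  have k_b_c [simp]: "k b c = 1" using k_sym[of c b] k_c_b by simp
  have kr_d_c: "k d c \<in> {1, 2}"
    by (rule base_shift_range) simp_all
  have k_d_c [simp]: "k d c = 2"
    using kr_d_c k_b_c base_shifts_differ[of b d c] by auto
  have k_c_d [simp]: "k c d = 1" using k_sym[of d c] k_d_c by simp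
  have kr_b_P: "k b P \<in> {1, 2}"
    by (rule base_shift_range) simp_all
  have kr_a_P: "k a P \<in> {1, 2}"
    by (rule base_shift_range) simp_all
  \<comment> \<open>The points a, b, P form a line; as k a b = 1 and the two other shifts are
    nonzero, zero area determines both.\<close>
  have "(k a b + k b P - k a P) mod 3 = 0"
    using line_iff[of a P b] by simp
  then have k_b_P [simp]: "k b P = 1" and k_a_P [simp]: "k a P = 2"
    using sum_mod_3_cases(1)[OF kr_b_P kr_a_P] unfolding k_a_b by simp_all
  have k_P_b [simp]: "k P b = 2" using k_sym[of b P] k_b_P by simp
  have k_P_a [simp]: "k P a = 1" using k_sym[of a P] k_a_P by simp
  have kr_d_Q: "k d Q \<in> {1, 2}"
    by (rule base_shift_range) simp_all
  have kr_a_Q: "k a Q \<in> {1, 2}"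
    by (rule base_shift_range) simp_all
  have "(k a d + k d Q - k a Q) mod 3 = 0"
    using line_iff[of a Q d] by simp
  then have k_d_Q [simp]: "k d Q = 2" and k_a_Q [simp]: "k a Q = 1"
    using sum_mod_3_cases(2)[OF kr_d_Q kr_a_Q] unfolding k_a_d by simp_all
  have k_Q_d [simp]: "k Q d = 1" using k_sym[of d Q] k_d_Q by simp
  have k_Q_a [simp]: "k Q a = 2" using k_sym[of a Q] k_a_Q by simp
  have kr_b_R: "k b R \<in> {1, 2}"
    by (rule base_shift_range) simp_all
  have kr_c_R: "k c R \<in> {1, 2}"
    by (rule base_shift_range) simp_all
  have "(k c b + k b R - k c R) mod 3 = 0"
    using line_iff[of c R b] by simp
  then have k_b_R [simp]: "k b R = 2" and k_c_R [simp]: "k c R = 1"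
    using sum_mod_3_cases(2)[OF kr_b_R kr_c_R] unfolding k_c_b by simp_all
  have k_R_b [simp]: "k R b = 1" using k_sym[of b R] k_b_R by simp
  have k_R_c [simp]: "k R c = 2" using k_sym[of c R] k_c_R by simp
  have kr_d_S: "k d S \<in> {1, 2}"
    by (rule base_shift_range) simp_all
  have kr_c_S: "k c S \<in> {1, 2}"
    by (rule base_shift_range) simp_all
  have "(k c d + k d S - k c S) mod 3 = 0"
    using line_iff[of c S d] by simp
  then have k_d_S [simp]: "k d S = 1" and k_c_S [simp]: "k c S = 2"
    using sum_mod_3_cases(1)[OF kr_d_S kr_c_S] unfolding k_c_d by simp_all
  have k_S_d [simp]: "k S d = 2" using k_sym[of d S] k_d_S by simp
  have k_S_c [simp]: "k S c = 1" using k_sym[of c S] k_c_S by simp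
  have kr_b_Q: "k b Q \<in> {1, 2}"
    by (rule base_shift_range) simp_all
  \<comment> \<open>The points b, d, Q are not on a line, and the nonzero area excludes one of the
    two values of \<open>k b Q\<close>.\<close>
  have "(k b Q + k Q d - k b d) mod 3 \<noteq> 0"
    using line_iff[of b d Q] by simp
  then have k_b_Q [simp]: "k b Q = 1" using kr_b_Q by auto
  have k_Q_b [simp]: "k Q b = 2" using k_sym[of b Q] k_b_Q by simp
  have kr_P_d: "k P d \<in> {1, 2}"
    by (rule base_shift_range) simp_all
  have "(k b P + k P d - k b d) mod 3 \<noteq> 0"
    using line_iff[of b d P] by simp
  then have k_P_d [simp]: "k P d = 1" using kr_P_d by auto
  have k_d_P [simp]: "k d P = 2" using k_sym[of P d] k_P_d by simp
  have kr_R_d: "k R d \<in> {1, 2}"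
    by (rule base_shift_range) simp_all
  have "(k b R + k R d - k b d) mod 3 \<noteq> 0"
    using line_iff[of b d R] by simp
  then have k_R_d [simp]: "k R d = 2" using kr_R_d by auto
  have k_d_R [simp]: "k d R = 1" using k_sym[of R d] k_R_d by simp
  have kr_b_S: "k b S \<in> {1, 2}"
    by (rule base_shift_range) simp_all
  have "(k b S + k S d - k b d) mod 3 \<noteq> 0"
    using line_iff[of b d S] by simp
  then have k_b_S [simp]: "k b S = 2" using kr_b_S by auto
  have k_S_b [simp]: "k S b = 1" using k_sym[of b S] k_b_S by simp
  have kr_P_c: "k P c \<in> {1, 2}"
    by (rule base_shift_range) simp_all
  have "(k a P + k P c - k a c) mod 3 \<noteq> 0"
    using line_iff[of a c P] by simp
  then have k_P_c [simp]: "k P c = 2" using kr_P_c by auto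
  have k_c_P [simp]: "k c P = 1" using k_sym[of P c] k_P_c by simp
  have kr_Q_c: "k Q c \<in> {1, 2}"
    by (rule base_shift_range) simp_all
  have "(k a Q + k Q c - k a c) mod 3 \<noteq> 0"
    using line_iff[of a c Q] by simp
  then have k_Q_c [simp]: "k Q c = 1" using kr_Q_c by auto
  have k_c_Q [simp]: "k c Q = 2" using k_sym[of Q c] k_Q_c by simp
  have kr_a_R: "k a R \<in> {1, 2}"
    by (rule base_shift_range) simp_all
  have "(k a R + k R c - k a c) mod 3 \<noteq> 0"
    using line_iff[of a c R] by simp
  then have k_a_R [simp]: "k a R = 2" using kr_a_R by auto
  have k_R_a [simp]: "k R a = 1" using k_sym[of a R] k_a_R by simp
  have kr_a_S: "k a S \<in> {1, 2}"
    by (rule base_shift_range) simp_all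
  have "(k a S + k S c - k a c) mod 3 \<noteq> 0"
    using line_iff[of a c S] by simp
  then have k_a_S [simp]: "k a S = 1" using kr_a_S by auto
  have k_S_a [simp]: "k S a = 2" using k_sym[of a S] k_a_S by simp
  have kr_P_Q: "k P Q \<in> {1, 2}"
    by (rule base_shift_range) simp_all
  have "(k c P + k P Q - k c Q) mod 3 = 0"
    using line_iff[of c Q P] by simp
  then have k_P_Q [simp]: "k P Q = 1" using kr_P_Q by auto
  have k_Q_P [simp]: "k Q P = 2" using k_sym[of P Q] k_P_Q by simp
  have kr_P_R: "k P R \<in> {1, 2}"
    by (rule base_shift_range) simp_all
  have "(k d P + k P R - k d R) mod 3 = 0"
    using line_iff[of d R P] by simp
  then have k_P_R [simp]: "k P R = 2" using kr_P_R by auto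
  have k_R_P [simp]: "k R P = 1" using k_sym[of P R] k_P_R by simp
  have kr_Q_S: "k Q S \<in> {1, 2}"
    by (rule base_shift_range) simp_all
  have "(k b Q + k Q S - k b S) mod 3 = 0"
    using line_iff[of b S Q] by simp
  then have k_Q_S [simp]: "k Q S = 1" using kr_Q_S by auto
  have k_S_Q [simp]: "k S Q = 2" using k_sym[of Q S] k_Q_S by simp
  have kr_R_S: "k R S \<in> {1, 2}"
    by (rule base_shift_range) simp_all
  have "(k a R + k R S - k a S) mod 3 = 0"
    using line_iff[of a S R] by simp
  then have k_R_S [simp]: "k R S = 2" using kr_R_S by auto
  have k_S_R [simp]: "k S R = 1" using k_sym[of R S] k_R_S by simp
  define e where "e i = [x0, a, c, b, d, P, Q, R, S] ! i" for i
  have "e ` {..<9} = K"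
    unfolding K_eq e_def using atLeast0LessThan[of 9] by (simp add: lessThan_nat_numeral lessThan_Suc eval_nat_numeral insert_commute)
  then have bij: "bij_betw e {..<9} K"
    unfolding bij_betw_def using eq_card_imp_inj_on[of "{..<9}" e] K by simp
  have less: "m (e i) (e j) = mult_table i j \<and> k (e i) (e j) = shift_table i j" if "i < j" "j < 9" for i j
  proof -
    have "i < 9" using that by simp
    then show ?thesis
      using that unfolding nat_less_9 e_def mult_table_def shift_table_def
      by (elim insertE emptyE; hypsubst; simp add:)
  qed
  have eK: "e i \<in> K" if "i < 9" for i using bij that unfolding bij_betw_def by blast
  have e_ne: "e i \<noteq> e j" if "i < 9" "j < 9" "i \<noteq> j" for i j
    using bij that unfolding bij_betw_def inj_on_def by blast
  have "m (e i) (e j) = mult_table i j \<and> k (e i) (e j) = shift_table i j" if "i < 9" "j < 9" "i \<noteq> j" for i j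
  proof (cases "i < j")
    case True
    then show ?thesis using less that by blast
  next
    case False
    then have "j < i" using that by simp
    then show ?thesis
      using less[of j i] that tables_sym[of j i] m_k_sym[OF eK eK e_ne, of j i] by simp
  qed
  then show ?thesis using that bij by blast
qed

lemma standard_form:
  "\<exists>\<theta>. bij_betw \<theta> ({..<9} \<times> L) V \<and>
    (\<forall>p\<in>{..<9} \<times> L. \<forall>p'\<in>{..<9} \<times> L. r (\<theta> p) (\<theta> p') = standard_rel p p')"
proof -
  obtain e where e: "bij_betw e {..<9} K"
    and mk: "\<And>i j. i < 9 \<Longrightarrow> j < 9 \<Longrightarrow> i \<noteq> j \<Longrightarrow> m (e i) (e j) = mult_table i j \<and> k (e i) (e j) = shift_table i j"
    by (rule nine_points) blast
  have eK: "e i \<in> K" if "i < 9" for i using e that unfolding bij_betw_def by blast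
  have e_inj: "e i = e j \<longleftrightarrow> i = j" if "i < 9" "j < 9" for i j
    using e that unfolding bij_betw_def inj_on_def by blast
  define \<theta> where "\<theta> p = pt (e (fst p)) (snd p)" for p
  have "bij_betw (case_prod pt \<circ> map_prod e id) ({..<9} \<times> L) V"
    by (rule bij_betw_trans[OF _ pt_bij], rule bij_betw_map_prod[OF e]) simp
  moreover have "case_prod pt \<circ> map_prod e id = \<theta>" by (auto simp: \<theta>_def)
  ultimately have "bij_betw \<theta> ({..<9} \<times> L) V" by simp
  moreover have "r (\<theta> p) (\<theta> p') = standard_rel p p'" if p: "p \<in> {..<9} \<times> L" "p' \<in> {..<9} \<times> L" for p p'
  proof -
    obtain i s j t where ij: "p = (i, s)" "p' = (j, t)" by (metis prod.collapse)
    have i: "i < 9" "j < 9" and st: "s \<in> L" "t \<in> L" using p unfolding ij by blast+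
    show ?thesis
    proof (cases "i = j")
      case True
      have "fib (pt (e i) s) (pt (e j) t)" using pt_fib[OF eK eK st] i True by blast
      moreover have "r (pt (e i) s) (pt (e j) t) = Same \<longleftrightarrow> s = t"
        using same[OF pt_in_V[OF eK st(1)] pt_in_V[OF eK st(2)]] pt_eq_iff[OF eK eK st] i True by simp
      ultimately show ?thesis
        unfolding ij \<theta>_def standard_rel_def fib_def by (auto simp: True)
    next
      case False
      then have ne: "e i \<noteq> e j" using e_inj i by blast
      show ?thesis
        unfolding ij \<theta>_def standard_rel_def fst_conv snd_conv r_pt[OF eK[OF i(1)] eK[OF i(2)] st ne]
          F_eq[OF eK[OF i(1)] eK[OF i(2)] ne st]
        using mk[OF i False] False by simp
    qed
  qed
  ultimately show ?thesis by blast
qed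

end

lemma (in config3) standard_form:
  "\<exists>\<theta>. bij_betw \<theta> ({..<9} \<times> {0, 1, 2}) V \<and>
    (\<forall>p\<in>{..<9} \<times> {0, 1, 2}. \<forall>p'\<in>{..<9} \<times> {0, 1, 2}. r (\<theta> p) (\<theta> p') = standard_rel p p')"
proof -
  obtain K x0 pt where "labelled_config3 V r K x0 pt" using labelling_exists by blast
  then interpret labelled_config3 V r K x0 pt .
  obtain m k where "affine_config3 V r K x0 pt m k" using affine_exists by blast
  then interpret affine_config3 V r K x0 pt m k .
  show ?thesis by (rule standard_form)
qed

section \<open>Fields of order 3\<close>

definition code3 :: "'a::field \<Rightarrow> int" where
  "code3 x = (if x = 0 then 0 else if x = 1 then 1 else 2)"

lemma vertex_tuples_2E:
  assumes "xs \<in> vertex_tuples 2 D"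
  obtains x y where "xs = [x, y]" "x \<in> pverts D" "y \<in> pverts D"
  using assms unfolding vertex_tuples_2 by auto

text \<open>Both configurations are coordinatised by the same tables, so the coordinates compose to
  an isomorphism.\<close>

lemma (in config3) isomorphic:
  assumes "config3 V' r'"
  shows "\<exists>f. bij_betw f V V' \<and> (\<forall>x\<in>V. \<forall>y\<in>V. r' (f x) (f y) = r x y)"
proof -
  let ?A = "{..<9::nat} \<times> {0, 1, 2 :: int}"
  obtain \<theta> where \<theta>: "bij_betw \<theta> ?A V" "\<forall>p\<in>?A. \<forall>p'\<in>?A. r (\<theta> p) (\<theta> p') = standard_rel p p'"
    using standard_form by blast
  obtain \<eta> where \<eta>: "bij_betw \<eta> ?A V'" "\<forall>p\<in>?A. \<forall>p'\<in>?A. r' (\<eta> p) (\<eta> p') = standard_rel p p'"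
    using config3.standard_form[OF assms] by blast
  let ?i = "the_inv_into ?A \<theta>"
  have i: "bij_betw ?i V ?A" by (rule bij_betw_the_inv_into[OF \<theta>(1)])
  have iA: "?i x \<in> ?A" if "x \<in> V" for x using bij_betwE[OF i] that by blast
  have inv: "\<theta> (?i x) = x" if "x \<in> V" for x using f_the_inv_into_f_bij_betw[OF \<theta>(1)] that by blast
  have "r' ((\<eta> \<circ> ?i) x) ((\<eta> \<circ> ?i) y) = r x y" if "x \<in> V" "y \<in> V" for x y
  proof -
    have "r' ((\<eta> \<circ> ?i) x) ((\<eta> \<circ> ?i) y) = standard_rel (?i x) (?i y)"
      unfolding comp_def by (rule bspec[OF bspec[OF \<eta>(2) iA[OF that(1)]] iA[OF that(2)]])
    also have "\<dots> = r (\<theta> (?i x)) (\<theta> (?i y))"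
      by (rule bspec[OF bspec[OF \<theta>(2) iA[OF that(1)]] iA[OF that(2)], symmetric])
    also have "\<dots> = r x y" unfolding inv[OF that(1)] inv[OF that(2)] ..
    finally show ?thesis .
  qed
  then show ?thesis using bij_betw_trans[OF i \<eta>(1)] by blast
qed

section \<open>Transfer of the relations to an equivalent digraph\<close>

context odd_nonsquare
begin

definition path_config :: "'v set \<Rightarrow> ('v \<Rightarrow> 'v \<Rightarrow> 'a rel_type) \<Rightarrow> bool" where
  "path_config V \<rho> \<longleftrightarrow> finite V \<and> card V = CARD('a) ^ 3 \<and>
    (\<forall>x\<in>V. \<forall>y\<in>V. (\<rho> x y = Same \<longleftrightarrow> x = y) \<and>
      (\<forall>s t. card {z \<in> V. \<rho> x z = s \<and> \<rho> z y = t} = paths s t (\<rho> x y)))"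

lemma path_config_rel: "path_config UNIV rel"
  by (simp add: path_config_def card_rel_paths power3_eq_cube)

lemma paths_Same_imp_inverse: "paths s t Same \<noteq> 0 \<Longrightarrow> t = rel_inverse s"
  by (cases s; cases t) (auto split: if_splits simp: add_eq_0_iff)

text \<open>The closed walk x, y, x exists, and closed walks only combine mutually inverse
  classes.\<close>

lemma path_config_sym:
  assumes "path_config V \<rho>" "x \<in> V" "y \<in> V"
  shows "\<rho> y x = rel_inverse (\<rho> x y)"
proof -
  have fin: "finite V" and same: "\<rho> x x = Same"
    and paths: "card {z \<in> V. \<rho> x z = s \<and> \<rho> z x = t} = paths s t (\<rho> x x)" for s t
    using assms unfolding path_config_def by blast+
  have "card {z \<in> V. \<rho> x z = \<rho> x y \<and> \<rho> z x = \<rho> y x} \<noteq> 0"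
    by (rule card_neq_0_if_mem[of _ y]) (use fin assms(3) in auto)
  then show ?thesis using paths_Same_imp_inverse unfolding paths same by blast
qed

lemma field_of_order_3:
  assumes q: "CARD('a) = 3"
  shows "(UNIV :: 'a set) = {0, 1, - 1}" "(- 1::'a) \<noteq> 1" "(1::'a) \<noteq> - 1" "(- 1::'a) \<noteq> 0"
proof -
  show m: "(1::'a) \<noteq> - 1"
    using two_neq_0 by (metis eq_neg_iff_add_eq_0 one_add_one)
  then show "(- 1::'a) \<noteq> 1" by (rule not_sym)
  show "(- 1::'a) \<noteq> 0" by simp
  have "card {0, 1, - 1 :: 'a} = 3" using m by simp
  then show "(UNIV :: 'a set) = {0, 1, - 1}"
    using q card_subset_eq[of UNIV "{0, 1, - 1 :: 'a}"] by simp
qed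

lemma code3_simps:
  assumes "CARD('a) = 3"
  shows "code3 (0::'a) = 0" "code3 (1::'a) = 1" "code3 (- 1::'a) = 2"
  using field_of_order_3[OF assms] by (simp_all add: code3_def)

lemma code3_eq_iff:
  assumes q: "CARD('a) = 3"
  shows "code3 a = code3 b \<longleftrightarrow> a = (b :: 'a)"
proof -
  have "x \<in> {0, 1, - 1 :: 'a}" for x using field_of_order_3(1)[OF q] by blast
  from this[of a] this[of b] show ?thesis
    using code3_simps[OF q] field_of_order_3(2-4)[OF q] by auto
qed

text \<open>In the field of order 3, 1 + 1 = -1 and \<epsilon> = \<delta> = -1; with these values
  \<open>paths\<close> and \<open>paths3\<close> are compared entry by entry.\<close>

lemma path_config_config3:
  assumes q: "CARD('a) = 3" and \<rho>: "path_config V \<rho>"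
  shows "config3 V (\<lambda>x y. map_rel_type code3 (\<rho> x y))"
proof -
  note UNIV3 = field_of_order_3(1)[OF q] and m1 = field_of_order_3(2,4)[OF q]
  have three: "(1::'a) + 1 = - 1"
  proof -
    have "(1::'a) + 1 \<in> {0, 1, - 1}" using UNIV3 by blast
    moreover have "(1::'a) + 1 \<noteq> 0" using two_neq_0 by simp
    moreover have "(1::'a) + 1 \<noteq> 1" using add_cancel_left_right[of "1::'a" 1] one_neq_zero by blast
    ultimately show ?thesis by blast
  qed
  have three': "(- 1::'a) + - 1 = 1" using three by (metis minus_add_distrib minus_minus)
  have eps: "\<epsilon> = - 1"
  proof -
    have "\<epsilon> \<noteq> 1" using nonsquare by (metis is_nth_power_1)
    then show ?thesis using UNIV3 eps_neq_0 by blast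
  qed
  have delta: "\<delta> = - 1"
  proof -
    have "(16::'a) = (1 + 1) * (1 + 1) * ((1 + 1) * (1 + 1))" by simp
    then have "(16::'a) = 1" unfolding three by simp
    then show ?thesis by (simp add: eps)
  qed
  note code = code3_simps[OF q]
  have cases3: "a = 0 \<or> a = 1 \<or> a = - 1" for a :: 'a using UNIV3 by blast
  have code_range: "code3 a \<in> {0, 1, 2}" for a :: 'a by (simp add: code3_def)
  note code_inj = code3_eq_iff[OF q]
  have code_surj: "\<exists>b::'a. c = code3 b" if "c \<in> {0, 1, 2}" for c
    using that code by (metis insertE singletonD)
  have code_neg: "code3 (- a) = (- code3 a) mod 3" for a :: 'a
    using cases3[of a] code by auto
  let ?r = "\<lambda>x y. map_rel_type code3 (\<rho> x y)"
  have r_simps: "map_rel_type code3 s = Same \<longleftrightarrow> s = Same" "map_rel_type code3 s = Fibre \<longleftrightarrow> s = Fibre"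
    "map_rel_type code3 s = Cone (code3 a) \<longleftrightarrow> s = Cone a" for s and a :: 'a
    by (cases s; simp add: code_inj)+
  have fin: "finite V" and cardV: "card V = 27"
    and same: "x \<in> V \<Longrightarrow> y \<in> V \<Longrightarrow> \<rho> x y = Same \<longleftrightarrow> x = y"
    and paths: "x \<in> V \<Longrightarrow> y \<in> V \<Longrightarrow> card {z \<in> V. \<rho> x z = s \<and> \<rho> z y = t} = paths s t (\<rho> x y)" for x y s t
    using \<rho> q unfolding path_config_def by simp_all
  have paths_code: "paths (Cone a) (Cone b) (Cone d) = paths3 (code3 a) (code3 b) (code3 d)" for a b d
    using cases3[of a] cases3[of b] cases3[of d]
    by (elim disjE; simp add: paths3_def delta code m1 m1[symmetric] three three' q)
  show ?thesis
  proof
    show "finite V" "card V = 27" by (fact fin, fact cardV)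
    fix x y assume xy: "x \<in> V" "y \<in> V"
    show "?r x y = Same \<longleftrightarrow> x = y" unfolding r_simps by (rule same[OF xy])
    show "?r y x = rel_inverse_mod3 (?r x y)"
      unfolding path_config_sym[OF \<rho> xy] by (cases "\<rho> x y") (simp_all add: code_neg)
    show "card {z \<in> V. ?r x z = Fibre \<and> ?r z y = Fibre} = (case ?r x y of Same \<Rightarrow> 2 | Fibre \<Rightarrow> 1 | Cone _ \<Rightarrow> 0)"
      unfolding r_simps paths[OF xy] by (cases "\<rho> x y") (simp_all add: q)
    show "c \<in> {0, 1, 2}" if "?r x y = Cone c" for c
      using that code_range by (cases "\<rho> x y") auto
    fix d assume "?r x y = Cone d"
    then obtain d' where d: "\<rho> x y = Cone d'" "d = code3 d'" by (cases "\<rho> x y") auto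
    fix a :: int assume "a \<in> {0, 1, 2}"
    then obtain a' :: 'a where a: "a = code3 a'" using code_surj by blast
    show "card {z \<in> V. ?r x z = Cone a \<and> ?r z y = Fibre} = of_bool (d \<noteq> a)"
      unfolding a d(2) r_simps paths[OF xy] d(1) code_inj by simp
    fix b :: int assume "b \<in> {0, 1, 2}"
    then obtain b' :: 'a where b: "b = code3 b'" using code_surj by blast
    show "card {z \<in> V. ?r x z = Cone a \<and> ?r z y = Cone b} = paths3 a b d"
      unfolding a b d(2) r_simps paths[OF xy] d(1) by (rule paths_code)
  next
    fix x assume x: "x \<in> V"
    have eq: "{z \<in> V. ?r x z = Cone 0} = {z \<in> V. \<rho> x z = Cone 0 \<and> \<rho> z x = Cone 0}"
      using path_config_sym[OF \<rho> x] r_simps(3)[of _ 0] unfolding code(1) by auto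
    show "card {z \<in> V. ?r x z = Cone 0} = 8"
      using paths[OF x x] same[OF x x] unfolding eq by (simp add: q)
  qed
qed

text \<open>A pair of equal points lies on every cone, a fibre pair on none, any other pair on
  exactly one.\<close>

lemma cone_rels_determine_rel:
  assumes "\<And>a. cone_rel \<epsilon> a g h \<longleftrightarrow> cone_rel \<epsilon> a g' h'"
  shows "rel g h = rel g' h'"
proof -
  have 01: "(0::'a) \<noteq> 1" by simp
  have eq: "(rel g h = Same \<or> rel g h = Cone a) \<longleftrightarrow> (rel g' h' = Same \<or> rel g' h' = Cone a)" for a
    using assms[of a] unfolding cone_rel_iff_rel .
  show ?thesis
  proof (cases "rel g h")
    case Same
    then show ?thesis using eq[of 0] eq[of 1] 01 by (metis rel_type.inject)
  next
    case Fibre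
    then have "rel g' h' \<noteq> Same" "rel g' h' \<noteq> Cone a" for a using eq[of a] by auto
    then show ?thesis using Fibre by (cases "rel g' h'") auto
  next
    case (Cone a)
    then have "rel g' h' \<noteq> Same"
      using eq[of "a + 1"] by auto
    then show ?thesis using eq[of a] Cone by auto
  qed
qed

text \<open>Each pair of \<open>E\<close> borrows the class of a pair of the cone digraph with the
  same colour. This is well defined because colours at round \<open>m\<close> determine all cones;
  one further round supplies the bijection of midpoints that transfers the intersection
  numbers.\<close>

lemma wl2_equivalent_path_config:
  fixes E :: "'v pair_pre_digraph"
  assumes gen: "i \<in> psi_generators \<epsilon>" and E: "finite (pverts E)"
    and nd: "\<not> wl_distinguishes 2 (cone_digraph \<epsilon> i) E"
  obtains \<rho> where "path_config (pverts E) \<rho>"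
    "\<And>x y. x \<in> pverts E \<Longrightarrow> y \<in> pverts E \<Longrightarrow> (x, y) \<in> parcs E \<longleftrightarrow> \<rho> x y = Same \<or> \<rho> x y = Cone i"
proof -
  let ?D = "cone_digraph \<epsilon> i"
  let ?c = "wl_tuple_colour ?D" and ?d = "wl_tuple_colour E"
  have D: "finite (pverts ?D)" by simp
  obtain m where m: "\<And>xs ys a b j. \<lbrakk>length xs = 2; ?c m xs = ?c m ys; a < 2; b < 2\<rbrakk> \<Longrightarrow>
      cone_rel \<epsilon> j (xs ! a) (xs ! b) \<longleftrightarrow> cone_rel \<epsilon> j (ys ! a) (ys ! b)"
    using colours_recognise_cones[OF gen, of 2] by auto
  have det: "rel g h = rel g' h'" if "?c m [g, h] = ?c m [g', h']" for g h g' h'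
    by (rule cone_rels_determine_rel) (use m[OF _ that, of 0 1] in simp)
  define \<rho> where "\<rho> x y = (SOME s. \<exists>g h. s = rel g h \<and> ?c m [g, h] = ?d m [x, y])" for x y
  have \<rho>: "\<rho> x y = rel g h" if "?c m [g, h] = ?d m [x, y]" for x y g h
  proof -
    have "\<exists>s g h. s = rel g h \<and> ?c m [g, h] = ?d m [x, y]" using that by blast
    from someI_ex[OF this] obtain g' h' where "\<rho> x y = rel g' h'" "?c m [g', h'] = ?d m [x, y]"
      unfolding \<rho>_def by blast
    then show ?thesis using det[of g' h' g h] that by simp
  qed
  obtain H where H: "bij_betw H (vertex_tuples 2 ?D) (vertex_tuples 2 E)"
    and Heq: "\<And>xs. xs \<in> vertex_tuples 2 ?D \<Longrightarrow> ?c (Suc m) xs = ?d (Suc m) (H xs)"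
  proof (rule image_mset_set_eq_bij[OF finite_vertex_tuples[OF D] finite_vertex_tuples[OF E]])
    show "image_mset (?c (Suc m)) (mset_set (vertex_tuples 2 ?D)) =
        image_mset (?d (Suc m)) (mset_set (vertex_tuples 2 E))"
      using nd unfolding wl_distinguishes_def by (simp del: wl_tuple_colour.simps)
  qed blast
  have lift: "\<exists>g h. ?c (Suc m) [g, h] = ?d (Suc m) [x, y]" if "x \<in> pverts E" "y \<in> pverts E" for x y
  proof -
    have "[x, y] \<in> vertex_tuples 2 E" using that by (simp add: vertex_tuples_def)
    then have "[x, y] \<in> H ` vertex_tuples 2 ?D" by (simp only: bij_betw_imp_surj_on[OF H])
    then obtain xs where xs: "[x, y] = H xs" "xs \<in> vertex_tuples 2 ?D" by (rule imageE)
    from xs(2) obtain g h where gh: "xs = [g, h]" by (rule vertex_tuples_2E)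
    have "?c (Suc m) [g, h] = ?d (Suc m) [x, y]" using Heq[OF xs(2)] unfolding gh xs(1) .
    then show ?thesis by (intro exI)
  qed
  have walk: "\<exists>f g h. bij_betw f UNIV (pverts E) \<and> ?c (Suc m) [g, h] = ?d (Suc m) [x, y] \<and>
      (\<forall>v. \<rho> x (f v) = rel g v \<and> \<rho> (f v) y = rel v h)"
    if xy: "x \<in> pverts E" "y \<in> pverts E" for x y
  proof -
    obtain g h where gh: "?c (Suc m) [g, h] = ?d (Suc m) [x, y]" using lift[OF xy] by blast
    obtain f where f: "bij_betw f (pverts ?D) (pverts E)"
      and feq: "\<And>v a. v \<in> pverts ?D \<Longrightarrow> a < length [g, h] \<Longrightarrow> ?c m ([g, h][a := v]) = ?d m ([x, y][a := f v])"
      by (rule wl_tuple_colour_step[OF D E gh]) blast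
    have "\<rho> x (f v) = rel g v \<and> \<rho> (f v) y = rel v h" for v
      using feq[of v 0] feq[of v 1] \<rho> by simp
    then show ?thesis using f gh by (intro exI[of _ f] exI[of _ g] exI[of _ h]) simp
  qed
  have "[(0, 0, 0), (0, 0, 0)] \<in> vertex_tuples 2 ?D" by (simp add: vertex_tuples_def)
  then have "H [(0, 0, 0), (0, 0, 0)] \<in> vertex_tuples 2 E" using bij_betwE[OF H] by blast
  then obtain x0 where "x0 \<in> pverts E" by (rule vertex_tuples_2E)
  then obtain f where "bij_betw f (UNIV :: ('a \<times> 'a \<times> 'a) set) (pverts E)" using walk by blast
  then have card: "card (pverts E) = CARD('a) ^ 3"
    using bij_betw_same_card[of f UNIV "pverts E"] by (simp add: card_prod power3_eq_cube)
  have props: "(\<rho> x y = Same \<longleftrightarrow> x = y) \<and> ((x, y) \<in> parcs E \<longleftrightarrow> \<rho> x y = Same \<or> \<rho> x y = Cone i) \<and>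
      card {z \<in> pverts E. \<rho> x z = s \<and> \<rho> z y = t} = paths s t (\<rho> x y)"
    if xy: "x \<in> pverts E" "y \<in> pverts E" for x y s t
  proof -
    obtain f g h where f: "bij_betw f UNIV (pverts E)" and gh: "?c (Suc m) [g, h] = ?d (Suc m) [x, y]"
      and fv: "\<And>v. \<rho> x (f v) = rel g v" "\<And>v. \<rho> (f v) y = rel v h"
      using walk[OF xy] by blast
    have rho: "\<rho> x y = rel g h" by (rule \<rho>[OF wl_tuple_colour_mono[OF gh]]) simp
    note type = wl_tuple_colour_type[OF gh]
    have "g = h \<longleftrightarrow> x = y" using tuple_type_eqD(2)[OF type, of 0 1] by simp
    moreover have "cone_rel \<epsilon> i g h \<longleftrightarrow> (x, y) \<in> parcs E"
      using tuple_type_eqD(3)[OF type, of 0 1] by simp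
    moreover have "card {z \<in> pverts E. \<rho> x z = s \<and> \<rho> z y = t} = card {v. rel g v = s \<and> rel v h = t}"
    proof -
      have "{z \<in> pverts E. \<rho> x z = s \<and> \<rho> z y = t} = f ` {v. rel g v = s \<and> rel v h = t}"
        unfolding bij_betw_imp_surj_on[OF f, symmetric] by (auto simp: fv)
      moreover have "inj_on f {v. rel g v = s \<and> rel v h = t}"
        using f unfolding bij_betw_def by (auto intro: inj_on_subset)
      ultimately show ?thesis by (simp add: card_image)
    qed
    ultimately show ?thesis unfolding rho card_rel_paths cone_rel_iff_rel rel_eq_Same_iff by blast
  qed
  show ?thesis
  proof (rule that)
    show "path_config (pverts E) \<rho>" unfolding path_config_def using E card props by blast
    show "(x, y) \<in> parcs E \<longleftrightarrow> \<rho> x y = Same \<or> \<rho> x y = Cone i" if "x \<in> pverts E" "y \<in> pverts E" for x y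
      using props[OF that] by blast
  qed
qed

text \<open>An undistinguished \<open>E\<close> carries a configuration with the same intersection
  numbers. For q = 3 such configurations are isomorphic with all classes preserved, hence also the
  arcs, which are the union of \<open>Same\<close> and \<open>Cone i\<close>.\<close>

lemma wl_identifies_2:
  assumes gen: "i \<in> psi_generators \<epsilon>" and q: "CARD('a) = 3"
  shows "wl_identifies 2 (cone_digraph \<epsilon> i)"
  unfolding wl_identifies_def
proof (intro allI impI, elim conjE, rule ccontr)
  fix E :: "nat pair_pre_digraph"
  assume E: "pair_fin_digraph E" and noniso: "\<not> digraph_iso (with_proj (cone_digraph \<epsilon> i)) (with_proj E)"
    and nd: "\<not> wl_distinguishes 2 (cone_digraph \<epsilon> i) E"
  have fin: "finite (pverts E)" and wf: "pair_wf_digraph E" "pair_wf_digraph (cone_digraph \<epsilon> i)"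
    using E pair_fin_digraph_cone_digraph
    by (auto simp: pair_fin_digraph_def pair_fin_digraph_axioms_def)
  obtain \<rho> where \<rho>: "path_config (pverts E) \<rho>"
    and arc: "\<And>x y. x \<in> pverts E \<Longrightarrow> y \<in> pverts E \<Longrightarrow> (x, y) \<in> parcs E \<longleftrightarrow> \<rho> x y = Same \<or> \<rho> x y = Cone i"
    using wl2_equivalent_path_config[OF gen fin nd] by blast
  obtain f where f: "bij_betw f UNIV (pverts E)"
    and fr: "\<And>x y. map_rel_type code3 (\<rho> (f x) (f y)) = map_rel_type code3 (rel x y)"
    using config3.isomorphic[OF path_config_config3[OF q path_config_rel] path_config_config3[OF q \<rho>]]
    by blast
  have "inj (code3 :: 'a \<Rightarrow> int)" using code3_eq_iff[OF q] by (simp add: inj_def)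
  then have rel: "\<rho> (f x) (f y) = rel x y" for x y using fr[of x y] rel_type.inj_map by (metis injD)
  have "arc_isomorphism f (cone_digraph \<epsilon> i) E"
    unfolding arc_isomorphism_def
    using f arc bij_betwE[OF f] by (simp add: rel cone_rel_iff_rel del: rel_eq_Same_iff)
  then show False using noniso digraph_iso_iff[OF wf(2,1)] by blast
qed

lemma pair_wf_digraph_Gamma: "pair_wf_digraph (Gamma_digraph \<epsilon> i)"
proof -
  have "x \<in> carrier heisenberg_group" if "x \<in> X_set \<epsilon> i" for x
    using that by (auto simp: X_set_def Y_set_def heisenberg_group_def intro: heis_mat_0[symmetric])
  then have "x ** g \<in> carrier heisenberg_group"
    if "x \<in> X_set \<epsilon> i" "g \<in> carrier heisenberg_group" for x g
    using that unfolding heisenberg_group_def by (fastforce simp: heis_mat_mult)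
  then show ?thesis
    unfolding pair_wf_digraph_def Gamma_digraph_def cayley_digraph_def
    by (auto simp: heisenberg_group_def) blast
qed

end

theorem proposition4p4:
  fixes \<epsilon> i :: "'a::{field,finite}" and q :: nat
  assumes "CARD('a) = q" and "odd q"
    and "\<not> is_square \<epsilon>"
    and "i \<in> psi_generators \<epsilon>"
  shows "wl_dim (Gamma_digraph \<epsilon> i) \<le> 3 \<and>
    (q > 9 \<longrightarrow> wl_dim (Gamma_digraph \<epsilon> i) = 3) \<and>
    (q = 3 \<longrightarrow> wl_dim (Gamma_digraph \<epsilon> i) = 2)"
proof -
  interpret odd_nonsquare \<epsilon> by unfold_locales (use assms in auto)
  note gen = assms(4)
  let ?D = "cone_digraph \<epsilon> i"
  have "pair_wf_digraph ?D"
    using pair_fin_digraph_cone_digraph by (auto simp: pair_fin_digraph_def)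
  then have dim: "wl_dim (Gamma_digraph \<epsilon> i) = (LEAST k. 1 \<le> k \<and> wl_identifies k ?D)"
    using wl_dim_iso[OF Gamma_digraph_iso_cone_digraph _ pair_wf_digraph_Gamma] by (simp add: wl_dim_def)
  have not1: "\<not> wl_identifies 1 ?D" by (rule not_wl_identifies_1[OF generator_neq_0[OF gen]])
  have not2: "\<not> wl_identifies 2 ?D" if "q > 9"
    using not_wl_identifies_2[OF gen] that assms(1) by simp
  have le: "wl_dim (Gamma_digraph \<epsilon> i) \<le> 3"
    unfolding dim by (rule Least_le) (simp add: wl_identifies_3[OF gen])
  moreover have "wl_dim (Gamma_digraph \<epsilon> i) = 3" if "q > 9"
    unfolding dim
  proof (rule Least_equality)
    show "3 \<le> k" if k: "1 \<le> k \<and> wl_identifies k ?D" for k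
    proof -
      have "k \<noteq> 1" "k \<noteq> 2" using k not1 not2[OF \<open>q > 9\<close>] by auto
      then show ?thesis using k by linarith
    qed
  qed (simp add: wl_identifies_3[OF gen])
  moreover have "wl_dim (Gamma_digraph \<epsilon> i) = 2" if "q = 3"
    unfolding dim
  proof (rule Least_equality)
    show "1 \<le> (2::nat) \<and> wl_identifies 2 ?D" using wl_identifies_2[OF gen] that assms(1) by simp
    show "2 \<le> k" if k: "1 \<le> k \<and> wl_identifies k ?D" for k
    proof -
      have "k \<noteq> 1" using k not1 by auto
      then show ?thesis using k by linarith
    qed
  qed
  ultimately show ?thesis by blast
qed

end
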